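(* Assume (A1) and (A3) below. Then for every $D>0$, $$R_{\mathrm{pr}}(D,0)=R(D,0).$$ (A1) For each fixed $\mu\in\mathcal P(\mathcal X)$, the map $\nu\mapsto d(\mu,\nu)$ is convex. (A3) For every $D>0$ and $\epsilon>0$ there exist random variables $\tilde X$ and $\hat X$ on $\mathcal X$, jointly distributed with $X$, such that all of the following hold: - $\tilde X$ is discrete with finite support; - $X\leftrightarrow\tilde X\leftrightarrow\hat X$ is a Markov chain; - $I(X;\tilde X)\le R(D,0)+\epsilon$; - $\mathbb E[\Delta(X,\hat X)]\le D$; - $p_{\hat X}=p_X$.
   Context: Let $\mathcal X$ be a Polish metric space with its Borel $\sigma$-algebra, and let $\mathcal P(\mathcal X)$ be the set of Borel probability measures on $\mathcal X$. Let $X\sim p_X\in\mathcal P(\mathcal X)$, and let $\{X_t\}_{t\ge1}$ be i.i.d. with marginal $p_X$. Let $\Delta:\mathcal X\times\mathcal X\to[0,\infty)$ be a measurable distortion function with $\Delta(x,\hat x)=0$ iff $x=\hat x$. Let $d:\mathcal P(\mathcal X)\times\mathcal P(\mathcal X)\to[0,\infty]$ be a divergence with $d(\mu,\nu)=0$ iff $\mu=\nu$. The rate-distortion-perception function is $$R(D,P):=\inf I(X;\hat X),$$ where the infimum is over Markov kernels $p_{\hat X|X}$ from $\mathcal X$ to $\mathcal X$ with $\mathbb E[\Delta(X,\hat X)]\le D$ and $d(p_X,p_{\hat X})\le P$. Thus $R(D,0)$ is the infimum of $I(X;\hat X)$ subject to $\mathbb E[\Delta(X,\hat X)]\le D$ and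 $p_{\hat X}=p_X$. Operational definition. A rate $R$ is achievable with private randomness if, for all sufficiently large $n$, there exist: - an encoder kernel $p_{Z|X^n}$ with $Z$ taking values in a countable set; - a decoder kernel $p_{\hat X^n|Z}$ with $\hat X^n\in\mathcal X^n$; such that, under $p_X^np_{Z|X^n}p_{\hat X^n|Z}$, the following hold: - $\frac1nH(Z)\le R$; - $\frac1n\sum_{t=1}^n\mathbb E[\Delta(X_t,\hat X_t)]\le D$; - $d(p_X,p_{\hat X_t})\le P$ for all $t\in[1:n]$. $R_{\mathrm{pr}}(D,P)$ is the infimum of such $R$. *)

theory Defs
  imports "HOL-Probability.Probability"
begin

text \<open>Relative entropy D(P||Q) = integral of f ln f dQ with f = dP/dQ if P is
  absolutely continuous w.r.t. Q, and \<infinity> otherwise.  The integral is the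
  extended one (positive part minus negative part; the negative part is finite).\<close>
definition KL_ext :: "'a measure \<Rightarrow> 'a measure \<Rightarrow> ereal" where
  "KL_ext P Q =
    (if absolutely_continuous Q P then
       (let f = (\<lambda>x. enn2real (RN_deriv Q P x)) in
          enn2ereal (\<integral>\<^sup>+ x. ennreal (f x * ln (f x)) \<partial>Q)
        - enn2ereal (\<integral>\<^sup>+ x. ennreal (- (f x * ln (f x))) \<partial>Q))
     else \<infinity>)"

definition mutual_info :: "('x::topological_space \<times> 'x) measure \<Rightarrow> ereal" where
  "mutual_info J = KL_ext J (distr J borel fst \<Otimes>\<^sub>M distr J borel snd)"

definition disc_entropy :: "nat measure \<Rightarrow> ennreal" where
  "disc_entropy \<mu> = (\<Sum>z. ennreal (- (measure \<mu> {z} * ln (measure \<mu> {z}))))"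

definition joint :: "'x::topological_space measure \<Rightarrow> ('x \<Rightarrow> 'x measure) \<Rightarrow> ('x \<times> 'x) measure" where
  "joint pX K = pX \<bind> (\<lambda>x. distr (K x) (borel \<Otimes>\<^sub>M borel) (Pair x))"

definition RDP :: "'x::topological_space measure \<Rightarrow> ('x \<Rightarrow> 'x \<Rightarrow> real)
    \<Rightarrow> ('x measure \<Rightarrow> 'x measure \<Rightarrow> ennreal) \<Rightarrow> real \<Rightarrow> real \<Rightarrow> ereal" where
  "RDP pX \<Delta> d D P =
     (INF K \<in> {K. K \<in> borel \<rightarrow>\<^sub>M prob_algebra borel
               \<and> enn2ereal (\<integral>\<^sup>+ p. ennreal (\<Delta> (fst p) (snd p)) \<partial>(joint pX K)) \<le> ereal D
               \<and> enn2ereal (d pX (pX \<bind> K)) \<le> ereal P}.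
        mutual_info (joint pX K))"

text \<open>Blocks x^n are elements of PiM {..<n} (index t ranges over 0..n-1);
  the countable index set of Z is represented by nat.\<close>
definition achievable_pr :: "'x::topological_space measure \<Rightarrow> ('x \<Rightarrow> 'x \<Rightarrow> real)
    \<Rightarrow> ('x measure \<Rightarrow> 'x measure \<Rightarrow> ennreal) \<Rightarrow> real \<Rightarrow> real \<Rightarrow> real \<Rightarrow> bool" where
  "achievable_pr pX \<Delta> d D P R \<longleftrightarrow>
    (\<forall>\<^sub>F n in sequentially. \<exists>(E :: (nat \<Rightarrow> 'x) \<Rightarrow> nat measure) (G :: nat \<Rightarrow> (nat \<Rightarrow> 'x) measure).
       E \<in> PiM {..<n} (\<lambda>_. borel) \<rightarrow>\<^sub>M prob_algebra (count_space UNIV) \<and>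
       G \<in> count_space UNIV \<rightarrow>\<^sub>M prob_algebra (PiM {..<n} (\<lambda>_. borel)) \<and>
       (let Xn = PiM {..<n} (\<lambda>_. pX);
            J = Xn \<bind> (\<lambda>x. E x \<bind> (\<lambda>z. distr (G z)
                   (PiM {..<n} (\<lambda>_. borel) \<Otimes>\<^sub>M PiM {..<n} (\<lambda>_. borel)) (Pair x)))
        in enn2ereal (disc_entropy (Xn \<bind> E)) / ereal (real n) \<le> ereal R
         \<and> (\<Sum>t<n. enn2ereal (\<integral>\<^sup>+ p. ennreal (\<Delta> (fst p t) (snd p t)) \<partial>J)) / ereal (real n)
              \<le> ereal D
         \<and> (\<forall>t<n. enn2ereal (d pX (distr J borel (\<lambda>p. snd p t))) \<le> ereal P)))"

definition R_pr :: "'x::topological_space measure \<Rightarrow> ('x \<Rightarrow> 'x \<Rightarrow> real)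
    \<Rightarrow> ('x measure \<Rightarrow> 'x measure \<Rightarrow> ennreal) \<Rightarrow> real \<Rightarrow> real \<Rightarrow> ereal" where
  "R_pr pX \<Delta> d D P = Inf {ereal R | R. achievable_pr pX \<Delta> d D P R}"

definition mix_measure :: "real \<Rightarrow> 'a measure \<Rightarrow> 'a measure \<Rightarrow> 'a measure" where
  "mix_measure l \<nu>1 \<nu>2 = measure_of (space \<nu>1) (sets \<nu>1)
      (\<lambda>A. ennreal l * emeasure \<nu>1 A + ennreal (1 - l) * emeasure \<nu>2 A)"

definition A1 :: "('x::topological_space measure \<Rightarrow> 'x measure \<Rightarrow> ennreal) \<Rightarrow> bool" where
  "A1 d \<longleftrightarrow> (\<forall>\<mu>\<in>space (prob_algebra borel). \<forall>\<nu>1\<in>space (prob_algebra borel).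
      \<forall>\<nu>2\<in>space (prob_algebra borel). \<forall>l\<in>{0..1::real}.
        d \<mu> (mix_measure l \<nu>1 \<nu>2) \<le> ennreal l * d \<mu> \<nu>1 + ennreal (1 - l) * d \<mu> \<nu>2)"

text \<open>(A3): Xtilde ~ kernel q from X, Xhat ~ kernel r from Xtilde (Markov chain
  X - Xtilde - Xhat), Xtilde supported on a finite set S.\<close>
definition A3 :: "'x::topological_space measure \<Rightarrow> ('x \<Rightarrow> 'x \<Rightarrow> real)
    \<Rightarrow> ('x measure \<Rightarrow> 'x measure \<Rightarrow> ennreal) \<Rightarrow> bool" where
  "A3 pX \<Delta> d \<longleftrightarrow> (\<forall>D>0. \<forall>\<epsilon>>0. \<exists>S q r.
      q \<in> borel \<rightarrow>\<^sub>M prob_algebra borel \<and> r \<in> borel \<rightarrow>\<^sub>M prob_algebra borel \<and>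
      finite S \<and> emeasure (pX \<bind> q) S = 1 \<and>
      mutual_info (joint pX q) \<le> RDP pX \<Delta> d D 0 + ereal \<epsilon> \<and>
      enn2ereal (\<integral>\<^sup>+ p. ennreal (\<Delta> (fst p) (snd p)) \<partial>(joint pX (\<lambda>x. q x \<bind> r))) \<le> ereal D \<and>
      pX \<bind> q \<bind> r = pX)"

end

theory Submission
  imports Defs
begin

text \<open>
  Converse: given \<open>Z = z\<close>, the law of \<open>X\<^sub>t\<close> has a density \<open>f\<close> with respect to \<open>pX\<close>, and perfect
  realism forces the same for the output.  Averaging the single-letter joint laws over \<open>t\<close>
  gives a feasible kernel; Jensen bounds its mutual information by the mean of
  \<open>\<Sum>t. KL(X\<^sub>t | Z = z)\<close>, which is at most \<open>- ln P(Z = z)\<close> because the density of \<open>X^n\<close> given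
  \<open>Z = z\<close> is at most \<open>1 / P(Z = z)\<close>.

  Achievability: take a likelihood encoder for a codebook with soft covering whose columns have
  nearly the right letter frequencies, scaled down by a factor just below 1.  Then
  the joint density of \<open>X\<^sub>t\<close> and the \<open>t\<close>-th code letter is dominated by that of the target
  coupling.  With the small remaining probability the encoder sends an uncoded word, each
  letter being drawn from the normalised deficit, so that every \<open>(X\<^sub>t, letter)\<close> has exactly
  the target law: distortion and output marginals are exact, and only the rate is asymptotic.
\<close>

text \<open>No continuity of \<open>d\<close> and no bound on \<open>\<Delta>\<close> is available,
  so a code whose output laws or distortion are only nearly right could not be corrected afterwards:
  every error has to be moved into the rate. Repair by an uncoded word needs the deficit to be
  nonnegative pointwise; closeness in total variation would not be enough. Two devices secure this.
  The posterior weight \<open>lr / (M * L)\<close> of the likelihood encoder gets the denominator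
  \<open>M * max 1 L\<close>, so each index weight is at most a multiple of its likelihood ratio,
  for any codebook. And no column frequency exceeds \<open>p s\<close> by more than the factor
  \<open>1 + \<eta>\<close>, which the scaling \<open>\<alpha> = (1 - \<eta>) / (1 + \<eta>)\<close>
  absorbs with a margin. An uncoded word costs at most \<open>ln (card S)\<close> nats per letter,
  so the fallback probability need not vanish quickly; a small constant suffices. This is one use of
  finite support; the other is that it bounds the exponential moments in the Chernoff estimate. In
  the converse, exact realism also makes \<open>pX \<Otimes>\<^sub>M pX\<close> the product of the
  marginals, so all densities refer to one fixed measure.\<close>

section \<open>Relative entropy\<close>

text \<open>The integrand \<open>a ln a\<close> corrected to be nonnegative, so that KL is an \<open>ennreal\<close> integral.\<close>
definition psi :: "real \<Rightarrow> real" where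
  "psi a = a * ln a - a + 1"

lemma psi_measurable [measurable]: "psi \<in> borel_measurable borel"
  unfolding psi_def by measurable

text \<open>\<open>psi\<close> is convex with derivative \<open>ln\<close>, and this is its tangent
  at \<open>h\<close>: after cancellation it reads \<open>a * (ln h - ln a) \<le> h - a\<close>,
  which is \<open>ln u \<le> u - 1\<close> at \<open>u = h / a\<close>. It serves as nonnegativity
  (\<open>h = 1\<close>), as the source of Jensen's inequality, and as Gibbs' inequality for the
  entropy of the index.\<close>

lemma psi_tangent:
  assumes "0 \<le> a" "0 < h"
  shows "psi h + ln h * (a - h) \<le> psi a"
proof (cases "a = 0")
  case True
  then show ?thesis using assms by (simp add: psi_def algebra_simps)
next
  case False
  then have a: "a > 0" using assms by simp
  have "ln (h / a) \<le> h / a - 1"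
    using a assms by (intro ln_le_minus_one) simp
  then have "a * (ln h - ln a) \<le> a * (h / a - 1)"
    using a assms by (intro mult_left_mono) (simp_all add: ln_div)
  also have "\<dots> = h - a" using a by (simp add: field_simps)
  finally show ?thesis by (simp add: psi_def algebra_simps)
qed

lemma psi_nonneg: "0 \<le> a \<Longrightarrow> 0 \<le> psi a"
  using psi_tangent[of a 1] by (simp add: psi_def)

text \<open>Since \<open>h\<close> and the constant 1 have the same integral, passing from
  \<open>h ln h\<close> to \<open>psi h\<close> leaves the total unchanged but makes the integrand
  nonnegative. The difference of two extended integrals in \<open>KL_ext\<close> thus becomes a
  single, possibly infinite, integral.\<close>

lemma KL_ext_density:
  fixes h :: "'a \<Rightarrow> real"
  assumes Q: "prob_space Q"
    and h [measurable]: "h \<in> borel_measurable Q"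
    and pos: "\<And>x. 0 \<le> h x"
    and P: "(\<integral>\<^sup>+ x. ennreal (h x) \<partial>Q) = 1"
  shows "KL_ext (density Q (\<lambda>x. ennreal (h x))) Q = enn2ereal (\<integral>\<^sup>+ x. ennreal (psi (h x)) \<partial>Q)"
proof -
  interpret prob_space Q by fact
  let ?P = "density Q (\<lambda>x. ennreal (h x))"
  define f where "f = (\<lambda>x. enn2real (RN_deriv Q ?P x))"
  have "AE x in Q. ennreal (h x) = RN_deriv Q ?P x"
    by (intro RN_deriv_unique) auto
  then have fh: "AE x in Q. f x = h x"
  proof eventually_elim
    case (elim x)
    have "f x = enn2real (ennreal (h x))" unfolding f_def elim ..
    then show ?case using pos[of x] by simp
  qed
  have ac: "absolutely_continuous Q ?P"
  proof (unfold absolutely_continuous_def, rule subsetI)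
    fix A assume A: "A \<in> null_sets Q"
    have "AE x in Q. x \<in> A \<longrightarrow> ennreal (h x) = 0"
      using AE_not_in[OF A] by eventually_elim simp
    with A show "A \<in> null_sets ?P" by (simp add: null_sets_density_iff null_setsD2)
  qed
  define A where "A = (\<integral>\<^sup>+ x. ennreal (h x * ln (h x)) \<partial>Q)"
  define B where "B = (\<integral>\<^sup>+ x. ennreal (- (h x * ln (h x))) \<partial>Q)"
  define C where "C = (\<integral>\<^sup>+ x. ennreal (psi (h x)) \<partial>Q)"
  have KL: "KL_ext ?P Q = enn2ereal A - enn2ereal B"
  proof -
    have "(\<integral>\<^sup>+ x. ennreal (f x * ln (f x)) \<partial>Q) = A"
      unfolding A_def by (intro nn_integral_cong_AE) (use fh in eventually_elim, simp)
    moreover have "(\<integral>\<^sup>+ x. ennreal (- (f x * ln (f x))) \<partial>Q) = B"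
      unfolding B_def by (intro nn_integral_cong_AE) (use fh in eventually_elim, simp)
    ultimately show ?thesis
      using ac by (simp add: KL_ext_def f_def[symmetric] Let_def)
  qed
  \<comment> \<open>\<open>psi \<ge> 0\<close> gives \<open>- h ln h \<le> 1 - h\<close>, so the
    negative part \<open>B\<close> is finite and may be subtracted.\<close>
  have neg: "- (h x * ln (h x)) \<le> 1" for x
    using psi_nonneg[OF pos[of x]] pos[of x] unfolding psi_def by simp
  have "B \<le> (\<integral>\<^sup>+ x. 1 \<partial>Q)"
    unfolding B_def using neg by (intro nn_integral_mono) (simp add: ennreal_le_1)
  then have Bfin: "B \<noteq> \<infinity>"
    by (auto simp: emeasure_space_1 top_unique)
  \<comment> \<open>Writing the identity with nonnegative terms only avoids any integrability
    assumption on \<open>h ln h\<close>; the mass 1 on both sides is then cancelled.\<close>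
  have "C + B + 1 = (\<integral>\<^sup>+ x. ennreal (psi (h x)) + ennreal (- (h x * ln (h x))) + ennreal (h x) \<partial>Q)"
    unfolding C_def B_def using P by (simp add: nn_integral_add)
  also have "\<dots> = (\<integral>\<^sup>+ x. ennreal (h x * ln (h x)) + 1 \<partial>Q)"
  proof (intro nn_integral_cong)
    fix x
    have *: "0 \<le> psi (h x)" "0 \<le> h x" by (simp_all add: pos psi_nonneg)
    show "ennreal (psi (h x)) + ennreal (- (h x * ln (h x))) + ennreal (h x) = ennreal (h x * ln (h x)) + 1"
    proof (cases "h x * ln (h x) \<ge> 0")
      case True
      then show ?thesis using *
        by (simp add: ennreal_neg ennreal_plus[symmetric] ennreal_1[symmetric] del: ennreal_plus ennreal_1)
           (simp add: psi_def)
    next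
      case False
      then show ?thesis using *
        by (simp add: ennreal_neg ennreal_plus[symmetric] ennreal_1[symmetric] del: ennreal_plus ennreal_1)
           (simp add: psi_def)
    qed
  qed
  also have "\<dots> = A + 1"
    unfolding A_def by (simp add: nn_integral_add emeasure_space_1)
  finally have "A = C + B"
    using ennreal_add_left_cancel[of 1 A "C + B"] by (simp add: add.commute)
  with Bfin have "enn2ereal A - enn2ereal B = enn2ereal C"
    by (cases B; cases C) (auto simp: plus_ennreal.rep_eq ennreal.rep_eq simp flip: ennreal_plus)
  with KL show ?thesis by (simp add: C_def)
qed

text \<open>The tangent inequality at the mean \<open>h\<close> is averaged over the weights. At
  \<open>h = 0\<close> there is no tangent, but then every \<open>w z * f z\<close> vanishes and
  both sides are 1. An infinite right side is trivial, so the sums can be treated as real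
  series.\<close>

lemma psi_jensen:
  fixes w f :: "nat \<Rightarrow> real"
  assumes w: "\<And>z. 0 \<le> w z" "(\<Sum>z. ennreal (w z)) = 1"
    and f: "\<And>z. 0 \<le> f z"
    and h: "0 \<le> h" "(\<Sum>z. ennreal (w z * f z)) = ennreal h"
  shows "ennreal (psi h) \<le> (\<Sum>z. ennreal (w z * psi (f z)))"
proof (cases "(\<Sum>z. ennreal (w z * psi (f z))) = top")
  case False
  have nn: "0 \<le> w z * f z" "0 \<le> w z * psi (f z)" for z
    by (simp_all add: w f psi_nonneg)
  have sw: "w sums 1"
  proof -
    have "summable w"
      using w by (intro summable_suminf_not_top) auto
    moreover have "ennreal (suminf w) = 1"
      using w(2) suminf_ennreal2[OF w(1) \<open>summable w\<close>] by simp
    ultimately show ?thesis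
      by (simp add: sums_iff)
  qed
  have sf: "(\<lambda>z. w z * f z) sums h"
  proof -
    have s: "summable (\<lambda>z. w z * f z)"
      using nn h by (intro summable_suminf_not_top) auto
    have "ennreal (\<Sum>z. w z * f z) = ennreal h"
      using h(2) suminf_ennreal2[OF nn(1) s] by simp
    then show ?thesis
      using s h(1) suminf_nonneg[OF s nn(1)] by (simp add: sums_iff)
  qed
  have sp: "summable (\<lambda>z. w z * psi (f z))"
    using nn False by (intro summable_suminf_not_top) auto
  have "psi h \<le> (\<Sum>z. w z * psi (f z))"
  proof (cases "h = 0")
    case True
    have "w z * f z = 0" for z
      using sf True suminf_eq_zero_iff[of "\<lambda>z. w z * f z"] nn(1) by (auto simp: sums_iff)
    then have "w z * psi (f z) = w z" for z
      by (cases "f z = 0") (auto simp: psi_def)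
    then have "(\<lambda>z. w z * psi (f z)) = w" by auto
    then show ?thesis using sw True by (simp add: sums_iff psi_def[of 0])
  next
    case False
    then have hp: "h > 0" using h by simp
    have "(\<lambda>z. w z * (psi h - ln h * h) + ln h * (w z * f z)) sums (1 * (psi h - ln h * h) + ln h * h)"
      by (intro sums_add sums_mult2 sums_mult sw sf)
    then have s: "(\<lambda>z. w z * (psi h + ln h * (f z - h))) sums psi h"
      by (simp add: algebra_simps)
    show ?thesis
      using s sp psi_tangent[OF f hp] w(1)
      by (intro sums_le[OF _ s summable_sums[OF sp]] mult_left_mono) auto
  qed
  then show ?thesis
    using suminf_ennreal2[OF nn(2) sp] by (simp add: ennreal_leI)
qed simp

section \<open>Kernels and joint laws\<close>

lemma nn_integral_bind_prob_algebra:
  assumes A: "A \<in> space (prob_algebra N)"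
    and B: "B \<in> N \<rightarrow>\<^sub>M prob_algebra L"
    and f: "f \<in> borel_measurable L"
  shows "(\<integral>\<^sup>+ x. f x \<partial>(A \<bind> B)) = (\<integral>\<^sup>+ x. \<integral>\<^sup>+ y. f y \<partial>B x \<partial>A)"
  using A B by (intro nn_integral_bind[OF f])
    (auto simp: space_prob_algebra measurable_prob_algebraD cong: measurable_cong_sets)

lemma joint_kernel_measurable:
  fixes K :: "'x::topological_space \<Rightarrow> 'x measure"
  assumes [measurable]: "K \<in> borel \<rightarrow>\<^sub>M prob_algebra borel"
  shows "(\<lambda>x. distr (K x) (borel \<Otimes>\<^sub>M borel) (Pair x)) \<in> borel \<rightarrow>\<^sub>M prob_algebra (borel \<Otimes>\<^sub>M borel)"
  by (rule measurable_distr_prob_space2[where M=borel]) measurable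

lemma nn_integral_joint:
  fixes K :: "'x::topological_space \<Rightarrow> 'x measure"
  assumes pX: "pX \<in> space (prob_algebra borel)"
    and K: "K \<in> borel \<rightarrow>\<^sub>M prob_algebra borel"
    and f [measurable]: "f \<in> borel_measurable (borel \<Otimes>\<^sub>M borel)"
  shows "(\<integral>\<^sup>+ p. f p \<partial>joint pX K) = (\<integral>\<^sup>+ x. \<integral>\<^sup>+ y. f (x, y) \<partial>K x \<partial>pX)"
  unfolding joint_def
  apply (subst nn_integral_bind_prob_algebra[OF pX joint_kernel_measurable[OF K] f])
  apply (intro nn_integral_cong)
  subgoal for x
    using measurable_space[OF K, of x]
    by (subst nn_integral_distr) (auto simp: space_prob_algebra cong: measurable_cong_sets)
  done

lemma joint_in_prob_algebra:
  fixes K :: "'x::topological_space \<Rightarrow> 'x measure"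
  assumes pX: "pX \<in> space (prob_algebra borel)"
    and K: "K \<in> borel \<rightarrow>\<^sub>M prob_algebra borel"
  shows "joint pX K \<in> space (prob_algebra (borel \<Otimes>\<^sub>M borel))"
  using sets_bind'[OF pX joint_kernel_measurable[OF K]] prob_space_bind'[OF pX joint_kernel_measurable[OF K]]
  by (simp add: joint_def space_prob_algebra)

lemma measure_eqI_nn_integral:
  assumes S: "sets M = sets L" "sets N = sets L"
    and eq: "\<And>f. f \<in> borel_measurable L \<Longrightarrow> (\<integral>\<^sup>+ x. f x \<partial>M) = (\<integral>\<^sup>+ x. f x \<partial>N)"
  shows "M = N"
proof (rule measure_eqI)
  fix A assume "A \<in> sets M"
  then have "A \<in> sets L" "A \<in> sets N" "A \<in> sets M" using S by auto
  then show "emeasure M A = emeasure N A"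
    using eq[of "indicator A"] by simp
qed (simp add: S)

lemma nn_integral_distr_joint:
  fixes K :: "'x::topological_space \<Rightarrow> 'x measure"
  assumes pX: "pX \<in> space (prob_algebra borel)"
    and K: "K \<in> borel \<rightarrow>\<^sub>M prob_algebra borel"
    and \<pi> [measurable]: "\<pi> \<in> borel \<Otimes>\<^sub>M borel \<rightarrow>\<^sub>M borel" and [measurable]: "f \<in> borel_measurable borel"
  shows "(\<integral>\<^sup>+ x. f x \<partial>distr (joint pX K) borel \<pi>) = (\<integral>\<^sup>+ x. \<integral>\<^sup>+ y. f (\<pi> (x, y)) \<partial>K x \<partial>pX)"
proof -
  have s: "sets (joint pX K) = sets (borel \<Otimes>\<^sub>M borel)"
    using joint_in_prob_algebra[OF pX K] by (simp add: space_prob_algebra)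
  have "(\<integral>\<^sup>+ x. f x \<partial>distr (joint pX K) borel \<pi>) = (\<integral>\<^sup>+ p. f (\<pi> p) \<partial>joint pX K)"
    using \<pi> by (intro nn_integral_distr) (auto simp: measurable_cong_sets[OF s refl])
  also have "\<dots> = (\<integral>\<^sup>+ x. \<integral>\<^sup>+ y. f (\<pi> (x, y)) \<partial>K x \<partial>pX)"
    by (rule nn_integral_joint[OF pX K]) measurable
  finally show ?thesis .
qed

lemma distr_fst_joint:
  fixes K :: "'x::topological_space \<Rightarrow> 'x measure"
  assumes pX: "pX \<in> space (prob_algebra borel)"
    and K: "K \<in> borel \<rightarrow>\<^sub>M prob_algebra borel"
  shows "distr (joint pX K) borel fst = pX"
proof (rule measure_eqI_nn_integral[where L=borel])
  fix f :: "'x \<Rightarrow> ennreal" assume [measurable]: "f \<in> borel_measurable borel"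
  show "(\<integral>\<^sup>+ x. f x \<partial>distr (joint pX K) borel fst) = (\<integral>\<^sup>+ x. f x \<partial>pX)"
    using measurable_space[OF K] by (subst nn_integral_distr_joint[OF pX K])
      (auto simp: space_prob_algebra prob_space.emeasure_space_1 intro!: nn_integral_cong)
qed (use pX in \<open>auto simp: space_prob_algebra\<close>)

lemma distr_snd_joint:
  fixes K :: "'x::topological_space \<Rightarrow> 'x measure"
  assumes pX: "pX \<in> space (prob_algebra borel)"
    and K: "K \<in> borel \<rightarrow>\<^sub>M prob_algebra borel"
  shows "distr (joint pX K) borel snd = pX \<bind> K"
proof (rule measure_eqI_nn_integral[where L=borel])
  fix f :: "'x \<Rightarrow> ennreal" assume f: "f \<in> borel_measurable borel"
  show "(\<integral>\<^sup>+ x. f x \<partial>distr (joint pX K) borel snd) = (\<integral>\<^sup>+ x. f x \<partial>(pX \<bind> K))"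
    using nn_integral_distr_joint[OF pX K _ f, of snd] nn_integral_bind_prob_algebra[OF pX K f] by simp
qed (use sets_bind'[OF pX K] in auto)

text \<open>The density is described by its action on integrals because that is the form in which
  Fubini delivers it, both for couplings with a density and for kernels on finitely many
  points.\<close>

lemma mutual_info_joint:
  fixes K :: "'x::topological_space \<Rightarrow> 'x measure"
  assumes pX: "pX \<in> space (prob_algebra borel)"
    and K: "K \<in> borel \<rightarrow>\<^sub>M prob_algebra borel"
    and h [measurable]: "h \<in> borel_measurable (borel \<Otimes>\<^sub>M borel)"
    and pos: "\<And>p. 0 \<le> h p"
    and eq: "\<And>f. f \<in> borel_measurable (borel \<Otimes>\<^sub>M borel) \<Longrightarrow>
      (\<integral>\<^sup>+ p. f p \<partial>joint pX K) = (\<integral>\<^sup>+ p. ennreal (h p) * f p \<partial>(pX \<Otimes>\<^sub>M (pX \<bind> K)))"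
  shows "mutual_info (joint pX K) = enn2ereal (\<integral>\<^sup>+ p. ennreal (psi (h p)) \<partial>(pX \<Otimes>\<^sub>M (pX \<bind> K)))"
proof -
  interpret X: prob_space pX using pX by (simp add: space_prob_algebra)
  interpret Y: prob_space "pX \<bind> K" using prob_space_bind'[OF pX K] .
  interpret XY: pair_prob_space pX "pX \<bind> K" ..
  interpret J: prob_space "joint pX K"
    using joint_in_prob_algebra[OF pX K] by (simp add: space_prob_algebra)
  have s: "sets (pX \<Otimes>\<^sub>M (pX \<bind> K)) = sets (borel \<Otimes>\<^sub>M borel)"
    using sets_bind'[OF pX K] pX by (auto simp: space_prob_algebra intro!: sets_pair_measure_cong)
  note [measurable_cong] = s
  have sj: "sets (joint pX K) = sets (borel \<Otimes>\<^sub>M borel)"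
    using joint_in_prob_algebra[OF pX K] by (simp add: space_prob_algebra)
  have J: "joint pX K = density (pX \<Otimes>\<^sub>M (pX \<bind> K)) (\<lambda>p. ennreal (h p))"
    by (rule measure_eqI_nn_integral[where L="borel \<Otimes>\<^sub>M borel"])
       (auto simp: eq s sj nn_integral_density)
  have "(\<integral>\<^sup>+ p. ennreal (h p) \<partial>(pX \<Otimes>\<^sub>M (pX \<bind> K))) = 1"
    using eq[of "\<lambda>_. 1"] by (simp add: J.emeasure_space_1)
  then show ?thesis
    unfolding mutual_info_def distr_fst_joint[OF pX K] distr_snd_joint[OF pX K]
    by (subst J) (intro KL_ext_density XY.prob_space_axioms, auto simp: pos)
qed

lemma density_kernel_measurable:
  fixes h :: "'x::topological_space \<Rightarrow> 'x \<Rightarrow> real"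
  assumes pX: "pX \<in> space (prob_algebra borel)"
    and h [measurable]: "case_prod h \<in> borel_measurable (borel \<Otimes>\<^sub>M borel)"
    and one: "\<And>x. (\<integral>\<^sup>+ y. ennreal (h x y) \<partial>pX) = 1"
  shows "(\<lambda>x. density pX (\<lambda>y. ennreal (h x y))) \<in> borel \<rightarrow>\<^sub>M prob_algebra borel"
proof -
  interpret X: prob_space pX using pX by (simp add: space_prob_algebra)
  have [measurable_cong]: "sets pX = sets borel" using pX by (simp add: space_prob_algebra)
  have ps: "prob_space (density pX (\<lambda>y. ennreal (h x y)))" for x
    by (rule prob_spaceI) (simp add: emeasure_density one cong: nn_integral_cong_simp)
  have "(\<lambda>x. density pX (\<lambda>y. ennreal (h x y))) \<in> borel \<rightarrow>\<^sub>M subprob_algebra borel"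
  proof (rule measurable_subprob_algebra)
    fix A :: "'x set" assume [measurable]: "A \<in> sets borel"
    have "(\<lambda>x. \<integral>\<^sup>+ y. ennreal (h x y) * indicator A y \<partial>pX) \<in> borel_measurable borel"
      by measurable
    then show "(\<lambda>x. emeasure (density pX (\<lambda>y. ennreal (h x y))) A) \<in> borel_measurable borel"
      by (simp add: emeasure_density)
  qed (use pX ps in \<open>auto simp: space_prob_algebra intro: prob_space_imp_subprob_space\<close>)
  then show ?thesis
    unfolding prob_algebra_def by (intro measurable_restrict_space2) (auto simp: ps)
qed

text \<open>The bridge to the single-letter problem. The row condition turns the coupling density
  into a kernel; the column condition makes its output law \<open>pX\<close>, which settles the
  perception constraint through \<open>d pX pX = 0\<close> and makes
  \<open>pX \<Otimes>\<^sub>M pX\<close> the reference measure of the mutual information.\<close>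

lemma RDP_le:
  fixes h :: "'x::topological_space \<Rightarrow> 'x \<Rightarrow> real"
  assumes pX: "pX \<in> space (prob_algebra borel)"
    and \<Delta> [measurable]: "(\<lambda>p. \<Delta> (fst p) (snd p)) \<in> borel_measurable (borel \<Otimes>\<^sub>M borel)"
    and h [measurable]: "case_prod h \<in> borel_measurable (borel \<Otimes>\<^sub>M borel)"
    and pos: "\<And>x y. 0 \<le> h x y"
    and h1: "AE x in pX. (\<integral>\<^sup>+ y. ennreal (h x y) \<partial>pX) = 1"
    and h2: "AE y in pX. (\<integral>\<^sup>+ x. ennreal (h x y) \<partial>pX) = 1"
    and dist: "enn2ereal (\<integral>\<^sup>+ x. \<integral>\<^sup>+ y. ennreal (h x y) * ennreal (\<Delta> x y) \<partial>pX \<partial>pX) \<le> ereal D"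
    and d: "d pX pX = 0"
  shows "RDP pX \<Delta> d D 0 \<le> enn2ereal (\<integral>\<^sup>+ x. \<integral>\<^sup>+ y. ennreal (psi (h x y)) \<partial>pX \<partial>pX)"
proof -
  interpret X: prob_space pX using pX by (simp add: space_prob_algebra)
  interpret XX: pair_prob_space pX pX ..
  have spX[measurable_cong]: "sets pX = sets borel" using pX by (simp add: space_prob_algebra)
  \<comment> \<open>A kernel must be a probability measure for every \<open>x\<close>, while the
    rows integrate to 1 only almost everywhere; exceptional rows get the density 1, that is, the
    output law \<open>pX\<close>.\<close>
  define k where "k = (\<lambda>x y. if (\<integral>\<^sup>+ y. ennreal (h x y) \<partial>pX) = 1 then h x y else 1)"
  have k[measurable]: "case_prod k \<in> borel_measurable (borel \<Otimes>\<^sub>M borel)"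
    unfolding k_def by measurable
  have k_pos: "0 \<le> k x y" for x y by (simp add: k_def pos)
  have k_one: "(\<integral>\<^sup>+ y. ennreal (k x y) \<partial>pX) = 1" for x
    by (cases "(\<integral>\<^sup>+ y. ennreal (h x y) \<partial>pX) = 1") (simp_all add: k_def X.emeasure_space_1)
  have kh: "AE x in pX. \<forall>y. k x y = h x y"
    using h1 by eventually_elim (simp add: k_def)
  define K where "K = (\<lambda>x. density pX (\<lambda>y. ennreal (k x y)))"
  have K: "K \<in> borel \<rightarrow>\<^sub>M prob_algebra borel"
    unfolding K_def by (rule density_kernel_measurable[OF pX k k_one])
  have bind: "pX \<bind> K = pX"
  proof (rule measure_eqI_nn_integral[where L=borel])
    fix f :: "'x \<Rightarrow> ennreal" assume [measurable]: "f \<in> borel_measurable borel"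
    have "(\<integral>\<^sup>+ y. f y \<partial>(pX \<bind> K)) = (\<integral>\<^sup>+ x. \<integral>\<^sup>+ y. ennreal (k x y) * f y \<partial>pX \<partial>pX)"
      by (subst nn_integral_bind_prob_algebra[OF pX K]) (simp_all add: K_def nn_integral_density)
    also have "\<dots> = (\<integral>\<^sup>+ x. \<integral>\<^sup>+ y. ennreal (h x y) * f y \<partial>pX \<partial>pX)"
      by (intro nn_integral_cong_AE) (use kh in eventually_elim, simp)
    also have "\<dots> = (\<integral>\<^sup>+ y. \<integral>\<^sup>+ x. ennreal (h x y) * f y \<partial>pX \<partial>pX)"
      by (rule XX.Fubini'[symmetric]) measurable
    also have "\<dots> = (\<integral>\<^sup>+ y. (\<integral>\<^sup>+ x. ennreal (h x y) \<partial>pX) * f y \<partial>pX)"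
      by (intro nn_integral_cong nn_integral_multc) measurable
    also have "\<dots> = (\<integral>\<^sup>+ y. f y \<partial>pX)"
      by (intro nn_integral_cong_AE) (use h2 in eventually_elim, simp)
    finally show "(\<integral>\<^sup>+ y. f y \<partial>(pX \<bind> K)) = (\<integral>\<^sup>+ y. f y \<partial>pX)" .
  qed (use sets_bind'[OF pX K] spX in auto)
  have eq: "(\<integral>\<^sup>+ p. f p \<partial>joint pX K) = (\<integral>\<^sup>+ x. \<integral>\<^sup>+ y. ennreal (k x y) * f (x, y) \<partial>pX \<partial>pX)"
    if [measurable]: "f \<in> borel_measurable (borel \<Otimes>\<^sub>M borel)" for f
    by (subst nn_integral_joint[OF pX K]) (simp_all add: K_def nn_integral_density)
  have "mutual_info (joint pX K) = enn2ereal (\<integral>\<^sup>+ p. ennreal (psi (case_prod k p)) \<partial>(pX \<Otimes>\<^sub>M (pX \<bind> K)))"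
  proof (rule mutual_info_joint[OF pX K k])
    fix f :: "'x \<times> 'x \<Rightarrow> ennreal" assume [measurable]: "f \<in> borel_measurable (borel \<Otimes>\<^sub>M borel)"
    show "(\<integral>\<^sup>+ p. f p \<partial>joint pX K) = (\<integral>\<^sup>+ p. ennreal (case_prod k p) * f p \<partial>(pX \<Otimes>\<^sub>M (pX \<bind> K)))"
      unfolding bind by (subst eq, measurable) (subst X.nn_integral_fst[symmetric], auto)
  qed (auto simp: k_pos)
  also have "\<dots> = enn2ereal (\<integral>\<^sup>+ x. \<integral>\<^sup>+ y. ennreal (psi (k x y)) \<partial>pX \<partial>pX)"
    unfolding bind by (subst X.nn_integral_fst[symmetric]) auto
  also have "(\<integral>\<^sup>+ x. \<integral>\<^sup>+ y. ennreal (psi (k x y)) \<partial>pX \<partial>pX) = (\<integral>\<^sup>+ x. \<integral>\<^sup>+ y. ennreal (psi (h x y)) \<partial>pX \<partial>pX)"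
    by (intro nn_integral_cong_AE) (use kh in eventually_elim, simp)
  finally have mi: "mutual_info (joint pX K) = enn2ereal (\<integral>\<^sup>+ x. \<integral>\<^sup>+ y. ennreal (psi (h x y)) \<partial>pX \<partial>pX)" .
  have "(\<integral>\<^sup>+ p. ennreal (\<Delta> (fst p) (snd p)) \<partial>joint pX K)
      = (\<integral>\<^sup>+ x. \<integral>\<^sup>+ y. ennreal (k x y) * ennreal (\<Delta> x y) \<partial>pX \<partial>pX)"
    by (subst eq) auto
  also have "\<dots> = (\<integral>\<^sup>+ x. \<integral>\<^sup>+ y. ennreal (h x y) * ennreal (\<Delta> x y) \<partial>pX \<partial>pX)"
    by (intro nn_integral_cong_AE) (use kh in eventually_elim, simp)
  finally have "enn2ereal (\<integral>\<^sup>+ p. ennreal (\<Delta> (fst p) (snd p)) \<partial>joint pX K) \<le> ereal D"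
    using dist by simp
  then show ?thesis
    unfolding mi[symmetric] RDP_def
    by (intro INF_lower) (use K in \<open>simp add: bind d zero_ennreal.rep_eq zero_ereal_def[symmetric]\<close>)
qed

section \<open>Marginal densities\<close>

text \<open>If \<open>F\<close> is a density relative to the product of copies of \<open>pX\<close>,
  this is the density of coordinate \<open>t\<close>; no normalisation of \<open>F\<close> is
  required. It is real valued so that logarithms and differences can be formed.\<close>

definition marg :: "'x measure \<Rightarrow> nat set \<Rightarrow> nat \<Rightarrow> ((nat \<Rightarrow> 'x) \<Rightarrow> real) \<Rightarrow> 'x \<Rightarrow> real" where
  "marg pX I t F y = (\<integral> x. F (x(t := y)) \<partial>PiM (I - {t}) (\<lambda>_. pX))"

lemma PiM_prob_space: "prob_space pX \<Longrightarrow> prob_space (PiM I (\<lambda>_. pX))"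
  by (intro prob_space_PiM) auto

lemma fun_upd_measurable_PiM:
  assumes "t \<in> I"
  shows "(\<lambda>(x, y). x(t := y)) \<in> PiM (I - {t}) (\<lambda>_. pX) \<Otimes>\<^sub>M pX \<rightarrow>\<^sub>M PiM I (\<lambda>_. pX)"
  using measurable_add_dim[of t "I - {t}" "\<lambda>_. pX"] assms by (simp add: insert_absorb)

lemma fun_upd_section_measurable:
  assumes "t \<in> I" "y \<in> space pX"
  shows "(\<lambda>x. x(t := y)) \<in> PiM (I - {t}) (\<lambda>_. pX) \<rightarrow>\<^sub>M PiM I (\<lambda>_. pX)"
  using measurable_compose[OF measurable_Pair2'[OF assms(2)] fun_upd_measurable_PiM[OF assms(1)]] by simp

lemma fun_upd_in_space_PiM:
  assumes "t \<in> I" "x \<in> space (PiM (I - {t}) (\<lambda>_. pX))" "y \<in> space pX"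
  shows "x(t := y) \<in> space (PiM I (\<lambda>_. pX))"
  using assms by (auto simp: space_PiM PiE_iff extensional_def)

lemma marg_measurable:
  assumes "prob_space pX" "t \<in> I" and [measurable]: "F \<in> borel_measurable (PiM I (\<lambda>_. pX))"
  shows "marg pX I t F \<in> borel_measurable pX"
proof -
  interpret prob_space "PiM (I - {t}) (\<lambda>_. pX)" by (intro PiM_prob_space assms)
  have "(\<lambda>(x, y). F (x(t := y))) = F \<circ> (\<lambda>(x, y). x(t := y))" by auto
  then have "(\<lambda>(x, y). F (x(t := y))) \<in> borel_measurable (PiM (I - {t}) (\<lambda>_. pX) \<Otimes>\<^sub>M pX)"
    by (simp add: measurable_comp[OF fun_upd_measurable_PiM[OF assms(2)] assms(3)])
  from measurable_compose[OF measurable_pair_swap' this]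
  have "(\<lambda>(y, x). F (x(t := y))) \<in> borel_measurable (pX \<Otimes>\<^sub>M PiM (I - {t}) (\<lambda>_. pX))"
    by (simp add: case_prod_beta)
  then show ?thesis
    unfolding marg_def by (rule borel_measurable_lebesgue_integral)
qed

lemma marg_integrable:
  assumes p: "prob_space pX" and t: "t \<in> I" and y: "y \<in> space pX"
    and F: "F \<in> borel_measurable (PiM I (\<lambda>_. pX))"
    and b: "\<And>x. x \<in> space (PiM I (\<lambda>_. pX)) \<Longrightarrow> \<bar>F x\<bar> \<le> (B :: real)"
  shows "integrable (PiM (I - {t}) (\<lambda>_. pX)) (\<lambda>x. F (x(t := y)))"
proof -
  interpret prob_space "PiM (I - {t}) (\<lambda>_. pX)" by (intro PiM_prob_space p)
  from measurable_compose[OF fun_upd_section_measurable[OF t y] F]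
  show ?thesis
    using b fun_upd_in_space_PiM[OF t _ y] by (intro integrable_const_bound[where B=B] AE_I2) auto
qed

lemma marg_nn_integral:
  assumes p: "prob_space pX" and t: "t \<in> I" and y: "y \<in> space pX"
    and F: "F \<in> borel_measurable (PiM I (\<lambda>_. pX))"
    and b: "\<And>x. x \<in> space (PiM I (\<lambda>_. pX)) \<Longrightarrow> 0 \<le> F x \<and> F x \<le> B"
  shows "ennreal (marg pX I t F y) = (\<integral>\<^sup>+ x. ennreal (F (x(t := y))) \<partial>PiM (I - {t}) (\<lambda>_. pX))"
    and "0 \<le> marg pX I t F y" and "marg pX I t F y \<le> B"
proof -
  interpret prob_space "PiM (I - {t}) (\<lambda>_. pX)" by (intro PiM_prob_space p)
  have bb: "0 \<le> F (x(t := y)) \<and> F (x(t := y)) \<le> B" if "x \<in> space (PiM (I - {t}) (\<lambda>_. pX))" for x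
    by (intro b fun_upd_in_space_PiM t that y)
  have int: "integrable (PiM (I - {t}) (\<lambda>_. pX)) (\<lambda>x. F (x(t := y)))"
    using b by (intro marg_integrable[where B=B] p t y F) auto
  show "ennreal (marg pX I t F y) = (\<integral>\<^sup>+ x. ennreal (F (x(t := y))) \<partial>PiM (I - {t}) (\<lambda>_. pX))"
    unfolding marg_def using bb by (intro nn_integral_eq_integral[symmetric] int AE_I2) auto
  show "0 \<le> marg pX I t F y"
    unfolding marg_def using bb by (intro integral_nonneg_AE AE_I2) auto
  have "marg pX I t F y \<le> (\<integral> x. B \<partial>PiM (I - {t}) (\<lambda>_. pX))"
    unfolding marg_def using bb by (intro integral_mono int) auto
  then show "marg pX I t F y \<le> B" by (simp add: prob_space)
qed

lemma nn_integral_PiM_marg: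
  assumes p: "prob_space pX" and I: "finite I" and t: "t \<in> I"
    and F [measurable]: "F \<in> borel_measurable (PiM I (\<lambda>_. pX))"
    and b: "\<And>x. x \<in> space (PiM I (\<lambda>_. pX)) \<Longrightarrow> 0 \<le> F x \<and> F x \<le> B"
    and g [measurable]: "g \<in> borel_measurable pX"
  shows "(\<integral>\<^sup>+ x. ennreal (F x) * g (x t) \<partial>PiM I (\<lambda>_. pX)) = (\<integral>\<^sup>+ y. ennreal (marg pX I t F y) * g y \<partial>pX)"
proof -
  interpret prob_space pX by fact
  interpret product_sigma_finite "\<lambda>_. pX" ..
  have ins: "insert t (I - {t}) = I" using t by auto
  have [measurable]: "(\<lambda>x. ennreal (F x) * g (x t)) \<in> borel_measurable (PiM I (\<lambda>_. pX))"
    using t by measurable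
  have "(\<integral>\<^sup>+ x. ennreal (F x) * g (x t) \<partial>PiM I (\<lambda>_. pX))
      = (\<integral>\<^sup>+ y. (\<integral>\<^sup>+ x. ennreal (F (x(t := y))) * g y \<partial>PiM (I - {t}) (\<lambda>_. pX)) \<partial>pX)"
    using product_nn_integral_insert_rev[of "I - {t}" t "\<lambda>x. ennreal (F x) * g (x t)", unfolded ins] I
    by simp
  also have "\<dots> = (\<integral>\<^sup>+ y. ennreal (marg pX I t F y) * g y \<partial>pX)"
  proof (intro nn_integral_cong)
    fix y assume y: "y \<in> space pX"
    from measurable_compose[OF fun_upd_section_measurable[OF t y] F]
    have [measurable]: "(\<lambda>x. F (x(t := y))) \<in> borel_measurable (PiM (I - {t}) (\<lambda>_. pX))" .
    show "(\<integral>\<^sup>+ x. ennreal (F (x(t := y))) * g y \<partial>PiM (I - {t}) (\<lambda>_. pX)) = ennreal (marg pX I t F y) * g y"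
      by (subst nn_integral_multc) (auto simp: marg_nn_integral(1)[OF p t y F b])
  qed
  finally show ?thesis .
qed

text \<open>Relative entropy against a product measure is superadditive: the divergences of the
  marginals add up to at most that of the joint law, and the latter is at most \<open>ln B\<close>
  for a density bounded by \<open>B\<close>. The proof is Gibbs' inequality for \<open>F\<close>
  against the product of its own marginal densities.\<close>

lemma entropy_superadditive:
  fixes F :: "(nat \<Rightarrow> 'x::topological_space) \<Rightarrow> real"
  assumes pX: "pX \<in> space (prob_algebra borel)" and I: "finite I"
    and F [measurable]: "F \<in> borel_measurable (PiM I (\<lambda>_. pX))"
    and b: "\<And>x. x \<in> space (PiM I (\<lambda>_. pX)) \<Longrightarrow> 0 \<le> F x \<and> F x \<le> B"
    and one: "(\<integral>\<^sup>+ x. ennreal (F x) \<partial>PiM I (\<lambda>_. pX)) = 1"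
  shows "(\<Sum>t\<in>I. \<integral>\<^sup>+ y. ennreal (psi (marg pX I t F y)) \<partial>pX) \<le> ennreal (ln B)"
proof -
  have p: "prob_space pX" and spX: "sets pX = sets borel" using pX by (simp_all add: space_prob_algebra)
  have sp[simp]: "space pX = UNIV" using sets_eq_imp_space_eq[OF spX] by simp
  note [measurable_cong] = spX
  interpret prob_space pX by fact
  interpret product_sigma_finite "\<lambda>_. pX" ..
  let ?X = "PiM I (\<lambda>_. pX)"
  interpret X: prob_space ?X by (intro PiM_prob_space p)
  define f where "f = (\<lambda>t. marg pX I t F)"
  have fm[measurable]: "f t \<in> borel_measurable borel" if "t \<in> I" for t
    using marg_measurable[OF p that F] unfolding f_def by (simp add: measurable_cong_sets[OF spX refl])
  have f0: "0 \<le> f t y" and fB: "f t y \<le> B" if "t \<in> I" for t y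
    using marg_nn_integral(2,3)[OF p that _ F b, of y] by (auto simp: f_def)
  have fint: "(\<integral>\<^sup>+ x. ennreal (F x) * g (x t) \<partial>?X) = (\<integral>\<^sup>+ y. ennreal (f t y) * g y \<partial>pX)"
    if "t \<in> I" "g \<in> borel_measurable pX" for t g
    unfolding f_def by (rule nn_integral_PiM_marg[OF p I that(1) F b that(2)])
  define \<mu> where "\<mu> = density ?X (\<lambda>x. ennreal (F x))"
  interpret M: prob_space \<mu>
    by (rule prob_spaceI) (simp add: \<mu>_def emeasure_density one cong: nn_integral_cong_simp)
  have F0: "AE x in ?X. 0 \<le> F x" using b by (auto intro: AE_I2)
  have intF: "integrable ?X F"
    using b by (intro X.integrable_const_bound[where B=B] AE_I2) auto
  have iF: "(\<integral>x. F x \<partial>?X) = 1"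
    using one by (subst integral_eq_nn_integral) (auto simp: F0)
  have B1: "1 \<le> B"
  proof -
    have "(\<integral>x. F x \<partial>?X) \<le> (\<integral>x. B \<partial>?X)" using b by (intro integral_mono intF) auto
    then show ?thesis using iF by (simp add: X.prob_space)
  qed
  have d: "distr \<mu> borel (\<lambda>x. x t) = density pX (\<lambda>y. ennreal (f t y))" if t: "t \<in> I" for t
  proof (rule measure_eqI_nn_integral[where L=borel])
    fix g :: "'x \<Rightarrow> ennreal" assume g[measurable]: "g \<in> borel_measurable borel"
    have gp: "g \<in> borel_measurable pX" and fp: "(\<lambda>y. ennreal (f t y)) \<in> borel_measurable pX"
      using g fm[OF t] by (simp_all add: measurable_cong_sets[OF spX refl])
    have [measurable]: "(\<lambda>x. x t) \<in> ?X \<rightarrow>\<^sub>M borel" using t by measurable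
    show "(\<integral>\<^sup>+ x. g x \<partial>distr \<mu> borel (\<lambda>x. x t)) = (\<integral>\<^sup>+ x. g x \<partial>density pX (\<lambda>y. ennreal (f t y)))"
    proof -
      have "(\<integral>\<^sup>+ x. g x \<partial>distr \<mu> borel (\<lambda>x. x t)) = (\<integral>\<^sup>+ x. ennreal (F x) * g (x t) \<partial>?X)"
        unfolding \<mu>_def by (simp add: nn_integral_distr nn_integral_density)
      also have "\<dots> = (\<integral>\<^sup>+ y. ennreal (f t y) * g y \<partial>pX)"
        by (rule fint[OF t gp])
      also have "\<dots> = (\<integral>\<^sup>+ x. g x \<partial>density pX (\<lambda>y. ennreal (f t y)))"
        by (rule nn_integral_density[OF fp gp, symmetric])
      finally show ?thesis .
    qed
  qed (simp_all add: spX)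
  have intff: "integrable pX (\<lambda>y. f t y * ln (f t y))" if t: "t \<in> I" for t
  \<comment> \<open>A crude bound, only for integrability: \<open>ln f \<le> B\<close> from above,
    \<open>- f ln f \<le> 1\<close> from below, and \<open>1 \<le> B\<close> because
    \<open>F\<close> has mean 1.\<close>
  proof (intro integrable_const_bound[where B="B * B"] AE_I2)
    fix y
    note f0[OF t, of y] fB[OF t, of y]
    moreover have "f t y * ln (f t y) \<le> B * B"
    proof (cases "f t y = 0")
      case False
      then have "ln (f t y) \<le> B" using ln_le_minus_one[of "f t y"] f0[OF t, of y] fB[OF t, of y] by simp
      then show ?thesis using f0[OF t, of y] fB[OF t, of y] B1
        by (meson mult_mono' mult_left_mono mult_right_mono order_trans zero_le_one)
    qed (use B1 in simp)
    moreover have "- (f t y * ln (f t y)) \<le> 1"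
      using psi_nonneg[OF f0[OF t, of y]] f0[OF t, of y] unfolding psi_def by simp
    moreover have "1 \<le> B * B" using B1 mult_mono[of 1 B 1 B] by simp
    ultimately show "norm (f t y * ln (f t y)) \<le> B * B" by (simp add: abs_le_iff)
  qed (use fm[OF t] in measurable)
  have intf: "integrable pX (f t)" and if1: "(\<integral>y. f t y \<partial>pX) = 1" if t: "t \<in> I" for t
  proof -
    show "integrable pX (f t)"
      using f0[OF t] fB[OF t] fm[OF t]  by (intro integrable_const_bound[where B=B] AE_I2) auto
    have "(\<integral>\<^sup>+ y. ennreal (f t y) \<partial>pX) = 1"
      using fint[OF t, of "\<lambda>_. 1"] one by simp
    then show "(\<integral>y. f t y \<partial>pX) = 1"
      using f0[OF t] fm[OF t] by (subst integral_eq_nn_integral) auto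
  qed
  have psi_f: "(\<integral>\<^sup>+ y. ennreal (psi (f t y)) \<partial>pX) = ennreal (\<integral>y. f t y * ln (f t y) \<partial>pX)" if t: "t \<in> I" for t
  proof -
    have "integrable pX (\<lambda>y. psi (f t y))"
      unfolding psi_def using intff[OF t] intf[OF t] by auto
    then have "(\<integral>\<^sup>+ y. ennreal (psi (f t y)) \<partial>pX) = ennreal (\<integral>y. psi (f t y) \<partial>pX)"
      using psi_nonneg[OF f0[OF t]] by (intro nn_integral_eq_integral) auto
    also have "(\<integral>y. psi (f t y) \<partial>pX) = (\<integral>y. f t y * ln (f t y) \<partial>pX)"
      unfolding psi_def using intff[OF t] intf[OF t] if1[OF t] prob_space by simp
    finally show ?thesis .
  qed
  have lnf: "integrable ?X (\<lambda>x. F x * ln (f t (x t)))"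
     "(\<integral>x. F x * ln (f t (x t)) \<partial>?X) = (\<integral>y. f t y * ln (f t y) \<partial>pX)"
     "AE x in ?X. F x > 0 \<longrightarrow> f t (x t) > 0" if t: "t \<in> I" for t
  proof -
    note [measurable] = fm[OF t]
    have fp[measurable]: "f t \<in> borel_measurable pX"
      using fm[OF t] by (simp add: measurable_cong_sets[OF spX refl])
    have lp: "(\<lambda>y. ln (f t y)) \<in> borel_measurable pX" by measurable
    have [measurable]: "(\<lambda>x. x t) \<in> ?X \<rightarrow>\<^sub>M borel" using t by measurable
    have [measurable]: "(\<lambda>x. x t) \<in> \<mu> \<rightarrow>\<^sub>M borel" unfolding \<mu>_def by measurable
    \<comment> \<open>Under \<open>\<mu>\<close>, the law with density \<open>F\<close>, coordinate
      \<open>t\<close> has density \<open>f t\<close>; this change of variables turns the integral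
      of \<open>F x * ln (f t (x t))\<close> into that of \<open>f t y * ln (f t y)\<close>.\<close>
    have "integrable (distr \<mu> borel (\<lambda>x. x t)) (\<lambda>y. ln (f t y))"
      unfolding d[OF t] using intff[OF t] f0[OF t] by (subst integrable_real_density) (auto simp: fp lp)
    then have "integrable \<mu> (\<lambda>x. ln (f t (x t)))"
      by (subst (asm) integrable_distr_eq) auto
    then show "integrable ?X (\<lambda>x. F x * ln (f t (x t)))"
      unfolding \<mu>_def using F0 by (subst (asm) integrable_real_density) auto
    have "(\<integral>x. F x * ln (f t (x t)) \<partial>?X) = (\<integral>x. ln (f t (x t)) \<partial>\<mu>)"
      unfolding \<mu>_def using F0 by (subst integral_real_density) auto
    also have "\<dots> = (\<integral>y. ln (f t y) \<partial>distr \<mu> borel (\<lambda>x. x t))"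
      by (subst integral_distr) auto
    also have "\<dots> = (\<integral>y. f t y * ln (f t y) \<partial>pX)"
      unfolding d[OF t] using f0[OF t] by (subst integral_real_density) (auto simp: fp lp)
    finally show "(\<integral>x. F x * ln (f t (x t)) \<partial>?X) = (\<integral>y. f t y * ln (f t y) \<partial>pX)" .
    \<comment> \<open>A density is almost surely positive under its own law; this is what later lets
      the logarithm of the product of marginal densities split into a sum.\<close>
    have "AE y in density pX (\<lambda>y. ennreal (f t y)). f t y > 0"
      by (subst AE_density) auto
    then have "AE x in \<mu>. f t (x t) > 0"
      unfolding d[OF t, symmetric] by (intro AE_distrD[of "\<lambda>x. x t" \<mu> borel]) auto
    then show "AE x in ?X. F x > 0 \<longrightarrow> f t (x t) > 0"
      unfolding \<mu>_def by (subst (asm) AE_density) auto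
  qed
  have intp: "integrable ?X (\<lambda>x. \<Prod>t\<in>I. f t (x t))"
    by (intro product_integrable_prod I intf)
  have ip: "(\<integral>x. (\<Prod>t\<in>I. f t (x t)) \<partial>?X) = 1"
    by (subst product_integral_prod[OF I intf]) (auto simp: if1)
  have pos: "AE x in ?X. \<forall>t\<in>I. F x > 0 \<longrightarrow> f t (x t) > 0"
    using I lnf(3) by (intro AE_finite_allI) auto
  \<comment> \<open>With \<open>P\<close> the product of the marginal densities, pointwise
    \<open>F ln P \<le> F ln F + P - F \<le> F ln B + P - F\<close>. Both \<open>P\<close> and
    \<open>F\<close> integrate to 1, so only \<open>ln B\<close> survives.\<close>
  have "(\<integral>x. (\<Sum>t\<in>I. F x * ln (f t (x t))) \<partial>?X) \<le> (\<integral>x. F x * ln B + (\<Prod>t\<in>I. f t (x t)) - F x \<partial>?X)"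
  proof (intro integral_mono_AE)
    show "AE x in ?X. (\<Sum>t\<in>I. F x * ln (f t (x t))) \<le> F x * ln B + (\<Prod>t\<in>I. f t (x t)) - F x"
      using pos AE_space
    proof eventually_elim
      case (elim x)
      have Fx: "0 \<le> F x" "F x \<le> B" using b elim by auto
      have p0: "0 \<le> (\<Prod>t\<in>I. f t (x t))" by (intro prod_nonneg) (auto simp: f0)
      show ?case
      proof (cases "F x = 0")
        case False
        then have Fp: "F x > 0" using Fx by simp
        define P where "P = (\<Prod>t\<in>I. f t (x t))"
        have Pp: "P > 0" unfolding P_def using elim Fp by (intro prod_pos) auto
        have "(\<Sum>t\<in>I. ln (f t (x t))) = ln P"
          unfolding P_def using elim Fp I by (subst ln_prod) auto
        then have "(\<Sum>t\<in>I. F x * ln (f t (x t))) = F x * ln P"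
          by (simp add: sum_distrib_left[symmetric])
        also have "\<dots> \<le> F x * ln B + P - F x"
        proof -
          have "ln (P / F x) \<le> P / F x - 1" using Pp Fp by (intro ln_le_minus_one) simp
          then have "ln P \<le> ln (F x) + P / F x - 1" using Pp Fp by (simp add: ln_div)
          also have "ln (F x) \<le> ln B" using Fx Fp by simp
          finally have "F x * ln P \<le> F x * (ln B + P / F x - 1)" using Fp by (intro mult_left_mono) auto
          also have "\<dots> = F x * ln B + P - F x" using Fp by (simp add: field_simps)
          finally show ?thesis .
        qed
        finally show ?thesis by (simp add: P_def)
      qed (use p0 in simp)
    qed
  qed (use lnf(1) intp intF in \<open>auto intro!: Bochner_Integration.integrable_sum\<close>)
  also have "\<dots> = ln B"
    using intp intF ip iF by simp
  finally have "(\<Sum>t\<in>I. \<integral>y. f t y * ln (f t y) \<partial>pX) \<le> ln B"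
    using lnf(1,2) by (simp add: Bochner_Integration.integral_sum)
  moreover have "0 \<le> (\<integral>y. f t y * ln (f t y) \<partial>pX)" if t: "t \<in> I" for t
  proof -
    have "0 \<le> (\<integral>y. psi (f t y) \<partial>pX)" using psi_nonneg[OF f0[OF t]] by (intro integral_nonneg_AE) auto
    also have "(\<integral>y. psi (f t y) \<partial>pX) = (\<integral>y. f t y * ln (f t y) \<partial>pX)"
      unfolding psi_def using intff[OF t] intf[OF t] if1[OF t] prob_space by simp
    finally show ?thesis .
  qed
  ultimately show ?thesis
    using psi_f by (simp add: f_def sum_ennreal ennreal_leI)
qed

section \<open>Converse\<close>

locale block_code =
  fixes pX :: "'x::topological_space measure" and n :: nat
    and E :: "(nat \<Rightarrow> 'x) \<Rightarrow> nat measure" and G :: "nat \<Rightarrow> (nat \<Rightarrow> 'x) measure"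
  assumes pX: "pX \<in> space (prob_algebra borel)"
    and E: "E \<in> PiM {..<n} (\<lambda>_. borel) \<rightarrow>\<^sub>M prob_algebra (count_space UNIV)"
    and G: "G \<in> count_space UNIV \<rightarrow>\<^sub>M prob_algebra (PiM {..<n} (\<lambda>_. borel))"
begin

abbreviation "Bn \<equiv> PiM {..<n} (\<lambda>_. borel :: 'x measure)"
abbreviation "Xn \<equiv> PiM {..<n} (\<lambda>_. pX)"
abbreviation "Rn t \<equiv> PiM ({..<n} - {t}) (\<lambda>_. pX)"
abbreviation "inv_n \<equiv> ennreal (1 / real n)"

definition J :: "((nat \<Rightarrow> 'x) \<times> (nat \<Rightarrow> 'x)) measure" where
  "J = Xn \<bind> (\<lambda>x. E x \<bind> (\<lambda>z. distr (G z) (Bn \<Otimes>\<^sub>M Bn) (Pair x)))"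

definition enc :: "nat \<Rightarrow> (nat \<Rightarrow> 'x) \<Rightarrow> real" where
  "enc z x = measure (E x) {z}"

definition pz :: "nat \<Rightarrow> real" where
  "pz z = measure (Xn \<bind> E) {z}"

lemma pX_prob: "prob_space pX" and sets_pX: "sets pX = sets borel"
  using pX by (simp_all add: space_prob_algebra)

lemma space_pX: "space pX = UNIV"
  using sets_eq_imp_space_eq[OF sets_pX] by simp

lemmas measurable_pX = measurable_cong_sets[OF sets_pX refl]

lemma sets_Xn: "sets Xn = sets Bn"
  by (intro sets_PiM_cong) (auto simp: sets_pX)

lemma Xn: "Xn \<in> space (prob_algebra Bn)"
  using sets_Xn PiM_prob_space[OF pX_prob] by (simp add: space_prob_algebra)

lemma G_prob: "prob_space (G z)" and sets_G: "sets (G z) = sets Bn"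
  using measurable_space[OF G, of z] by (auto simp: space_prob_algebra)

lemma E_prob: "x \<in> space Xn \<Longrightarrow> prob_space (E x)" and sets_E: "x \<in> space Xn \<Longrightarrow> sets (E x) = UNIV"
  using measurable_space[OF E, of x] sets_eq_imp_space_eq[OF sets_Xn] by (auto simp: space_prob_algebra)

lemma decoder_kernel:
  "(\<lambda>p. distr (G (snd p)) (Bn \<Otimes>\<^sub>M Bn) (Pair (fst p)))
     \<in> Bn \<Otimes>\<^sub>M count_space UNIV \<rightarrow>\<^sub>M prob_algebra (Bn \<Otimes>\<^sub>M Bn)"
proof (rule measurable_distr_prob_space2[where M=Bn])
  show "(\<lambda>p. G (snd p)) \<in> Bn \<Otimes>\<^sub>M count_space UNIV \<rightarrow>\<^sub>M prob_algebra Bn"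
    by (rule measurable_compose[OF measurable_snd G])
qed measurable

lemma decoder_kernel_section:
  assumes "x \<in> space Xn"
  shows "(\<lambda>z. distr (G z) (Bn \<Otimes>\<^sub>M Bn) (Pair x)) \<in> count_space UNIV \<rightarrow>\<^sub>M prob_algebra (Bn \<Otimes>\<^sub>M Bn)"
proof -
  have "x \<in> space Bn" using assms sets_eq_imp_space_eq[OF sets_Xn] by simp
  from measurable_compose[OF measurable_Pair1'[OF this] decoder_kernel] show ?thesis by simp
qed

lemma code_kernel:
  "(\<lambda>x. E x \<bind> (\<lambda>z. distr (G z) (Bn \<Otimes>\<^sub>M Bn) (Pair x))) \<in> Bn \<rightarrow>\<^sub>M prob_algebra (Bn \<Otimes>\<^sub>M Bn)"
  by (rule measurable_bind_prob_space2[OF E]) (use decoder_kernel in \<open>simp add: case_prod_beta\<close>)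

lemma J: "J \<in> space (prob_algebra (Bn \<Otimes>\<^sub>M Bn))"
  using sets_bind'[OF Xn code_kernel] prob_space_bind'[OF Xn code_kernel]
  by (simp add: J_def space_prob_algebra)

lemma nn_integral_E:
  assumes x: "x \<in> space Xn"
  shows "(\<integral>\<^sup>+ z. f z \<partial>E x) = (\<Sum>z. ennreal (enc z x) * f z)"
proof -
  interpret prob_space "E x" by (rule E_prob[OF x])
  have "E x = density (count_space UNIV) (\<lambda>z. ennreal (enc z x))"
  proof (rule measure_eqI_countable[where A=UNIV])
    show "emeasure (E x) {a} = emeasure (density (count_space UNIV) (\<lambda>z. ennreal (enc z x))) {a}" for a
      by (simp add: emeasure_density enc_def emeasure_eq_measure nn_integral_count_space_indicator[symmetric]
          nn_integral_count_space_finite)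
  qed (auto simp: sets_E[OF x])
  then have "(\<integral>\<^sup>+ z. f z \<partial>E x) = (\<integral>\<^sup>+ z. f z \<partial>density (count_space UNIV) (\<lambda>z. ennreal (enc z x)))"
    by simp
  also have "\<dots> = (\<Sum>z. ennreal (enc z x) * f z)"
    by (simp add: nn_integral_density nn_integral_count_space_nat)
  finally show ?thesis .
qed

lemma enc_measurable [measurable]: "enc z \<in> borel_measurable Xn"
proof -
  have "(\<lambda>x. measure (E x) {z}) \<in> borel_measurable Bn"
    by (rule measurable_compose[OF measurable_prob_algebraD[OF E]]) measurable
  then show ?thesis
    unfolding enc_def by (simp add: measurable_cong_sets[OF sets_Xn refl])
qed

lemma enc_nonneg: "0 \<le> enc z x" and enc_le_1: "x \<in> space Xn \<Longrightarrow> enc z x \<le> 1"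
  using prob_space.prob_le_1[OF E_prob] by (auto simp: enc_def)

lemma enc_sum: "x \<in> space Xn \<Longrightarrow> (\<Sum>z. ennreal (enc z x)) = 1"
  using nn_integral_E[of x "\<lambda>_. 1"] prob_space.emeasure_space_1[OF E_prob[of x]] by simp

lemma pz_eq: "ennreal (pz z) = (\<integral>\<^sup>+ x. ennreal (enc z x) \<partial>Xn)"
proof -
  interpret prob_space "Xn \<bind> E" by (rule prob_space_bind'[OF Xn E])
  have "ennreal (pz z) = emeasure (Xn \<bind> E) {z}" by (simp add: pz_def emeasure_eq_measure)
  also have "\<dots> = (\<integral>\<^sup>+ x. emeasure (E x) {z} \<partial>Xn)"
    by (rule emeasure_bind_prob_algebra[OF Xn E]) simp
  also have "\<dots> = (\<integral>\<^sup>+ x. ennreal (enc z x) \<partial>Xn)"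
    by (intro nn_integral_cong)
       (simp add: enc_def finite_measure.emeasure_eq_measure[OF prob_space.finite_measure[OF E_prob]])
  finally show ?thesis .
qed

lemma pz_nonneg: "0 \<le> pz z" by (simp add: pz_def)

text \<open>Source block, index and output block form a Markov chain, so given \<open>Z = z\<close>
  the two blocks are independent and the joint law is a countable sum over \<open>z\<close>.\<close>

lemma nn_integral_J:
  assumes [measurable]: "f \<in> borel_measurable (Bn \<Otimes>\<^sub>M Bn)"
  shows "(\<integral>\<^sup>+ p. f p \<partial>J) = (\<Sum>z. \<integral>\<^sup>+ x. ennreal (enc z x) * (\<integral>\<^sup>+ y. f (x, y) \<partial>G z) \<partial>Xn)"
proof -
  have [measurable]: "(\<lambda>x. \<integral>\<^sup>+ y. f (x, y) \<partial>G z) \<in> borel_measurable Xn" for z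
  proof -
    interpret prob_space "G z" by (rule G_prob)
    have "(\<lambda>x. \<integral>\<^sup>+ y. f (x, y) \<partial>G z) \<in> borel_measurable Bn"
      by (rule borel_measurable_nn_integral)
         (simp add: measurable_cong_sets[OF sets_pair_measure_cong[OF refl sets_G] refl])
    then show ?thesis by (simp add: measurable_cong_sets[OF sets_Xn refl])
  qed
  have "(\<integral>\<^sup>+ p. f p \<partial>J) = (\<integral>\<^sup>+ x. \<integral>\<^sup>+ p. f p \<partial>(E x \<bind> (\<lambda>z. distr (G z) (Bn \<Otimes>\<^sub>M Bn) (Pair x))) \<partial>Xn)"
    unfolding J_def by (rule nn_integral_bind_prob_algebra[OF Xn code_kernel]) measurable
  also have "\<dots> = (\<integral>\<^sup>+ x. (\<Sum>z. ennreal (enc z x) * (\<integral>\<^sup>+ y. f (x, y) \<partial>G z)) \<partial>Xn)"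
  proof (intro nn_integral_cong)
    fix x assume x: "x \<in> space Xn"
    have xB: "x \<in> space Bn" using x sets_eq_imp_space_eq[OF sets_Xn] by simp
    have Ex: "E x \<in> space (prob_algebra (count_space UNIV))"
      using E_prob[OF x] sets_E[OF x] by (simp add: space_prob_algebra)
    have "(\<integral>\<^sup>+ p. f p \<partial>(E x \<bind> (\<lambda>z. distr (G z) (Bn \<Otimes>\<^sub>M Bn) (Pair x))))
        = (\<integral>\<^sup>+ z. \<integral>\<^sup>+ p. f p \<partial>distr (G z) (Bn \<Otimes>\<^sub>M Bn) (Pair x) \<partial>E x)"
      by (rule nn_integral_bind_prob_algebra[OF Ex decoder_kernel_section[OF x]]) measurable
    also have "\<dots> = (\<Sum>z. ennreal (enc z x) * (\<integral>\<^sup>+ p. f p \<partial>distr (G z) (Bn \<Otimes>\<^sub>M Bn) (Pair x)))"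
      by (rule nn_integral_E[OF x])
    also have "\<dots> = (\<Sum>z. ennreal (enc z x) * (\<integral>\<^sup>+ y. f (x, y) \<partial>G z))"
      using measurable_Pair1'[OF xB]
      by (subst nn_integral_distr) (auto simp: measurable_cong_sets[OF sets_G refl])
    finally show "(\<integral>\<^sup>+ p. f p \<partial>(E x \<bind> (\<lambda>z. distr (G z) (Bn \<Otimes>\<^sub>M Bn) (Pair x))))
        = (\<Sum>z. ennreal (enc z x) * (\<integral>\<^sup>+ y. f (x, y) \<partial>G z))" .
  qed
  also have "\<dots> = (\<Sum>z. \<integral>\<^sup>+ x. ennreal (enc z x) * (\<integral>\<^sup>+ y. f (x, y) \<partial>G z) \<partial>Xn)"
    by (rule nn_integral_suminf) measurable
  finally show ?thesis .
qed

text \<open>Distortion and perception are constraints on single letters, so these marginals of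
  \<open>G z\<close> are all that the converse uses of the decoder.\<close>

definition dec :: "nat \<Rightarrow> nat \<Rightarrow> 'x measure" where
  "dec z t = distr (G z) borel (\<lambda>y. y t)"

lemma dec:
  assumes t: "t < n"
  shows "prob_space (dec z t)" and "sets (dec z t) = sets borel"
proof -
  have "(\<lambda>y. y t) \<in> G z \<rightarrow>\<^sub>M borel" using t by (simp add: measurable_cong_sets[OF sets_G refl])
  then show "prob_space (dec z t)" unfolding dec_def by (rule prob_space.prob_space_distr[OF G_prob])
qed (simp add: dec_def)

lemma nn_integral_dec:
  assumes t: "t < n" and [measurable]: "f \<in> borel_measurable borel"
  shows "(\<integral>\<^sup>+ y. f (y t) \<partial>G z) = (\<integral>\<^sup>+ y. f y \<partial>dec z t)"
proof -
  have [measurable]: "(\<lambda>y. y t) \<in> G z \<rightarrow>\<^sub>M borel" using t by (simp add: measurable_cong_sets[OF sets_G refl])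
  show ?thesis unfolding dec_def by (subst nn_integral_distr) auto
qed

lemma component_pair_measurable:
  assumes t: "t < n"
  shows "(\<lambda>p. (fst p t, snd p t)) \<in> Bn \<Otimes>\<^sub>M Bn \<rightarrow>\<^sub>M borel \<Otimes>\<^sub>M borel"
  using t by (intro measurable_Pair measurable_compose[OF measurable_fst measurable_component_singleton]
      measurable_compose[OF measurable_snd measurable_component_singleton]) auto

lemma dec_section_measurable:
  assumes t: "t < n" and [measurable]: "f \<in> borel_measurable (borel \<Otimes>\<^sub>M borel)"
  shows "(\<lambda>x. \<integral>\<^sup>+ y. f (x, y) \<partial>dec z t) \<in> borel_measurable borel"
proof -
  interpret prob_space "dec z t" by (rule dec[OF t])
  show ?thesis
    by (rule borel_measurable_nn_integral)
       (simp add: measurable_cong_sets[OF sets_pair_measure_cong[OF refl dec(2)[OF t]] refl])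
qed

lemma nn_integral_J_component:
  assumes t: "t < n" and f [measurable]: "f \<in> borel_measurable (borel \<Otimes>\<^sub>M borel)"
  shows "(\<integral>\<^sup>+ p. f (fst p t, snd p t) \<partial>J)
    = (\<Sum>z. \<integral>\<^sup>+ x. ennreal (enc z x) * (\<integral>\<^sup>+ y. f (x t, y) \<partial>dec z t) \<partial>Xn)"
proof -
  have "(\<lambda>p. f (fst p t, snd p t)) \<in> borel_measurable (Bn \<Otimes>\<^sub>M Bn)"
    by (rule measurable_compose[OF component_pair_measurable[OF t] f])
  then show ?thesis
    by (subst nn_integral_J) (auto simp: nn_integral_dec[OF t, where f="\<lambda>y. f (x, y)" for x])
qed

lemma distr_J_component:
  assumes t: "t < n"
  shows "distr J borel (\<lambda>p. snd p t) \<in> space (prob_algebra borel)"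
    and "f \<in> borel_measurable borel \<Longrightarrow> (\<integral>\<^sup>+ y. f y \<partial>distr J borel (\<lambda>p. snd p t)) = (\<Sum>z. ennreal (pz z) * (\<integral>\<^sup>+ y. f y \<partial>dec z t))"
proof -
  have [measurable]: "(\<lambda>p. snd p t) \<in> J \<rightarrow>\<^sub>M borel"
    using J t by (simp add: space_prob_algebra cong: measurable_cong_sets)
  show "distr J borel (\<lambda>p. snd p t) \<in> space (prob_algebra borel)"
    using J by (auto simp: space_prob_algebra intro!: prob_space.prob_space_distr)
  assume [measurable]: "f \<in> borel_measurable borel"
  have "(\<integral>\<^sup>+ y. f y \<partial>distr J borel (\<lambda>p. snd p t)) = (\<integral>\<^sup>+ p. (\<lambda>q. f (snd q)) (fst p t, snd p t) \<partial>J)"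
    by (subst nn_integral_distr) auto
  also have "\<dots> = (\<Sum>z. \<integral>\<^sup>+ x. ennreal (enc z x) * (\<integral>\<^sup>+ y. f y \<partial>dec z t) \<partial>Xn)"
    by (subst nn_integral_J_component[OF t]) auto
  also have "\<dots> = (\<Sum>z. ennreal (pz z) * (\<integral>\<^sup>+ y. f y \<partial>dec z t))"
    by (simp add: nn_integral_multc pz_eq)
  finally show "(\<integral>\<^sup>+ y. f y \<partial>distr J borel (\<lambda>p. snd p t)) = (\<Sum>z. ennreal (pz z) * (\<integral>\<^sup>+ y. f y \<partial>dec z t))" .
qed

end

lemma nn_integral_sum_cmult:
  assumes "\<And>i. i \<in> I \<Longrightarrow> \<phi> i \<in> borel_measurable M"
  shows "(\<integral>\<^sup>+ x. (\<Sum>i\<in>I. c * \<phi> i x) \<partial>M) = (\<Sum>i\<in>I. c * (\<integral>\<^sup>+ x. \<phi> i x \<partial>M))"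
  using assms by (subst nn_integral_sum) (auto intro!: sum.cong nn_integral_cmult)

section \<open>Single-letter densities given the index\<close>

context block_code begin

text \<open>Density of \<open>P(Z = z, X\<^sub>t \<in> \<cdot>)\<close> with respect to \<open>pX\<close>.\<close>
definition a :: "nat \<Rightarrow> nat \<Rightarrow> 'x \<Rightarrow> real" where
  "a z t = marg pX {..<n} t (enc z)"

lemma enc_bounds: "x \<in> space Xn \<Longrightarrow> 0 \<le> enc z x \<and> enc z x \<le> 1"
  by (simp add: enc_nonneg enc_le_1)

lemma a_measurable: "t < n \<Longrightarrow> a z t \<in> borel_measurable borel"
  using marg_measurable[OF pX_prob, of t "{..<n}" "enc z"]
  by (simp add: a_def measurable_pX)

lemma a_nonneg: "t < n \<Longrightarrow> 0 \<le> a z t y"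
  unfolding a_def by (rule marg_nn_integral(2)[OF pX_prob, where B=1]) (auto simp: space_pX enc_bounds)

lemma nn_integral_enc_component:
  assumes t: "t < n" and g: "g \<in> borel_measurable borel"
  shows "(\<integral>\<^sup>+ x. ennreal (enc z x) * g (x t) \<partial>Xn) = (\<integral>\<^sup>+ y. ennreal (a z t y) * g y \<partial>pX)"
  unfolding a_def
  by (rule nn_integral_PiM_marg[OF pX_prob]) (use t g enc_bounds in \<open>auto simp: measurable_pX\<close>)

lemma a_integral: "t < n \<Longrightarrow> (\<integral>\<^sup>+ y. ennreal (a z t y) \<partial>pX) = ennreal (pz z)"
  using nn_integral_enc_component[of t "\<lambda>_. 1" z] by (simp add: pz_eq)

lemma a_sum:
  assumes t: "t < n"
  shows "(\<Sum>z. ennreal (a z t y)) = 1"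
proof -
  interpret R: prob_space "Rn t" by (intro PiM_prob_space pX_prob)
  have y: "y \<in> space pX" by (simp add: space_pX)
  have tI: "t \<in> {..<n}" using t by simp
  have m: "(\<lambda>x. x(t := y)) \<in> Rn t \<rightarrow>\<^sub>M Xn"
    by (rule fun_upd_section_measurable[OF tI y])
  have "(\<Sum>z. ennreal (a z t y)) = (\<Sum>z. \<integral>\<^sup>+ x. ennreal (enc z (x(t := y))) \<partial>Rn t)"
    unfolding a_def by (subst marg_nn_integral(1)[OF pX_prob tI y enc_measurable enc_bounds]) auto
  also have "\<dots> = (\<integral>\<^sup>+ x. (\<Sum>z. ennreal (enc z (x(t := y)))) \<partial>Rn t)"
    by (rule nn_integral_suminf[symmetric])
       (use measurable_compose[OF m enc_measurable] in simp)
  also have "\<dots> = (\<integral>\<^sup>+ x. 1 \<partial>Rn t)"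
    by (intro nn_integral_cong enc_sum fun_upd_in_space_PiM tI y)
  finally show ?thesis by (simp add: R.emeasure_space_1)
qed

text \<open>Densities of \<open>X\<^sub>t\<close> and of the output letter given \<open>Z = z\<close> (junk if \<open>pz z = 0\<close>), and of their joint law.\<close>
definition f :: "nat \<Rightarrow> nat \<Rightarrow> 'x \<Rightarrow> real" where
  "f z t y = a z t y / pz z"

definition g :: "nat \<Rightarrow> nat \<Rightarrow> 'x \<Rightarrow> real" where
  "g z t y = enn2real (RN_deriv pX (dec z t) y)"

definition H :: "nat \<Rightarrow> 'x \<Rightarrow> 'x \<Rightarrow> ennreal" where
  "H t x y = (\<Sum>z. ennreal (pz z * g z t y * f z t x))"

lemma f_measurable: "t < n \<Longrightarrow> f z t \<in> borel_measurable borel"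
  unfolding f_def using a_measurable by simp

lemma f_measurable' [measurable]: "t < n \<Longrightarrow> f z t \<in> borel_measurable pX"
  using f_measurable by (simp add: measurable_pX)

lemma f_nonneg: "t < n \<Longrightarrow> 0 \<le> f z t y"
  by (simp add: f_def a_nonneg pz_nonneg)

lemma g_measurable: "g z t \<in> borel_measurable borel"
  using borel_measurable_RN_deriv[of pX "dec z t"]
  unfolding g_def by (simp add: measurable_pX)

lemma g_measurable' [measurable]: "g z t \<in> borel_measurable pX"
  using g_measurable by (simp add: measurable_pX)

lemma g_nonneg: "0 \<le> g z t y" by (simp add: g_def)

lemma H_measurable: "t < n \<Longrightarrow> case_prod (H t) \<in> borel_measurable (borel \<Otimes>\<^sub>M borel)"
proof -
  assume t: "t < n"
  note [measurable] = f_measurable[OF t] g_measurable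
  show ?thesis unfolding H_def by measurable
qed

lemma H_section:
  assumes t: "t < n"
  shows "(\<lambda>y. H t x y) \<in> borel_measurable pX" and "(\<lambda>x. H t x y) \<in> borel_measurable pX"
  using measurable_compose[OF measurable_Pair1' H_measurable[OF t], of x]
    measurable_compose[OF measurable_Pair2' H_measurable[OF t], of y]
  by (simp_all add: measurable_pX)

lemma f_psi_le:
  assumes z: "pz z > 0"
  shows "(\<Sum>t<n. \<integral>\<^sup>+ y. ennreal (psi (f z t y)) \<partial>pX) \<le> ennreal (- ln (pz z))"
proof -
  have "f z t = marg pX {..<n} t (\<lambda>x. enc z x / pz z)" for t
    by (simp add: fun_eq_iff f_def a_def marg_def)
  moreover have "(\<Sum>t<n. \<integral>\<^sup>+ y. ennreal (psi (marg pX {..<n} t (\<lambda>x. enc z x / pz z) y)) \<partial>pX) \<le> ennreal (ln (1 / pz z))"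
  proof (rule entropy_superadditive[OF pX])
    show "(\<integral>\<^sup>+ x. ennreal (enc z x / pz z) \<partial>Xn) = 1"
    proof -
      have "(\<integral>\<^sup>+ x. ennreal (enc z x / pz z) \<partial>Xn) = (\<integral>\<^sup>+ x. ennreal (enc z x) * ennreal (1 / pz z) \<partial>Xn)"
        using z by (intro nn_integral_cong) (simp add: ennreal_mult''[symmetric])
      also have "\<dots> = ennreal (pz z) * ennreal (1 / pz z)"
        by (subst nn_integral_multc) (auto simp: pz_eq)
      also have "\<dots> = 1" using z by (simp add: ennreal_mult''[symmetric])
      finally show ?thesis .
    qed
  qed (use z enc_bounds in \<open>auto simp: divide_right_mono\<close>)
  ultimately show ?thesis using z by (simp add: ln_div)
qed

context
  fixes \<Delta> :: "'x \<Rightarrow> 'x \<Rightarrow> real"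
  assumes marginal: "\<And>t. t < n \<Longrightarrow> distr J borel (\<lambda>p. snd p t) = pX"
    and \<Delta>: "(\<lambda>p. \<Delta> (fst p) (snd p)) \<in> borel_measurable (borel \<Otimes>\<^sub>M borel)"
begin

lemma mixture_dec:
  assumes t: "t < n" and [measurable]: "\<phi> \<in> borel_measurable borel"
  shows "(\<Sum>z. ennreal (pz z) * (\<integral>\<^sup>+ y. \<phi> y \<partial>dec z t)) = (\<integral>\<^sup>+ y. \<phi> y \<partial>pX)"
  using distr_J_component(2)[OF t, of \<phi>] marginal[OF t] by simp

text \<open>By exact realism \<open>pX\<close> is the mixture of the laws \<open>dec z t\<close>
  with weights \<open>pz z\<close>, so a null set of \<open>pX\<close> is null for every component
  of positive weight. Hence the Radon-Nikodym derivative behind \<open>g\<close> represents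
  \<open>dec z t\<close>, and it is finite almost everywhere.\<close>

lemma density_g:
  assumes t: "t < n" and z: "pz z > 0" and \<phi>: "\<phi> \<in> borel_measurable borel"
  shows "(\<integral>\<^sup>+ y. ennreal (g z t y) * \<phi> y \<partial>pX) = (\<integral>\<^sup>+ y. \<phi> y \<partial>dec z t)"
proof -
  interpret X: prob_space pX by (rule pX_prob)
  interpret D: prob_space "dec z t" by (rule dec[OF t])
  have ac: "absolutely_continuous pX (dec z t)"
    unfolding absolutely_continuous_def
  proof
    fix A assume A: "A \<in> null_sets pX"
    then have Ab: "A \<in> sets borel" and A0: "emeasure pX A = 0" by (auto simp: sets_pX)
    have "(\<Sum>z. ennreal (pz z) * emeasure (dec z t) A) = 0"
      using mixture_dec[OF t, of "indicator A"] Ab A0 by (simp add: dec(2)[OF t] sets_pX)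
    then have "ennreal (pz z) * emeasure (dec z t) A = 0"
      by (subst (asm) suminf_eq_zero_iff) auto
    then have "emeasure (dec z t) A = 0" using z by (simp add: ennreal_eq_0_iff)
    then show "A \<in> null_sets (dec z t)" using Ab by (intro null_setsI) (simp_all add: dec(2)[OF t])
  qed
  have sD: "sets (dec z t) = sets pX" by (simp add: dec(2)[OF t] sets_pX)
  have fin: "AE y in pX. RN_deriv pX (dec z t) y \<noteq> \<infinity>"
    by (rule X.RN_deriv_finite[OF D.sigma_finite_measure_axioms ac sD])
  have "(\<integral>\<^sup>+ y. \<phi> y \<partial>dec z t) = (\<integral>\<^sup>+ y. RN_deriv pX (dec z t) y * \<phi> y \<partial>pX)"
    using \<phi> by (intro X.RN_deriv_nn_integral[OF ac sD]) (simp add: measurable_pX)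
  also have "\<dots> = (\<integral>\<^sup>+ y. ennreal (g z t y) * \<phi> y \<partial>pX)"
    by (intro nn_integral_cong_AE) (use fin in \<open>eventually_elim, simp add: g_def less_top\<close>)
  finally show ?thesis by simp
qed

text \<open>The factor \<open>pz z\<close> annihilates the junk value of \<open>g\<close> at indices
  of probability zero, so positivity of \<open>pz z\<close> no longer has to be assumed.\<close>

lemma density_pz_g:
  assumes t: "t < n" and \<phi>: "\<phi> \<in> borel_measurable borel"
  shows "(\<integral>\<^sup>+ y. ennreal (pz z * g z t y) * \<phi> y \<partial>pX) = ennreal (pz z) * (\<integral>\<^sup>+ y. \<phi> y \<partial>dec z t)"
proof (cases "pz z = 0")
  case False
  then have z: "pz z > 0" using pz_nonneg[of z] by simp
  have [measurable]: "\<phi> \<in> borel_measurable pX" using \<phi> by (simp add: measurable_pX)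
  have "(\<integral>\<^sup>+ y. ennreal (pz z * g z t y) * \<phi> y \<partial>pX) = (\<integral>\<^sup>+ y. ennreal (pz z) * (ennreal (g z t y) * \<phi> y) \<partial>pX)"
    by (intro nn_integral_cong) (simp add: ennreal_mult pz_nonneg g_nonneg mult.assoc)
  also have "\<dots> = ennreal (pz z) * (\<integral>\<^sup>+ y. ennreal (g z t y) * \<phi> y \<partial>pX)"
    by (rule nn_integral_cmult) measurable
  finally show ?thesis using density_g[OF t z \<phi>] by simp
qed simp

text \<open>These numbers are the posterior probabilities of \<open>Z = z\<close> given the output
  letter \<open>y\<close>, and they will be the weights in Jensen's inequality. Their sum and the
  constant 1 are both densities of \<open>pX\<close> relative to itself, and densities are unique
  almost everywhere.\<close>

lemma weights_sum:
  assumes t: "t < n"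
  shows "AE y in pX. (\<Sum>z. ennreal (pz z * g z t y)) = 1"
proof -
  interpret X: prob_space pX by (rule pX_prob)
  note [measurable] = g_measurable
  have m: "(\<lambda>y. \<Sum>z. ennreal (pz z * g z t y)) \<in> borel_measurable pX"
    by (subst measurable_pX) measurable
  have "density pX (\<lambda>y. \<Sum>z. ennreal (pz z * g z t y)) = density pX (\<lambda>_. 1)"
  proof (rule measure_eqI_nn_integral[where L=borel])
    fix \<phi> :: "'x \<Rightarrow> ennreal" assume \<phi>: "\<phi> \<in> borel_measurable borel"
    then have \<phi>p[measurable]: "\<phi> \<in> borel_measurable pX" by (simp add: measurable_pX)
    have "(\<integral>\<^sup>+ y. \<phi> y \<partial>density pX (\<lambda>y. \<Sum>z. ennreal (pz z * g z t y)))
        = (\<integral>\<^sup>+ y. (\<Sum>z. ennreal (pz z * g z t y)) * \<phi> y \<partial>pX)"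
      by (rule nn_integral_density[OF m \<phi>p])
    also have "\<dots> = (\<integral>\<^sup>+ y. (\<Sum>z. ennreal (pz z * g z t y) * \<phi> y) \<partial>pX)"
      by simp
    also have "\<dots> = (\<Sum>z. \<integral>\<^sup>+ y. ennreal (pz z * g z t y) * \<phi> y \<partial>pX)"
      by (rule nn_integral_suminf) measurable
    also have "\<dots> = (\<integral>\<^sup>+ y. \<phi> y \<partial>pX)"
      by (simp add: density_pz_g[OF t \<phi>] mixture_dec[OF t \<phi>])
    finally show "(\<integral>\<^sup>+ y. \<phi> y \<partial>density pX (\<lambda>y. \<Sum>z. ennreal (pz z * g z t y))) = (\<integral>\<^sup>+ y. \<phi> y \<partial>density pX (\<lambda>_. 1))"
      by (simp add: density_1)
  qed (simp_all add: sets_pX)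
  then show ?thesis
    by (subst (asm) X.density_unique_iff) (use m in auto)
qed

text \<open>Only indices with \<open>pz z = 0\<close> need an argument: there division by zero makes
  \<open>f\<close> vanish, and \<open>a z t\<close>, whose integral is \<open>pz z\<close>, vanishes
  almost everywhere.\<close>

lemma pz_f_eq_a:
  assumes t: "t < n"
  shows "AE x in pX. \<forall>z. pz z * f z t x = a z t x"
proof (subst AE_all_countable, intro allI)
  fix z
  show "AE x in pX. pz z * f z t x = a z t x"
  proof (cases "pz z = 0")
    case True
    have m: "(\<lambda>x. ennreal (a z t x)) \<in> borel_measurable pX"
      using a_measurable[OF t, of z] by (simp add: measurable_pX)
    have "AE x in pX. ennreal (a z t x) = 0"
      using a_integral[OF t, of z] True nn_integral_0_iff_AE[OF m] by simp
    then show ?thesis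
      by eventually_elim (use True a_nonneg[OF t] in \<open>auto simp: ennreal_eq_0_iff intro: antisym\<close>)
  qed (simp add: f_def)
qed

lemma H_integral_snd:
  assumes t: "t < n" and x: "\<forall>z. pz z * f z t x = a z t x" and \<phi>: "\<phi> \<in> borel_measurable borel"
  shows "(\<integral>\<^sup>+ y. H t x y * \<phi> y \<partial>pX) = (\<Sum>z. ennreal (a z t x) * (\<integral>\<^sup>+ y. \<phi> y \<partial>dec z t))"
proof -
  have [measurable]: "\<phi> \<in> borel_measurable pX"
    using \<phi> by (simp add: measurable_pX)
  have "(\<integral>\<^sup>+ y. H t x y * \<phi> y \<partial>pX)
      = (\<integral>\<^sup>+ y. (\<Sum>z. ennreal (f z t x) * (ennreal (pz z * g z t y) * \<phi> y)) \<partial>pX)"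
    unfolding H_def using f_nonneg[OF t] pz_nonneg g_nonneg
    by (intro nn_integral_cong)
      (simp add: ennreal_suminf_multc[symmetric] ennreal_mult'' ennreal_mult' mult_ac)
  also have "\<dots> = (\<Sum>z. \<integral>\<^sup>+ y. ennreal (f z t x) * (ennreal (pz z * g z t y) * \<phi> y) \<partial>pX)"
    by (rule nn_integral_suminf) measurable
  also have "\<dots> = (\<Sum>z. ennreal (f z t x) * (ennreal (pz z) * (\<integral>\<^sup>+ y. \<phi> y \<partial>dec z t)))"
    by (simp add: nn_integral_cmult density_pz_g[OF t \<phi>])
  also have "\<dots> = (\<Sum>z. ennreal (a z t x) * (\<integral>\<^sup>+ y. \<phi> y \<partial>dec z t))"
  proof (intro suminf_cong)
    fix z
    have "ennreal (a z t x) = ennreal (f z t x) * ennreal (pz z)"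
      using x f_nonneg[OF t, of z x] pz_nonneg[of z] by (metis ennreal_mult mult.commute)
    then show "ennreal (f z t x) * (ennreal (pz z) * (\<integral>\<^sup>+ y. \<phi> y \<partial>dec z t))
        = ennreal (a z t x) * (\<integral>\<^sup>+ y. \<phi> y \<partial>dec z t)" by (simp add: mult.assoc)
  qed
  finally show ?thesis .
qed

text \<open>Given the index, source letter and output letter are independent, so their joint density
  is a mixture over \<open>z\<close> of products; this identifies \<open>H t\<close> as the density
  of the pair at time \<open>t\<close>.\<close>

lemma H_integral:
  assumes t: "t < n" and \<phi>: "\<phi> \<in> borel_measurable (borel \<Otimes>\<^sub>M borel)"
  shows "(\<integral>\<^sup>+ x. \<integral>\<^sup>+ y. H t x y * \<phi> (x, y) \<partial>pX \<partial>pX) = (\<integral>\<^sup>+ p. \<phi> (fst p t, snd p t) \<partial>J)"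
proof -
  have dm: "(\<lambda>x. \<integral>\<^sup>+ y. \<phi> (x, y) \<partial>dec z t) \<in> borel_measurable borel" for z
    by (rule dec_section_measurable[OF t \<phi>])
  have \<phi>x: "(\<lambda>y. \<phi> (x, y)) \<in> borel_measurable borel" for x
    using measurable_compose[OF measurable_Pair1' \<phi>, of x] by simp
  have "(\<integral>\<^sup>+ x. \<integral>\<^sup>+ y. H t x y * \<phi> (x, y) \<partial>pX \<partial>pX)
      = (\<integral>\<^sup>+ x. (\<Sum>z. ennreal (a z t x) * (\<integral>\<^sup>+ y. \<phi> (x, y) \<partial>dec z t)) \<partial>pX)"
    by (intro nn_integral_cong_AE, use pz_f_eq_a[OF t] in eventually_elim) (rule H_integral_snd[OF t _ \<phi>x])
  also have "\<dots> = (\<Sum>z. \<integral>\<^sup>+ x. ennreal (a z t x) * (\<integral>\<^sup>+ y. \<phi> (x, y) \<partial>dec z t) \<partial>pX)"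
    using dm a_measurable[OF t]
    by (intro nn_integral_suminf) (simp add: measurable_pX)
  also have "\<dots> = (\<Sum>z. \<integral>\<^sup>+ x. ennreal (enc z x) * (\<integral>\<^sup>+ y. \<phi> (x t, y) \<partial>dec z t) \<partial>Xn)"
    using nn_integral_enc_component[OF t dm] by simp
  also have "\<dots> = (\<integral>\<^sup>+ p. \<phi> (fst p t, snd p t) \<partial>J)"
    by (rule nn_integral_J_component[OF t \<phi>, symmetric])
  finally show ?thesis .
qed

lemma H_row:
  assumes t: "t < n"
  shows "AE x in pX. (\<integral>\<^sup>+ y. H t x y \<partial>pX) = 1"
  using pz_f_eq_a[OF t]
proof eventually_elim
  case (elim x)
  show ?case
    using H_integral_snd[OF t elim, of "\<lambda>_. 1"] a_sum[OF t, of x]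
    by (simp add: prob_space.emeasure_space_1[OF dec(1)[OF t]])
qed

lemma f_integral:
  assumes t: "t < n" and z: "pz z > 0"
  shows "(\<integral>\<^sup>+ x. ennreal (f z t x) \<partial>pX) = 1"
proof -
  have [measurable]: "a z t \<in> borel_measurable pX"
    using a_measurable[OF t] by (simp add: measurable_pX)
  have "(\<integral>\<^sup>+ x. ennreal (f z t x) \<partial>pX) = (\<integral>\<^sup>+ x. ennreal (a z t x) * ennreal (1 / pz z) \<partial>pX)"
    using z by (intro nn_integral_cong) (simp add: f_def ennreal_mult''[symmetric])
  also have "\<dots> = ennreal (pz z) * ennreal (1 / pz z)"
    by (subst nn_integral_multc) (auto simp: a_integral[OF t])
  also have "\<dots> = 1" using z by (simp add: ennreal_mult''[symmetric])
  finally show ?thesis .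
qed

lemma H_column:
  assumes t: "t < n"
  shows "AE y in pX. (\<integral>\<^sup>+ x. H t x y \<partial>pX) = 1"
  using weights_sum[OF t]
proof eventually_elim
  case (elim y)
  note [measurable] = f_measurable'[OF t]
  have "(\<integral>\<^sup>+ x. H t x y \<partial>pX) = (\<Sum>z. \<integral>\<^sup>+ x. ennreal (pz z * g z t y) * ennreal (f z t x) \<partial>pX)"
    unfolding H_def using pz_nonneg g_nonneg f_nonneg[OF t]
    by (subst nn_integral_suminf[symmetric]) (auto simp: ennreal_mult)
  also have "\<dots> = (\<Sum>z. ennreal (pz z * g z t y))"
  proof (intro suminf_cong)
    fix z
    show "(\<integral>\<^sup>+ x. ennreal (pz z * g z t y) * ennreal (f z t x) \<partial>pX) = ennreal (pz z * g z t y)"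
      using f_integral[OF t, of z] pz_nonneg[of z]
      by (cases "pz z = 0") (auto simp: nn_integral_cmult)
  qed
  finally show ?case using elim by simp
qed

text \<open>A nonnegative function with integral 1 is finite almost everywhere. Both orders are
  recorded: one serves the rows of the averaged coupling, the other its columns.\<close>

lemma H_finite:
  assumes "t < n"
  shows "AE x in pX. AE y in pX. H t x y \<noteq> \<infinity>" and "AE y in pX. AE x in pX. H t x y \<noteq> \<infinity>"
proof -
  note m1 = H_section(1)[OF assms] and m2 = H_section(2)[OF assms]
  show "AE x in pX. AE y in pX. H t x y \<noteq> \<infinity>"
    using H_row[OF assms] by eventually_elim (intro nn_integral_PInf_AE m1, simp)
  show "AE y in pX. AE x in pX. H t x y \<noteq> \<infinity>"
    using H_column[OF assms] by eventually_elim (intro nn_integral_PInf_AE m2, simp)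
qed

section \<open>The time-averaged coupling\<close>

definition h :: "'x \<Rightarrow> 'x \<Rightarrow> real" where
  "h x y = (\<Sum>t<n. (1 / real n) * enn2real (H t x y))"

lemma h_nonneg: "0 \<le> h x y"
  unfolding h_def by (intro sum_nonneg) auto

lemma h_measurable: "case_prod h \<in> borel_measurable (borel \<Otimes>\<^sub>M borel)"
proof -
  have "(\<lambda>p. \<Sum>t<n. (1 / real n) * enn2real (case_prod (H t) p)) \<in> borel_measurable (borel \<Otimes>\<^sub>M borel)"
    using H_measurable by (intro borel_measurable_sum borel_measurable_times borel_measurable_enn2real) auto
  moreover have "case_prod h = (\<lambda>p. \<Sum>t<n. (1 / real n) * enn2real (case_prod (H t) p))"
    by (auto simp: h_def)
  ultimately show ?thesis by simp
qed

lemma h_eq_H: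
  assumes "\<And>t. t < n \<Longrightarrow> H t x y \<noteq> \<infinity>"
  shows "ennreal (h x y) = (\<Sum>t<n. inv_n * H t x y)"
proof -
  have "ennreal (h x y) = (\<Sum>t<n. ennreal ((1 / real n) * enn2real (H t x y)))"
    unfolding h_def by (subst sum_ennreal) auto
  also have "\<dots> = (\<Sum>t<n. inv_n * H t x y)"
  proof (intro sum.cong refl)
    fix t assume "t \<in> {..<n}"
    then have "H t x y < top" using assms by (auto simp: less_top)
    moreover have "ennreal ((1 / real n) * enn2real (H t x y)) = inv_n * ennreal (enn2real (H t x y))"
      by (rule ennreal_mult) auto
    ultimately show "ennreal ((1 / real n) * enn2real (H t x y)) = inv_n * H t x y" by simp
  qed
  finally show ?thesis .
qed

lemma h_eq_H_AE:
  "AE x in pX. AE y in pX. ennreal (h x y) = (\<Sum>t<n. inv_n * H t x y)"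
  "AE y in pX. AE x in pX. ennreal (h x y) = (\<Sum>t<n. inv_n * H t x y)"
proof -
  have 1: "AE x in pX. \<forall>t\<in>{..<n}. AE y in pX. H t x y \<noteq> \<infinity>"
    by (intro AE_finite_allI) (use H_finite in auto)
  show "AE x in pX. AE y in pX. ennreal (h x y) = (\<Sum>t<n. inv_n * H t x y)"
    using 1
  proof eventually_elim
    case (elim x)
    then have "AE y in pX. \<forall>t\<in>{..<n}. H t x y \<noteq> \<infinity>" by (intro AE_finite_allI) auto
    then show ?case by eventually_elim (intro h_eq_H, auto)
  qed
  have 2: "AE y in pX. \<forall>t\<in>{..<n}. AE x in pX. H t x y \<noteq> \<infinity>"
    by (intro AE_finite_allI) (use H_finite in auto)
  show "AE y in pX. AE x in pX. ennreal (h x y) = (\<Sum>t<n. inv_n * H t x y)"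
    using 2
  proof eventually_elim
    case (elim y)
    then have "AE x in pX. \<forall>t\<in>{..<n}. H t x y \<noteq> \<infinity>" by (intro AE_finite_allI) auto
    then show ?case by eventually_elim (intro h_eq_H, auto)
  qed
qed

lemma sum_inv_n: "n > 0 \<Longrightarrow> (\<Sum>t<n. inv_n) = 1"
  by (subst sum_ennreal) auto

lemma h_section_integral:
  assumes n: "n > 0" and eq: "AE v in pX. ennreal (k v) = (\<Sum>t<n. inv_n * \<phi> t v)"
    and m: "\<And>t. t < n \<Longrightarrow> \<phi> t \<in> borel_measurable pX"
    and one: "\<And>t. t < n \<Longrightarrow> (\<integral>\<^sup>+ v. \<phi> t v \<partial>pX) = 1"
  shows "(\<integral>\<^sup>+ v. ennreal (k v) \<partial>pX) = 1"
proof -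
  have "(\<integral>\<^sup>+ v. ennreal (k v) \<partial>pX) = (\<integral>\<^sup>+ v. (\<Sum>t<n. inv_n * \<phi> t v) \<partial>pX)"
    using eq by (rule nn_integral_cong_AE)
  also have "\<dots> = (\<Sum>t<n. inv_n * (\<integral>\<^sup>+ v. \<phi> t v \<partial>pX))"
    by (rule nn_integral_sum_cmult) (use m in auto)
  finally show ?thesis using sum_inv_n[OF n] one by simp
qed

lemma h_row:
  assumes n: "n > 0"
  shows "AE x in pX. (\<integral>\<^sup>+ y. ennreal (h x y) \<partial>pX) = 1"
proof -
  have "AE x in pX. \<forall>t\<in>{..<n}. (\<integral>\<^sup>+ y. H t x y \<partial>pX) = 1"
    by (intro AE_finite_allI) (use H_row in auto)
  then show ?thesis using h_eq_H_AE(1)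
    by eventually_elim (erule h_section_integral[OF n], auto simp: H_section)
qed

lemma h_column:
  assumes n: "n > 0"
  shows "AE y in pX. (\<integral>\<^sup>+ x. ennreal (h x y) \<partial>pX) = 1"
proof -
  have "AE y in pX. \<forall>t\<in>{..<n}. (\<integral>\<^sup>+ x. H t x y \<partial>pX) = 1"
    by (intro AE_finite_allI) (use H_column in auto)
  then show ?thesis using h_eq_H_AE(2)
    by eventually_elim (erule h_section_integral[OF n], auto simp: H_section)
qed

lemma h_distortion:
  "(\<integral>\<^sup>+ x. \<integral>\<^sup>+ y. ennreal (h x y) * ennreal (\<Delta> x y) \<partial>pX \<partial>pX)
     = (\<Sum>t<n. inv_n * (\<integral>\<^sup>+ p. ennreal (\<Delta> (fst p t) (snd p t)) \<partial>J))"
proof -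
  interpret X: prob_space pX by (rule pX_prob)
  have \<Delta>': "(\<lambda>p. ennreal (\<Delta> (fst p) (snd p))) \<in> borel_measurable (borel \<Otimes>\<^sub>M borel)"
    using \<Delta> by measurable
  have m2: "(\<lambda>p. H t (fst p) (snd p) * ennreal (\<Delta> (fst p) (snd p))) \<in> borel_measurable (borel \<Otimes>\<^sub>M borel)" if "t < n" for t
    using H_measurable[OF that] \<Delta>' by (simp add: case_prod_beta')
  have m1: "(\<lambda>y. H t x y * ennreal (\<Delta> x y)) \<in> borel_measurable pX" if "t < n" for t x
    using measurable_compose[OF measurable_Pair1' m2[OF that], of x]
    by (simp add: measurable_pX)
  have spp: "sets (borel \<Otimes>\<^sub>M pX) = sets (borel \<Otimes>\<^sub>M borel)"
    by (intro sets_pair_measure_cong) (auto simp: sets_pX)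
  have m3: "(\<lambda>x. \<integral>\<^sup>+ y. H t x y * ennreal (\<Delta> x y) \<partial>pX) \<in> borel_measurable pX" if "t < n" for t
    using m2[OF that]
    by (subst measurable_pX, intro X.borel_measurable_nn_integral)
       (simp add: measurable_cong_sets[OF spp refl] case_prod_beta')
  have "(\<integral>\<^sup>+ x. \<integral>\<^sup>+ y. ennreal (h x y) * ennreal (\<Delta> x y) \<partial>pX \<partial>pX)
      = (\<integral>\<^sup>+ x. \<integral>\<^sup>+ y. (\<Sum>t<n. inv_n * (H t x y * ennreal (\<Delta> x y))) \<partial>pX \<partial>pX)"
  proof (intro nn_integral_cong_AE, use h_eq_H_AE(1) in eventually_elim)
    case (elim x)
    then have "AE y in pX. ennreal (h x y) * ennreal (\<Delta> x y)
        = (\<Sum>t<n. inv_n * (H t x y * ennreal (\<Delta> x y)))"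
      by eventually_elim (simp add: sum_distrib_right mult.assoc)
    then show ?case by (rule nn_integral_cong_AE)
  qed
  also have "\<dots> = (\<integral>\<^sup>+ x. (\<Sum>t<n. inv_n * (\<integral>\<^sup>+ y. H t x y * ennreal (\<Delta> x y) \<partial>pX)) \<partial>pX)"
    by (intro nn_integral_cong nn_integral_sum_cmult) (simp add: m1)
  also have "\<dots> = (\<Sum>t<n. inv_n * (\<integral>\<^sup>+ x. \<integral>\<^sup>+ y. H t x y * ennreal (\<Delta> x y) \<partial>pX \<partial>pX))"
    by (intro nn_integral_sum_cmult) (simp add: m3)
  also have "\<dots> = (\<Sum>t<n. inv_n * (\<integral>\<^sup>+ p. ennreal (\<Delta> (fst p t) (snd p t)) \<partial>J))"
    using H_integral[OF _ \<Delta>'] by simp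
  finally show ?thesis .
qed

text \<open>Jensen's inequality twice: over \<open>t\<close> with uniform weights, then for each
  \<open>t\<close> over \<open>z\<close> with the posterior weights \<open>pz z * g z t y\<close>,
  under which the mean of \<open>f z t x\<close> is \<open>H t x y\<close>.\<close>

lemma psi_h_le:
  assumes n: "n > 0"
    and fin: "\<And>t. t < n \<Longrightarrow> H t x y \<noteq> \<infinity>"
    and w: "\<And>t. t < n \<Longrightarrow> (\<Sum>z. ennreal (pz z * g z t y)) = 1"
  shows "ennreal (psi (h x y)) \<le> (\<Sum>t<n. inv_n * (\<Sum>z. ennreal (pz z * g z t y * psi (f z t x))))"
proof -
  \<comment> \<open>Uniform weights on \<open>{..<n}\<close> continued by 0, to fit the countable
    form of \<open>psi_jensen\<close>.\<close>
  define w' where "w' = (\<lambda>t. if t < n then 1 / real n else 0)"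
  define r where "r = (\<lambda>t. enn2real (H t x y))"
  have "ennreal (psi (h x y)) \<le> (\<Sum>t. ennreal (w' t * psi (r t)))"
  proof (rule psi_jensen)
    have "(\<Sum>t. ennreal (w' t)) = (\<Sum>t<n. ennreal (w' t))"
      by (rule suminf_finite) (auto simp: w'_def)
    then show "(\<Sum>t. ennreal (w' t)) = 1"
      using sum_inv_n[OF n] by (simp add: w'_def)
    have "(\<Sum>t. ennreal (w' t * r t)) = (\<Sum>t<n. ennreal (w' t * r t))"
      by (rule suminf_finite) (auto simp: w'_def)
    also have "\<dots> = ennreal (\<Sum>t<n. w' t * r t)"
      by (rule sum_ennreal) (auto simp: w'_def r_def)
    also have "(\<Sum>t<n. w' t * r t) = h x y"
      unfolding h_def by (intro sum.cong) (auto simp: w'_def r_def)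
    finally show "(\<Sum>t. ennreal (w' t * r t)) = ennreal (h x y)" .
  qed (auto simp: w'_def r_def h_nonneg)
  also have "\<dots> = (\<Sum>t<n. ennreal (w' t * psi (r t)))"
    by (rule suminf_finite) (auto simp: w'_def)
  also have "\<dots> = (\<Sum>t<n. inv_n * ennreal (psi (r t)))"
  proof (intro sum.cong refl)
    fix t assume "t \<in> {..<n}"
    then have "w' t = 1 / real n" by (simp add: w'_def)
    moreover have "ennreal ((1 / real n) * psi (r t)) = inv_n * ennreal (psi (r t))"
      by (rule ennreal_mult) (auto simp: psi_nonneg r_def)
    ultimately show "ennreal (w' t * psi (r t)) = inv_n * ennreal (psi (r t))" by simp
  qed
  also have "\<dots> \<le> (\<Sum>t<n. inv_n * (\<Sum>z. ennreal (pz z * g z t y * psi (f z t x))))"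
  proof (intro sum_mono mult_left_mono)
    fix t assume "t \<in> {..<n}"
    then have t: "t < n" by simp
    show "ennreal (psi (r t)) \<le> (\<Sum>z. ennreal (pz z * g z t y * psi (f z t x)))"
      by (rule psi_jensen)
         (use fin[OF t] w[OF t] f_nonneg[OF t] in \<open>auto simp: pz_nonneg g_nonneg r_def H_def[symmetric] less_top\<close>)
  qed simp
  finally show ?thesis .
qed

text \<open>After Jensen, \<open>y\<close> enters only through the posterior weights, and these
  integrate to \<open>pz z\<close>. What remains is the mean over \<open>z\<close> of the
  divergences of the source letters given \<open>Z = z\<close>, which superadditivity bounds by
  \<open>- ln (pz z)\<close>.\<close>

lemma psi_h_integral_le:
  assumes n: "n > 0"
  shows "(\<integral>\<^sup>+ x. \<integral>\<^sup>+ y. ennreal (psi (h x y)) \<partial>pX \<partial>pX) \<le> inv_n * disc_entropy (Xn \<bind> E)"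
proof -
  have pm: "(\<lambda>x. ennreal (psi (f z t x))) \<in> borel_measurable pX" if "t < n" for z t
    by (rule measurable_compose[OF f_measurable'[OF that]]) measurable
  have 1: "AE x in pX. \<forall>t\<in>{..<n}. AE y in pX. H t x y \<noteq> \<infinity>"
    by (intro AE_finite_allI) (use H_finite in auto)
  have 2: "AE y in pX. \<forall>t\<in>{..<n}. (\<Sum>z. ennreal (pz z * g z t y)) = 1"
    by (intro AE_finite_allI) (use weights_sum in auto)
  have inner: "(\<integral>\<^sup>+ y. ennreal (pz z * g z t y * psi (f z t x)) \<partial>pX) = ennreal (pz z) * ennreal (psi (f z t x))"
    if "t < n" for z t x
  proof -
    have "(\<integral>\<^sup>+ y. ennreal (pz z * g z t y * psi (f z t x)) \<partial>pX)
       = (\<integral>\<^sup>+ y. ennreal (pz z * g z t y) * ennreal (psi (f z t x)) \<partial>pX)"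
      using f_nonneg[OF that] by (intro nn_integral_cong) (simp add: ennreal_mult pz_nonneg g_nonneg psi_nonneg)
    also have "\<dots> = ennreal (pz z) * (\<integral>\<^sup>+ y. ennreal (psi (f z t x)) \<partial>dec z t)"
      by (rule density_pz_g[OF that]) simp
    finally show ?thesis by (simp add: prob_space.emeasure_space_1[OF dec(1)[OF that]])
  qed
  have "(\<integral>\<^sup>+ x. \<integral>\<^sup>+ y. ennreal (psi (h x y)) \<partial>pX \<partial>pX)
      \<le> (\<integral>\<^sup>+ x. \<integral>\<^sup>+ y. (\<Sum>t<n. inv_n * (\<Sum>z. ennreal (pz z * g z t y * psi (f z t x)))) \<partial>pX \<partial>pX)"
  proof (intro nn_integral_mono_AE, use 1 in eventually_elim)
    case (elim x)
    then have "AE y in pX. \<forall>t\<in>{..<n}. H t x y \<noteq> \<infinity>" by (intro AE_finite_allI) auto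
    with 2 have "AE y in pX. ennreal (psi (h x y)) \<le> (\<Sum>t<n. inv_n * (\<Sum>z. ennreal (pz z * g z t y * psi (f z t x))))"
      by eventually_elim (intro psi_h_le[OF n], auto)
    then show ?case by (rule nn_integral_mono_AE)
  qed
  also have "\<dots> = (\<integral>\<^sup>+ x. (\<Sum>t<n. inv_n * (\<Sum>z. ennreal (pz z) * ennreal (psi (f z t x)))) \<partial>pX)"
  proof (intro nn_integral_cong)
    fix x
    have "(\<integral>\<^sup>+ y. (\<Sum>t<n. inv_n * (\<Sum>z. ennreal (pz z * g z t y * psi (f z t x)))) \<partial>pX)
       = (\<Sum>t<n. inv_n * (\<integral>\<^sup>+ y. (\<Sum>z. ennreal (pz z * g z t y * psi (f z t x))) \<partial>pX))"
      by (simp add: nn_integral_sum nn_integral_cmult)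
    also have "\<dots> = (\<Sum>t<n. inv_n * (\<Sum>z. \<integral>\<^sup>+ y. ennreal (pz z * g z t y * psi (f z t x)) \<partial>pX))"
      by (simp add: nn_integral_suminf)
    finally show "(\<integral>\<^sup>+ y. (\<Sum>t<n. inv_n * (\<Sum>z. ennreal (pz z * g z t y * psi (f z t x)))) \<partial>pX)
       = (\<Sum>t<n. inv_n * (\<Sum>z. ennreal (pz z) * ennreal (psi (f z t x))))"
      by (simp add: inner)
  qed
  also have "\<dots> = (\<Sum>t<n. inv_n * (\<integral>\<^sup>+ x. (\<Sum>z. ennreal (pz z) * ennreal (psi (f z t x))) \<partial>pX))"
  proof -
    have "(\<lambda>x. \<Sum>z. ennreal (pz z) * ennreal (psi (f z t x))) \<in> borel_measurable pX" if "t < n" for t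
      using pm[OF that] by (intro borel_measurable_suminf_order borel_measurable_times_ennreal) auto
    then show ?thesis by (intro nn_integral_sum_cmult) auto
  qed
  also have "\<dots> = (\<Sum>t<n. inv_n * (\<Sum>z. ennreal (pz z) * (\<integral>\<^sup>+ x. ennreal (psi (f z t x)) \<partial>pX)))"
    using pm by (simp add: nn_integral_suminf nn_integral_cmult)
  \<comment> \<open>The sum over \<open>t\<close> is moved inside the sum over \<open>z\<close>,
    since superadditivity applies to one index at a time.\<close>
  also have "\<dots> = inv_n * (\<Sum>z. \<Sum>t<n. ennreal (pz z) * (\<integral>\<^sup>+ x. ennreal (psi (f z t x)) \<partial>pX))"
    by (subst suminf_sum) (auto simp: sum_distrib_left)
  also have "\<dots> \<le> inv_n * (\<Sum>z. ennreal (- (pz z * ln (pz z))))"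
  proof (intro mult_left_mono suminf_le)
    fix z
    show "(\<Sum>t<n. ennreal (pz z) * (\<integral>\<^sup>+ x. ennreal (psi (f z t x)) \<partial>pX)) \<le> ennreal (- (pz z * ln (pz z)))"
    proof (cases "pz z = 0")
      case False
      then have z: "pz z > 0" using pz_nonneg[of z] by simp
      have "(\<Sum>t<n. ennreal (pz z) * (\<integral>\<^sup>+ x. ennreal (psi (f z t x)) \<partial>pX)) \<le> ennreal (pz z) * ennreal (- ln (pz z))"
        by (subst sum_distrib_left[symmetric]) (intro mult_left_mono f_psi_le z, simp)
      also have "\<dots> = ennreal (- (pz z * ln (pz z)))"
        using z by (simp add: ennreal_mult'[symmetric])
      finally show ?thesis .
    qed simp
  qed auto
  finally show ?thesis by (simp add: disc_entropy_def pz_def)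
qed

lemma RDP_le_entropy:
  assumes n: "n > 0" and d: "d pX pX = 0"
    and dist: "(\<Sum>t<n. enn2ereal (\<integral>\<^sup>+ p. ennreal (\<Delta> (fst p t) (snd p t)) \<partial>J)) / ereal (real n) \<le> ereal D"
  shows "RDP pX \<Delta> d D 0 \<le> enn2ereal (disc_entropy (Xn \<bind> E)) / ereal (real n)"
proof -
  have div: "enn2ereal (inv_n * c) = enn2ereal c / ereal (real n)" for c
    using n by (simp add: times_ennreal.rep_eq divide_ereal_def mult.commute)
       (simp add: inverse_eq_divide)
  have esum: "enn2ereal (\<Sum>t\<in>I. v t) = (\<Sum>t\<in>I. enn2ereal (v t))" for I :: "nat set" and v
    by (induction I rule: infinite_finite_induct) (auto simp: plus_ennreal.rep_eq zero_ennreal.rep_eq)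
  have "RDP pX \<Delta> d D 0 \<le> enn2ereal (\<integral>\<^sup>+ x. \<integral>\<^sup>+ y. ennreal (psi (h x y)) \<partial>pX \<partial>pX)"
  proof (rule RDP_le[where h=h and d=d and pX=pX and \<Delta>=\<Delta>])
    have "(\<integral>\<^sup>+ x. \<integral>\<^sup>+ y. ennreal (h x y) * ennreal (\<Delta> x y) \<partial>pX \<partial>pX)
       = inv_n * (\<Sum>t<n. (\<integral>\<^sup>+ p. ennreal (\<Delta> (fst p t) (snd p t)) \<partial>J))"
      unfolding h_distortion by (simp add: sum_distrib_left)
    then show "enn2ereal (\<integral>\<^sup>+ x. \<integral>\<^sup>+ y. ennreal (h x y) * ennreal (\<Delta> x y) \<partial>pX \<partial>pX) \<le> ereal D"
      using dist by (simp only: div esum)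
  qed (use pX \<Delta> h_measurable h_nonneg h_row[OF n] h_column[OF n] d in auto)
  also have "\<dots> \<le> enn2ereal (inv_n * disc_entropy (Xn \<bind> E))"
    using psi_h_integral_le[OF n] by (simp add: less_eq_ennreal.rep_eq)
  finally show ?thesis by (simp only: div)
qed

end

end

section \<open>Soft covering\<close>

text \<open>The exponential series is compared term by term: orders 0 and 1 are kept, and
  \<open>\<theta> ^ k \<le> \<theta>\<^sup>2\<close> for \<open>k \<ge> 2\<close>. The error
  quadratic in \<open>\<theta>\<close> is what makes a small tilt profitable in the Chernoff
  bound.\<close>

lemma exp_mult_le:
  fixes y \<theta> :: real
  assumes "0 \<le> \<theta>" "\<theta> \<le> 1"
  shows "exp (\<theta> * y) \<le> 1 + \<theta> * y + \<theta>\<^sup>2 * exp \<bar>y\<bar>"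
proof -
  have S: "(\<lambda>k. u ^ k / fact k) sums exp u" for u :: real
    using exp_converges[of u] by (simp add: field_simps)
  have s1: "(\<lambda>k. if k = 0 then 1 else 0) sums (1 :: real)"
    using sums_single[of 0 "\<lambda>_. 1 :: real"] by simp
  have s2: "(\<lambda>k. if k = 1 then \<theta> * y else 0) sums (\<theta> * y)"
    using sums_single[of 1 "\<lambda>_. \<theta> * y"] by simp
  have s3: "(\<lambda>k. (if k = 0 then 1 else 0) + (if k = 1 then \<theta> * y else 0) + \<theta>\<^sup>2 * (\<bar>y\<bar> ^ k / fact k))
      sums (1 + \<theta> * y + \<theta>\<^sup>2 * exp \<bar>y\<bar>)"
    by (intro sums_add s1 s2 sums_mult S)
  have "(\<theta> * y) ^ k / fact k \<le> (if k = 0 then 1 else 0) + (if k = 1 then \<theta> * y else 0) + \<theta>\<^sup>2 * (\<bar>y\<bar> ^ k / fact k)" for k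
  proof (cases "k \<ge> 2")
    case True
    have "(\<theta> * y) ^ k \<le> \<theta> ^ k * \<bar>y\<bar> ^ k"
      using assms abs_ge_self[of "(\<theta> * y) ^ k"] by (simp add: abs_mult power_abs power_mult_distrib)
    also have "\<dots> \<le> \<theta>\<^sup>2 * \<bar>y\<bar> ^ k"
      using assms True by (intro mult_right_mono power_decreasing) auto
    finally show ?thesis using True by (simp add: divide_right_mono)
  next
    case False
    then have "k = 0 \<or> k = 1" by auto
    then show ?thesis by auto
  qed
  from sums_le[OF this S s3] show ?thesis .
qed

text \<open>Independence in finite form: the expectation of a product of functions of separate
  codebook entries factors.\<close>

lemma sum_weight_prod:
  fixes P :: "'w \<Rightarrow> real" and M :: nat
  assumes "finite W"
  shows "(\<Sum>C\<in>PiE {..<M} (\<lambda>_. W). (\<Prod>z<M. P (C z)) * (\<Prod>z<M. k z (C z))) = (\<Prod>z<M. \<Sum>v\<in>W. P v * k z v)"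
  using assms by (subst prod_sum_PiE) (auto simp: prod.distrib)

text \<open>The random codebook: \<open>M\<close> independent entries of law \<open>P\<close>.
  Expectations are finite sums over \<open>CB\<close> weighted by \<open>wt\<close>, so no second
  probability space is introduced.\<close>

locale finite_weights =
  fixes W :: "'w set" and P :: "'w \<Rightarrow> real" and M :: nat
  assumes W: "finite W" and P_nonneg: "\<And>v. v \<in> W \<Longrightarrow> 0 \<le> P v" and P_sum: "(\<Sum>v\<in>W. P v) = 1"
begin

abbreviation "CB \<equiv> PiE {..<M} (\<lambda>_. W)"

definition wt :: "(nat \<Rightarrow> 'w) \<Rightarrow> real" where
  "wt C = (\<Prod>z<M. P (C z))"

lemma CB_finite: "finite CB"
  using W by (intro finite_PiE) auto

lemma wt_nonneg: "C \<in> CB \<Longrightarrow> 0 \<le> wt C"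
  unfolding wt_def by (intro prod_nonneg) (auto intro: P_nonneg)

lemma wt_sum: "(\<Sum>C\<in>CB. wt C) = 1"
  using sum_weight_prod[OF W, where M=M and P=P and k="\<lambda>_ _. 1"] P_sum by (simp add: wt_def)

text \<open>For \<open>i \<noteq> j\<close> the expectation factors and one factor is the mean of
  \<open>g\<close>, which is zero; only the diagonal survives.\<close>

lemma wt_pair:
  assumes i: "i < M" "j < M" and g: "(\<Sum>v\<in>W. P v * g v) = 0"
  shows "(\<Sum>C\<in>CB. wt C * (g (C i) * g (C j))) = (if i = j then \<Sum>v\<in>W. P v * (g v)\<^sup>2 else 0)"
proof -
  \<comment> \<open>Placing both factors in one family makes the entry \<open>i = j\<close> carry
    the square automatically.\<close>
  define k where "k = (\<lambda>z v. (if z = i then g v else 1) * (if z = j then g v else 1))"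
  have "(\<Prod>z<M. k z (C z)) = g (C i) * g (C j)" for C
    unfolding k_def using i by (simp add: prod.distrib)
  then have "(\<Sum>C\<in>CB. wt C * (g (C i) * g (C j))) = (\<Prod>z<M. \<Sum>v\<in>W. P v * k z v)"
    using sum_weight_prod[OF W, where M=M and P=P and k=k] by (simp add: wt_def)
  also have "\<dots> = (if i = j then \<Sum>v\<in>W. P v * (g v)\<^sup>2 else 0)"
  proof (cases "i = j")
    case True
    have "(\<Prod>z<M. \<Sum>v\<in>W. P v * k z v) = (\<Prod>z<M. if z = i then \<Sum>v\<in>W. P v * (g v)\<^sup>2 else 1)"
      using True P_sum by (intro prod.cong) (auto simp: k_def power2_eq_square)
    then show ?thesis using True i by simp
  next
    case False
    have "(\<Sum>v\<in>W. P v * k i v) = 0" using False g by (simp add: k_def)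
    then show ?thesis using False i by (auto intro!: prod_zero)
  qed
  finally show ?thesis .
qed

lemma wt_second_moment:
  assumes g: "(\<Sum>v\<in>W. P v * g v) = 0"
  shows "(\<Sum>C\<in>CB. wt C * (\<Sum>z<M. g (C z))\<^sup>2) = real M * (\<Sum>v\<in>W. P v * (g v)\<^sup>2)"
proof -
  have "(\<Sum>C\<in>CB. wt C * (\<Sum>z<M. g (C z))\<^sup>2) = (\<Sum>C\<in>CB. \<Sum>i<M. \<Sum>j<M. wt C * (g (C i) * g (C j)))"
    unfolding power2_eq_square sum_product unfolding sum_distrib_left ..
  also have "\<dots> = (\<Sum>i<M. \<Sum>j<M. \<Sum>C\<in>CB. wt C * (g (C i) * g (C j)))"
    by (subst sum.swap, rule sum.cong[OF refl], subst sum.swap, rule refl)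
  also have "\<dots> = (\<Sum>i<M. \<Sum>j<M. if i = j then \<Sum>v\<in>W. P v * (g v)\<^sup>2 else 0)"
    by (intro sum.cong refl) (auto simp: wt_pair[OF _ _ g])
  also have "\<dots> = real M * (\<Sum>v\<in>W. P v * (g v)\<^sup>2)"
    by simp
  finally show ?thesis .
qed

lemma wt_variance:
  assumes M: "M > 0" and \<mu>: "\<mu> = (\<Sum>v\<in>W. P v * \<phi> v)"
  shows "(\<Sum>C\<in>CB. wt C * ((\<Sum>z<M. \<phi> (C z)) / M - \<mu>)\<^sup>2) \<le> (\<Sum>v\<in>W. P v * (\<phi> v)\<^sup>2) / M"
proof -
  define g where "g = (\<lambda>v. \<phi> v - \<mu>)"
  have g0: "(\<Sum>v\<in>W. P v * g v) = 0"
    by (simp add: g_def right_diff_distrib sum_subtractf \<mu> sum_distrib_right[symmetric] P_sum)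
  have gM: "(\<Sum>z<M. \<phi> (C z)) / M - \<mu> = (\<Sum>z<M. g (C z)) / M" for C
    using M by (simp add: g_def sum_subtractf field_simps)
  have "(\<Sum>C\<in>CB. wt C * ((\<Sum>z<M. \<phi> (C z)) / M - \<mu>)\<^sup>2) = (\<Sum>C\<in>CB. wt C * (\<Sum>z<M. g (C z))\<^sup>2) / (real M)\<^sup>2"
    unfolding gM power_divide by (simp add: sum_divide_distrib[of "\<lambda>C. wt C * (\<Sum>z<M. g (C z))\<^sup>2"])
  also have "\<dots> = (\<Sum>v\<in>W. P v * (g v)\<^sup>2) / M"
    unfolding wt_second_moment[OF g0] using M by (simp add: power2_eq_square[of "real M"])
  also have "(\<Sum>v\<in>W. P v * (g v)\<^sup>2) = (\<Sum>v\<in>W. P v * (\<phi> v)\<^sup>2 - 2 * \<mu> * (P v * \<phi> v) + \<mu>\<^sup>2 * P v)"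
    by (intro sum.cong) (auto simp: g_def power2_eq_square algebra_simps)
  also have "\<dots> = (\<Sum>v\<in>W. P v * (\<phi> v)\<^sup>2) - \<mu>\<^sup>2"
    by (simp add: sum.distrib sum_subtractf sum_distrib_left[symmetric] P_sum \<mu>[symmetric] power2_eq_square)
  also have "\<dots> / M \<le> (\<Sum>v\<in>W. P v * (\<phi> v)\<^sup>2) / M"
    using M by (intro divide_right_mono) auto
  finally show ?thesis .
qed

text \<open>\<open>\<bar>y\<bar> \<le> \<delta> + y\<^sup>2 / \<delta>\<close> passes from second to
  first moments without Cauchy-Schwarz and its square root.\<close>

lemma wt_mean_abs:
  fixes \<delta> :: real
  assumes M: "M > 0" and \<mu>: "\<mu> = (\<Sum>v\<in>W. P v * \<phi> v)" and \<delta>: "\<delta> > 0"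
  shows "(\<Sum>C\<in>CB. wt C * \<bar>(\<Sum>z<M. \<phi> (C z)) / M - \<mu>\<bar>) \<le> \<delta> + (\<Sum>v\<in>W. P v * (\<phi> v)\<^sup>2) / (M * \<delta>)"
proof -
  have abs: "\<bar>y\<bar> \<le> \<delta> + y\<^sup>2 / \<delta>" for y :: real
  proof -
    have "0 \<le> (\<bar>y\<bar> - \<delta>)\<^sup>2 + \<bar>y\<bar> * \<delta>" using \<delta> by simp
    then have "\<bar>y\<bar> * \<delta> \<le> \<delta> * \<delta> + y\<^sup>2" by (simp add: power2_eq_square algebra_simps)
    then show ?thesis using \<delta> by (simp add: field_simps)
  qed
  have "(\<Sum>C\<in>CB. wt C * \<bar>(\<Sum>z<M. \<phi> (C z)) / M - \<mu>\<bar>)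
      \<le> (\<Sum>C\<in>CB. wt C * (\<delta> + ((\<Sum>z<M. \<phi> (C z)) / M - \<mu>)\<^sup>2 / \<delta>))"
    by (intro sum_mono mult_left_mono abs wt_nonneg)
  also have "\<dots> = \<delta> + (\<Sum>C\<in>CB. wt C * ((\<Sum>z<M. \<phi> (C z)) / M - \<mu>)\<^sup>2) / \<delta>"
    by (simp add: distrib_left sum.distrib sum_distrib_right[symmetric] wt_sum sum_divide_distrib)
  also have "\<dots> \<le> \<delta> + (\<Sum>v\<in>W. P v * (\<phi> v)\<^sup>2) / M / \<delta>"
    using wt_variance[OF M \<mu>] \<delta> by (intro add_left_mono divide_right_mono) auto
  finally show ?thesis by simp
qed

text \<open>The probabilistic method. A function above \<open>b\<close> on all codebooks would have
  mean strictly above \<open>b\<close>, because some codebook has positive weight.\<close>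

lemma exists_le_mean:
  assumes "(\<Sum>C\<in>CB. wt C * \<Phi> C) \<le> b"
  shows "\<exists>C\<in>CB. \<Phi> C \<le> b"
proof (rule ccontr)
  assume "\<not> ?thesis"
  then have gt: "\<Phi> C > b" if "C \<in> CB" for C using that by auto
  have "\<exists>C\<in>CB. wt C > 0"
  proof (rule ccontr)
    assume "\<not> ?thesis"
    then have "(\<Sum>C\<in>CB. wt C) \<le> 0" by (intro sum_nonpos) (auto simp: not_less)
    then show False using wt_sum by simp
  qed
  then obtain C0 where C0: "C0 \<in> CB" "wt C0 > 0" by auto
  have "(\<Sum>C\<in>CB. wt C * b) < (\<Sum>C\<in>CB. wt C * \<Phi> C)"
  proof (rule sum_strict_mono_ex1[OF CB_finite])
    show "\<forall>C\<in>CB. wt C * b \<le> wt C * \<Phi> C"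
      using gt wt_nonneg by (meson less_imp_le mult_left_mono)
    show "\<exists>C\<in>CB. wt C * b < wt C * \<Phi> C"
      using C0 gt[OF C0(1)] by (intro bexI[of _ C0]) auto
  qed
  then show False
    using assms by (simp add: sum_distrib_right[symmetric] wt_sum)
qed

end

text \<open>The test channel: \<open>q s x\<close> is the probability of letter \<open>s\<close>
  given \<open>X = x\<close>, and \<open>p s\<close> its total probability, positive so that
  \<open>q s x / p s\<close> makes sense. The rows sum to 1 for every \<open>x\<close>, which the
  encoder kernel will require.\<close>

locale scheme =
  fixes pX :: "'x::topological_space measure" and S :: "'s set"
    and q :: "'s \<Rightarrow> 'x \<Rightarrow> real" and p :: "'s \<Rightarrow> real"
  assumes pX: "pX \<in> space (prob_algebra borel)"
    and S: "finite S"
    and q_meas: "\<And>s. s \<in> S \<Longrightarrow> q s \<in> borel_measurable borel"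
    and q_nonneg: "\<And>s x. s \<in> S \<Longrightarrow> 0 \<le> q s x"
    and q_sum: "\<And>x. (\<Sum>s\<in>S. q s x) = 1"
    and p_pos: "\<And>s. s \<in> S \<Longrightarrow> 0 < p s"
    and p_eq: "\<And>s. s \<in> S \<Longrightarrow> (\<integral>\<^sup>+ x. ennreal (q s x) \<partial>pX) = ennreal (p s)"
begin

sublocale X: prob_space pX
  using pX by (simp add: space_prob_algebra)

sublocale product_sigma_finite "\<lambda>_::nat. pX" ..

lemma sets_pX: "sets pX = sets borel"
  using pX by (simp add: space_prob_algebra)

lemma space_pX: "space pX = UNIV"
  using sets_eq_imp_space_eq[OF sets_pX] by simp

lemmas measurable_pX = measurable_cong_sets[OF sets_pX refl]

lemma q_meas' [measurable]: "s \<in> S \<Longrightarrow> q s \<in> borel_measurable pX"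
  using q_meas by (simp add: measurable_pX)

lemma q_le_1: "s \<in> S \<Longrightarrow> q s x \<le> 1"
  using q_sum[of x] S q_nonneg member_le_sum[of s S "\<lambda>s. q s x"] by auto

lemma q_integrable: "s \<in> S \<Longrightarrow> integrable pX (q s)"
  using q_nonneg q_le_1 by (intro X.integrable_const_bound[where B=1] AE_I2) auto

lemma q_integral: "s \<in> S \<Longrightarrow> (\<integral>x. q s x \<partial>pX) = p s"
  using p_eq[of s] q_nonneg p_pos[of s] by (subst integral_eq_nn_integral) auto

lemma p_sum: "(\<Sum>s\<in>S. p s) = 1"
proof -
  have "(\<Sum>s\<in>S. p s) = (\<Sum>s\<in>S. \<integral>x. q s x \<partial>pX)"
    by (intro sum.cong) (auto simp: q_integral)
  also have "\<dots> = (\<integral>x. (\<Sum>s\<in>S. q s x) \<partial>pX)"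
    by (subst Bochner_Integration.integral_sum) (auto simp: q_integrable)
  finally show ?thesis by (simp add: q_sum X.prob_space)
qed

text \<open>The divergence of the letter law given \<open>x\<close> from \<open>p\<close>; its mean
  \<open>info\<close> is the mutual information of source and letter. With \<open>psi\<close> every
  term is nonnegative; \<open>idens_eq\<close> gives the usual form.\<close>

definition idens :: "'x \<Rightarrow> real" where
  "idens x = (\<Sum>s\<in>S. p s * psi (q s x / p s))"

definition info :: real where
  "info = (\<integral>x. idens x \<partial>pX)"

lemma idens_nonneg: "0 \<le> idens x"
  unfolding idens_def using p_pos q_nonneg
  by (intro sum_nonneg mult_nonneg_nonneg psi_nonneg divide_nonneg_pos) (auto intro: less_imp_le)

lemma psi_term_eq:
  assumes "s \<in> S"
  shows "p s * psi (q s x / p s) = q s x * ln (q s x / p s) - q s x + p s"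
  using p_pos[OF assms] by (simp add: psi_def algebra_simps)

lemma idens_eq: "idens x = (\<Sum>s\<in>S. q s x * ln (q s x / p s))"
  unfolding idens_def using p_sum q_sum[of x]
  by (simp add: psi_term_eq sum.distrib sum_subtractf)

lemma idens_measurable [measurable]: "idens \<in> borel_measurable pX"
  unfolding idens_def by measurable

lemma idens_bound: "idens x \<le> (\<Sum>s\<in>S. 1 / p s)"
  unfolding idens_eq
proof (intro sum_mono)
  fix s assume s: "s \<in> S"
  have "q s x * ln (q s x / p s) \<le> q s x * (q s x / p s)"
  proof (cases "q s x = 0")
    case False
    then have "0 < q s x / p s" using s p_pos q_nonneg[OF s, of x] by auto
    from ln_le_minus_one[OF this] show ?thesis
      using q_nonneg[OF s, of x] by (intro mult_left_mono) auto
  qed simp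
  also have "\<dots> \<le> 1 * (1 / p s)"
    using q_nonneg[OF s, of x] q_le_1[OF s, of x] p_pos[OF s] by (intro mult_mono divide_right_mono) auto
  finally show "q s x * ln (q s x / p s) \<le> 1 / p s" by simp
qed

lemma idens_integrable: "integrable pX idens"
  using idens_bound idens_nonneg
  by (intro X.integrable_const_bound[where B="\<Sum>s\<in>S. 1 / p s"] AE_I2) auto

lemma info_nonneg: "0 \<le> info"
  unfolding info_def using idens_nonneg by (intro integral_nonneg_AE) auto

section \<open>Exponential moments of the information density\<close>

abbreviation "cS \<equiv> \<Sum>s\<in>S. 1 / p s + p s"

text \<open>The moment of order \<open>\<theta>\<close> of the likelihood ratio under the letter law
  given \<open>x\<close>. The Chernoff bound for large likelihood ratios of words multiplies these
  over the letters.\<close>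

definition tilt :: "real \<Rightarrow> 'x \<Rightarrow> real" where
  "tilt \<theta> x = (\<Sum>s\<in>S. q s x * (q s x / p s) powr \<theta>)"

lemma tilt_nonneg: "0 \<le> tilt \<theta> x"
  unfolding tilt_def using q_nonneg by (intro sum_nonneg mult_nonneg_nonneg) auto

lemma tilt_le:
  assumes \<theta>: "0 \<le> \<theta>" "\<theta> \<le> 1"
  shows "tilt \<theta> x \<le> 1 + \<theta> * idens x + \<theta>\<^sup>2 * cS"
proof -
  have "tilt \<theta> x \<le> (\<Sum>s\<in>S. q s x + \<theta> * (q s x * ln (q s x / p s)) + \<theta>\<^sup>2 * (1 / p s + p s))"
    unfolding tilt_def
  proof (intro sum_mono)
    fix s assume s: "s \<in> S"
    note ps = p_pos[OF s] and q0 = q_nonneg[OF s, of x] and q1 = q_le_1[OF s, of x]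
    show "q s x * (q s x / p s) powr \<theta> \<le> q s x + \<theta> * (q s x * ln (q s x / p s)) + \<theta>\<^sup>2 * (1 / p s + p s)"
    proof (cases "q s x = 0")
      case True
      then show ?thesis using ps by simp
    next
      case False
      then have qp: "q s x > 0" using q0 by simp
      define y where "y = ln (q s x / p s)"
      have ey: "exp y = q s x / p s" "exp (- y) = p s / q s x"
        using qp ps by (simp_all add: y_def exp_minus)
      \<comment> \<open>With \<open>y = ln (q / p)\<close>, \<open>exp \<bar>y\<bar>\<close> is at
        most \<open>q / p + p / q\<close>; multiplied by \<open>q\<close> this stays below
        \<open>1 / p + p\<close> even where \<open>q\<close> is tiny. Hence the constant
        \<open>cS\<close>.\<close>
      have "exp \<bar>y\<bar> \<le> exp y + exp (- y)" by (cases "y \<ge> 0") auto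
      then have "q s x * exp \<bar>y\<bar> \<le> q s x * (q s x / p s) + p s"
        using qp ps unfolding ey by (simp add: field_simps)
      also have "q s x * (q s x / p s) \<le> 1 * (1 / p s)"
        using q0 q1 ps by (intro mult_mono divide_right_mono) auto
      finally have b: "q s x * exp \<bar>y\<bar> \<le> 1 / p s + p s" by simp
      have "q s x * (q s x / p s) powr \<theta> = q s x * exp (\<theta> * y)"
        using qp ps by (simp add: powr_def y_def)
      also have "\<dots> \<le> q s x * (1 + \<theta> * y + \<theta>\<^sup>2 * exp \<bar>y\<bar>)"
        using exp_mult_le[OF \<theta>] q0 by (intro mult_left_mono) auto
      also have "\<dots> = q s x + \<theta> * (q s x * y) + \<theta>\<^sup>2 * (q s x * exp \<bar>y\<bar>)"
        by (simp add: algebra_simps)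
      also have "\<dots> \<le> q s x + \<theta> * (q s x * y) + \<theta>\<^sup>2 * (1 / p s + p s)"
        using b by (intro add_left_mono mult_left_mono) auto
      finally show ?thesis by (simp add: y_def)
    qed
  qed
  also have "\<dots> = 1 + \<theta> * idens x + \<theta>\<^sup>2 * cS"
    unfolding idens_eq sum_distrib_left by (subst sum.distrib, subst sum.distrib, subst q_sum) simp
  finally show ?thesis .
qed

lemma tilt_measurable [measurable]: "tilt \<theta> \<in> borel_measurable pX"
  unfolding tilt_def by measurable

lemma tilt_integral:
  assumes \<theta>: "0 \<le> \<theta>" "\<theta> \<le> 1"
  shows "integrable pX (tilt \<theta>)"
    and "(\<integral>x. tilt \<theta> x \<partial>pX) \<le> exp (\<theta> * info + \<theta>\<^sup>2 * cS)"
proof -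
  define c where "c = \<theta>\<^sup>2 * cS"
  have int: "integrable pX (\<lambda>x. 1 + \<theta> * idens x + c)" using idens_integrable by auto
  show i: "integrable pX (tilt \<theta>)"
    using tilt_le[OF \<theta>] tilt_nonneg by (intro Bochner_Integration.integrable_bound[OF int] AE_I2)
      (auto simp: c_def intro: order_trans[OF _ abs_ge_self])
  have "(\<integral>x. tilt \<theta> x \<partial>pX) \<le> (\<integral>x. 1 + \<theta> * idens x + c \<partial>pX)"
    using tilt_le[OF \<theta>] by (intro integral_mono i int) (auto simp: c_def)
  also have "\<dots> = 1 + (\<theta> * info + c)"
    using idens_integrable by (simp add: info_def X.prob_space)
  \<comment> \<open>\<open>1 + u \<le> exp u\<close> prepares for taking the \<open>n\<close>-th
    power.\<close>
  also have "\<dots> \<le> exp (\<theta> * info + c)" by (rule exp_ge_add_one_self)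
  finally show "(\<integral>x. tilt \<theta> x \<partial>pX) \<le> exp (\<theta> * info + \<theta>\<^sup>2 * cS)"
    by (simp add: c_def)
qed

section \<open>Words, likelihood ratios and covering\<close>

definition words :: "nat \<Rightarrow> (nat \<Rightarrow> 's) set" where
  "words n = PiE {..<n} (\<lambda>_. S)"

definition pw :: "nat \<Rightarrow> (nat \<Rightarrow> 's) \<Rightarrow> real" where
  "pw n c = (\<Prod>t<n. p (c t))"

text \<open>By Bayes, \<open>q s x / p s\<close> is the density of \<open>X\<close> given the letter
  \<open>s\<close>, relative to \<open>pX\<close>; so \<open>lr n c\<close> is the density of the
  source block given the word \<open>c\<close> under the reversed memoryless channel.\<close>

definition lr :: "nat \<Rightarrow> (nat \<Rightarrow> 's) \<Rightarrow> (nat \<Rightarrow> 'x) \<Rightarrow> real" where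
  "lr n c x = (\<Prod>t<n. q (c t) (x t) / p (c t))"

lemma words_finite: "finite (words n)"
  unfolding words_def using S by (intro finite_PiE) auto

lemma words_in: "c \<in> words n \<Longrightarrow> t < n \<Longrightarrow> c t \<in> S"
  by (auto simp: words_def)

lemma pw_pos: "c \<in> words n \<Longrightarrow> 0 < pw n c"
  unfolding pw_def by (intro prod_pos) (auto intro: p_pos words_in)

lemma words_sum_prod: "(\<Sum>c\<in>words n. \<Prod>t<n. k t (c t)) = (\<Prod>t<n. \<Sum>s\<in>S. k t s)"
  for k :: "nat \<Rightarrow> 's \<Rightarrow> 'b::comm_semiring_1"
  unfolding words_def using S by (subst prod_sum_PiE) auto

lemma pw_sum: "(\<Sum>c\<in>words n. pw n c) = 1"
  unfolding pw_def by (subst words_sum_prod) (simp add: p_sum)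

lemma lr_nonneg: "c \<in> words n \<Longrightarrow> 0 \<le> lr n c x"
  unfolding lr_def
  by (intro prod_nonneg divide_nonneg_pos) (auto intro: p_pos q_nonneg words_in)

lemma pw_lr:
  assumes "c \<in> words n"
  shows "pw n c * lr n c x = (\<Prod>t<n. q (c t) (x t))"
  unfolding pw_def lr_def prod.distrib[symmetric]
proof (intro prod.cong refl)
  fix t assume "t \<in> {..<n}"
  then have "p (c t) \<noteq> 0" using p_pos[OF words_in[OF assms], of t] by simp
  then show "p (c t) * (q (c t) (x t) / p (c t)) = q (c t) (x t)" by simp
qed

text \<open>A word drawn from \<open>pw\<close> and sent through the reversed channel reproduces the
  source law. Hence \<open>mix\<close> has codebook mean 1, the value that covering compares it
  with.\<close>

lemma pw_lr_sum: "(\<Sum>c\<in>words n. pw n c * lr n c x) = 1"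
  using words_sum_prod[of "\<lambda>t s. q s (x t)" n] by (simp add: pw_lr q_sum)

lemma pw_lr_tilt_sum: "(\<Sum>c\<in>words n. pw n c * lr n c x * lr n c x powr \<theta>) = (\<Prod>t<n. tilt \<theta> (x t))"
proof -
  have "(\<Sum>c\<in>words n. pw n c * lr n c x * lr n c x powr \<theta>)
      = (\<Sum>c\<in>words n. \<Prod>t<n. q (c t) (x t) * (q (c t) (x t) / p (c t)) powr \<theta>)"
    unfolding prod.distrib
    by (intro sum.cong refl) (simp add: pw_lr, simp add: lr_def prod_powr_distrib)
  also have "\<dots> = (\<Prod>t<n. tilt \<theta> (x t))"
    using words_sum_prod[of "\<lambda>t s. q s (x t) * (q s (x t) / p s) powr \<theta>" n] by (simp add: tilt_def)
  finally show ?thesis .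
qed

abbreviation "Xn n \<equiv> PiM {..<n} (\<lambda>_. pX)"

lemma q_component_measurable: "s \<in> S \<Longrightarrow> t < n \<Longrightarrow> (\<lambda>x. q s (x t)) \<in> borel_measurable (Xn n)"
  by (rule measurable_compose[OF _ q_meas', where f="\<lambda>x. x t"]) auto

lemma lr_measurable: "c \<in> words n \<Longrightarrow> lr n c \<in> borel_measurable (Xn n)"
  unfolding lr_def
  by (intro borel_measurable_prod borel_measurable_divide q_component_measurable) (auto dest: words_in)

lemma tilt_word_integral:
  assumes \<theta>: "0 \<le> \<theta>" "\<theta> \<le> 1"
  shows "integrable (Xn n) (\<lambda>x. \<Prod>t<n. tilt \<theta> (x t))"
    and "(\<integral>x. (\<Prod>t<n. tilt \<theta> (x t)) \<partial>Xn n) \<le> exp (real n * (\<theta> * info + \<theta>\<^sup>2 * cS))"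
proof -
  show "integrable (Xn n) (\<lambda>x. \<Prod>t<n. tilt \<theta> (x t))"
    by (rule product_integrable_prod) (auto simp: tilt_integral[OF \<theta>])
  have "(\<integral>x. (\<Prod>t<n. tilt \<theta> (x t)) \<partial>Xn n) = (\<integral>x. tilt \<theta> x \<partial>pX) ^ n"
    by (subst product_integral_prod) (auto simp: tilt_integral[OF \<theta>])
  also have "\<dots> \<le> exp (\<theta> * info + \<theta>\<^sup>2 * cS) ^ n"
    using tilt_nonneg by (intro power_mono tilt_integral(2)[OF \<theta>] integral_nonneg_AE) auto
  finally show "(\<integral>x. (\<Prod>t<n. tilt \<theta> (x t)) \<partial>Xn n) \<le> exp (real n * (\<theta> * info + \<theta>\<^sup>2 * cS))"
    by (simp add: exp_of_nat_mult)
qed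

text \<open>The density of the block that a uniformly chosen codeword produces through the reversed
  channel. Covering means that its shortfall below 1 has small mean.\<close>

definition mix :: "nat \<Rightarrow> nat \<Rightarrow> (nat \<Rightarrow> nat \<Rightarrow> 's) \<Rightarrow> (nat \<Rightarrow> 'x) \<Rightarrow> real" where
  "mix n M C x = (\<Sum>z<M. lr n (C z) x) / M"

definition freq :: "nat \<Rightarrow> (nat \<Rightarrow> nat \<Rightarrow> 's) \<Rightarrow> nat \<Rightarrow> 's \<Rightarrow> real" where
  "freq M C t s = (\<Sum>z<M. if C z t = s then 1 else 0) / M"

lemma weights: "finite_weights (words n) (pw n)"
  by unfold_locales (auto simp: words_finite pw_sum intro: less_imp_le pw_pos)

text \<open>Truncate the likelihood ratios at \<open>B\<close>: the tail is handled by Chernoff, the rest by its variance.\<close>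
lemma covering_pointwise:
  fixes M :: nat and B \<delta> \<theta> :: real
  assumes M: "M > 0" and B: "B > 0" and \<delta>: "\<delta> > 0" and \<theta>: "\<theta> > 0"
  shows "(\<Sum>C\<in>PiE {..<M} (\<lambda>_. words n). finite_weights.wt (pw n) M C * max 0 (1 - mix n M C x))
    \<le> B powr (- \<theta>) * (\<Prod>t<n. tilt \<theta> (x t)) + \<delta> + B / (M * \<delta>)"
proof -
  interpret finite_weights "words n" "pw n" M by (rule weights)
  define v where "v = (\<lambda>c. if lr n c x \<le> B then lr n c x else 0)"
  define \<mu> where "\<mu> = (\<Sum>c\<in>words n. pw n c * v c)"
  define \<tau> where "\<tau> = B powr (- \<theta>) * (\<Prod>t<n. tilt \<theta> (x t))"
  have "1 - \<mu> = (\<Sum>c\<in>words n. pw n c * (lr n c x - v c))"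
    by (simp add: \<mu>_def right_diff_distrib sum_subtractf pw_lr_sum)
  also have "\<dots> \<le> (\<Sum>c\<in>words n. B powr (- \<theta>) * (pw n c * lr n c x * lr n c x powr \<theta>))"
  proof (intro sum_mono)
    fix c assume c: "c \<in> words n"
    note l0 = lr_nonneg[OF c, of x] and p0 = pw_pos[OF c]
    show "pw n c * (lr n c x - v c) \<le> B powr (- \<theta>) * (pw n c * lr n c x * lr n c x powr \<theta>)"
    proof (cases "lr n c x \<le> B")
      case True
      then show ?thesis using l0 p0 by (simp add: v_def)
    next
      case False
      then have "B powr \<theta> \<le> lr n c x powr \<theta>" using B \<theta> by (intro powr_mono2) auto
      then have "1 \<le> B powr (- \<theta>) * lr n c x powr \<theta>" using B by (simp add: powr_minus field_simps)
      then have "pw n c * lr n c x * 1 \<le> pw n c * lr n c x * (B powr (- \<theta>) * lr n c x powr \<theta>)"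
        using l0 p0 by (intro mult_left_mono) auto
      then show ?thesis using False by (simp add: v_def mult_ac)
    qed
  qed
  also have "\<dots> = \<tau>"
    by (simp add: \<tau>_def sum_distrib_left[symmetric] pw_lr_tilt_sum)
  finally have \<mu>: "1 - \<mu> \<le> \<tau>" .
  have \<tau>0: "0 \<le> \<tau>" unfolding \<tau>_def by (intro mult_nonneg_nonneg prod_nonneg) (auto simp: tilt_nonneg)
  \<comment> \<open>Only the shortfall of \<open>mix\<close> below 1 matters, and truncation can
    only enlarge it, so a one-sided comparison is enough.\<close>
  have "(\<Sum>C\<in>CB. wt C * max 0 (1 - mix n M C x)) \<le> (\<Sum>C\<in>CB. wt C * (\<tau> + \<bar>(\<Sum>z<M. v (C z)) / M - \<mu>\<bar>))"
  proof (intro sum_mono mult_left_mono wt_nonneg)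
    fix C assume C: "C \<in> CB"
    have "(\<Sum>z<M. v (C z)) \<le> (\<Sum>z<M. lr n (C z) x)"
    proof (intro sum_mono)
      fix z assume "z \<in> {..<M}"
      then have "C z \<in> words n" using C by auto
      then show "v (C z) \<le> lr n (C z) x" by (simp add: v_def lr_nonneg)
    qed
    then have "(\<Sum>z<M. v (C z)) / M \<le> mix n M C x"
      unfolding mix_def by (intro divide_right_mono) auto
    then show "max 0 (1 - mix n M C x) \<le> \<tau> + \<bar>(\<Sum>z<M. v (C z)) / M - \<mu>\<bar>"
      using \<mu> \<tau>0 by linarith
  qed
  also have "\<dots> = \<tau> + (\<Sum>C\<in>CB. wt C * \<bar>(\<Sum>z<M. v (C z)) / M - \<mu>\<bar>)"
    by (simp add: distrib_left sum.distrib sum_distrib_right[symmetric] wt_sum)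
  also have "\<dots> \<le> \<tau> + (\<delta> + (\<Sum>c\<in>words n. pw n c * (v c)\<^sup>2) / (M * \<delta>))"
    using wt_mean_abs[OF M \<mu>_def \<delta>] by simp
  \<comment> \<open>\<open>v\<close> is at most \<open>B\<close> and \<open>lr\<close> has mean 1,
    so the second moment is at most \<open>B\<close>.\<close>
  also have "(\<Sum>c\<in>words n. pw n c * (v c)\<^sup>2) \<le> (\<Sum>c\<in>words n. B * (pw n c * lr n c x))"
  proof (intro sum_mono)
    fix c assume c: "c \<in> words n"
    note l0 = lr_nonneg[OF c, of x] and p0 = pw_pos[OF c]
    have "(v c)\<^sup>2 \<le> B * lr n c x"
      using l0 B by (auto simp: v_def power2_eq_square intro: mult_right_mono)
    then have "pw n c * (v c)\<^sup>2 \<le> pw n c * (B * lr n c x)" using p0 by (intro mult_left_mono) auto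
    then show "pw n c * (v c)\<^sup>2 \<le> B * (pw n c * lr n c x)" by (simp add: mult_ac)
  qed
  also have "\<dots> = B" by (simp add: sum_distrib_left[symmetric] pw_lr_sum)
  finally show ?thesis using \<delta> M by (simp add: \<tau>_def divide_right_mono)
qed

text \<open>Column \<open>t\<close> of the random codebook consists of \<open>M\<close> independent
  letters of law \<open>p\<close>, so \<open>freq\<close> is an empirical frequency with mean
  \<open>p s\<close>.\<close>

lemma freq_variance:
  fixes M :: nat
  assumes M: "M > 0" and t: "t < n" and s: "s \<in> S"
  shows "(\<Sum>C\<in>PiE {..<M} (\<lambda>_. words n). finite_weights.wt (pw n) M C * (freq M C t s - p s)\<^sup>2) \<le> p s / M"
proof -
  interpret finite_weights "words n" "pw n" M by (rule weights)
  have e: "(\<Sum>c\<in>words n. pw n c * (if c t = s then 1 else 0)) = p s"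
  proof -
    have "(\<Sum>c\<in>words n. pw n c * (if c t = s then 1 else 0))
       = (\<Sum>c\<in>words n. \<Prod>t'<n. p (c t') * (if t' = t then (if c t' = s then 1 else 0) else 1))"
      using t by (simp add: pw_def prod.distrib)
    also have "\<dots> = (\<Prod>t'<n. \<Sum>s'\<in>S. p s' * (if t' = t then (if s' = s then 1 else 0) else 1))"
      by (rule words_sum_prod)
    also have "\<dots> = (\<Prod>t'<n. if t' = t then p s else 1)"
    proof (intro prod.cong refl)
      fix t'
      have "(\<Sum>s'\<in>S. p s' * (if s' = s then 1 else 0)) = (\<Sum>s'\<in>S. if s' = s then p s' else 0)"
        by (intro sum.cong) auto
      then show "(\<Sum>s'\<in>S. p s' * (if t' = t then (if s' = s then 1 else 0) else 1)) = (if t' = t then p s else 1)"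
        using S s by (simp add: p_sum)
    qed
    finally show ?thesis using t by simp
  qed
  have "(\<Sum>C\<in>CB. wt C * ((\<Sum>z<M. (if C z t = s then 1 else 0)) / M - p s)\<^sup>2)
      \<le> (\<Sum>c\<in>words n. pw n c * (if c t = s then 1 else 0)\<^sup>2) / M"
    by (rule wt_variance[OF M]) (simp add: e)
  also have "(\<Sum>c\<in>words n. pw n c * (if c t = s then 1 else 0)\<^sup>2) = p s"
    unfolding e[symmetric] by (intro sum.cong) auto
  finally show ?thesis by (simp add: freq_def)
qed

lemma mix_measurable:
  "C \<in> PiE {..<M} (\<lambda>_. words n) \<Longrightarrow> mix n M C \<in> borel_measurable (Xn n)"
  unfolding mix_def by (intro borel_measurable_divide borel_measurable_sum lr_measurable) auto

lemma exists_codebook: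
  fixes M :: nat and B \<delta> \<theta> \<eta> b :: real
  assumes M: "M > 0" and B: "B > 0" and \<delta>: "\<delta> > 0" and \<theta>: "0 < \<theta>" "\<theta> \<le> 1" and \<eta>: "\<eta> > 0"
    and b: "B powr (- \<theta>) * exp (real n * (\<theta> * info + \<theta>\<^sup>2 * cS))
          + \<delta> + B / (M * \<delta>) + real n * (\<Sum>s\<in>S. 1 / p s) / (M * \<eta>\<^sup>2) \<le> b" and b1: "b \<le> 1"
  shows "\<exists>C. (\<forall>z<M. C z \<in> words n) \<and> (\<integral>x. max 0 (1 - mix n M C x) \<partial>Xn n) \<le> b
     \<and> (\<forall>t<n. \<forall>s\<in>S. freq M C t s \<le> (1 + \<eta>) * p s)"
proof -
  interpret finite_weights "words n" "pw n" M by (rule weights)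
  interpret XN: prob_space "Xn n" by (intro PiM_prob_space X.prob_space_axioms)
  \<comment> \<open>One functional carries both demands. Its mean is at most
    \<open>b \<le> 1\<close>, so for the selected codebook the shortfall is at most \<open>b\<close>
    and each normalised squared deviation is at most 1, which is
    \<open>freq \<le> (1 + \<eta>) * p\<close> at every position and letter.\<close>
  define \<Phi> where "\<Phi> = (\<lambda>C. (\<integral>x. max 0 (1 - mix n M C x) \<partial>Xn n)
     + (\<Sum>t<n. \<Sum>s\<in>S. (freq M C t s - p s)\<^sup>2 / (\<eta> * p s)\<^sup>2))"
  have mix0: "0 \<le> mix n M C x" if "C \<in> CB" for C x
    unfolding mix_def using that by (intro divide_nonneg_nonneg sum_nonneg lr_nonneg) auto
  have int: "integrable (Xn n) (\<lambda>x. max 0 (1 - mix n M C x))" if C: "C \<in> CB" for C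
    using mix_measurable[OF C] mix0[OF C]
    by (intro XN.integrable_const_bound[where B=1] AE_I2) auto
  have "(\<Sum>C\<in>CB. wt C * (\<integral>x. max 0 (1 - mix n M C x) \<partial>Xn n))
     = (\<integral>x. (\<Sum>C\<in>CB. wt C * max 0 (1 - mix n M C x)) \<partial>Xn n)"
    using int by (subst Bochner_Integration.integral_sum) auto
  also have "\<dots> \<le> (\<integral>x. B powr (- \<theta>) * (\<Prod>t<n. tilt \<theta> (x t)) + \<delta> + B / (M * \<delta>) \<partial>Xn n)"
    using int tilt_word_integral(1)[of \<theta> n] \<theta> covering_pointwise[OF M B \<delta> \<theta>(1)]
    by (intro integral_mono) auto
  also have "\<dots> = B powr (- \<theta>) * (\<integral>x. (\<Prod>t<n. tilt \<theta> (x t)) \<partial>Xn n) + \<delta> + B / (M * \<delta>)"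
    using tilt_word_integral(1)[of \<theta> n] \<theta> by (simp add: XN.prob_space)
  also have "\<dots> \<le> B powr (- \<theta>) * exp (real n * (\<theta> * info + \<theta>\<^sup>2 * cS)) + \<delta> + B / (M * \<delta>)"
    using tilt_word_integral(2)[of \<theta> n] \<theta> by (intro add_right_mono mult_left_mono) auto
  finally have 1: "(\<Sum>C\<in>CB. wt C * (\<integral>x. max 0 (1 - mix n M C x) \<partial>Xn n)) \<le> \<dots>" .
  have "(\<Sum>C\<in>CB. wt C * (\<Sum>t<n. \<Sum>s\<in>S. (freq M C t s - p s)\<^sup>2 / (\<eta> * p s)\<^sup>2))
      = (\<Sum>t<n. \<Sum>s\<in>S. (\<Sum>C\<in>CB. wt C * (freq M C t s - p s)\<^sup>2) / (\<eta> * p s)\<^sup>2)"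
    unfolding sum_distrib_left sum_divide_distrib
    by (subst sum.swap, rule sum.cong[OF refl], subst sum.swap) simp
  also have "\<dots> \<le> (\<Sum>t<n. \<Sum>s\<in>S. (p s / M) / (\<eta> * p s)\<^sup>2)"
    by (intro sum_mono divide_right_mono freq_variance M) auto
  also have "\<dots> = (\<Sum>t<n. \<Sum>s\<in>S. (1 / p s) / (M * \<eta>\<^sup>2))"
    by (intro sum.cong refl) (auto simp: power2_eq_square dest: p_pos)
  also have "\<dots> = real n * (\<Sum>s\<in>S. 1 / p s) / (M * \<eta>\<^sup>2)"
    unfolding sum_divide_distrib[symmetric] by simp
  finally have 2: "(\<Sum>C\<in>CB. wt C * (\<Sum>t<n. \<Sum>s\<in>S. (freq M C t s - p s)\<^sup>2 / (\<eta> * p s)\<^sup>2)) \<le> \<dots>" .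
  have "(\<Sum>C\<in>CB. wt C * \<Phi> C) \<le> b"
    unfolding \<Phi>_def distrib_left sum.distrib using 1 2 b by linarith
  then obtain C where C: "C \<in> CB" "\<Phi> C \<le> b" using exists_le_mean by blast
  have i0: "0 \<le> (\<integral>x. max 0 (1 - mix n M C x) \<partial>Xn n)" by (intro integral_nonneg_AE) auto
  have s0: "0 \<le> (\<Sum>t<n. \<Sum>s\<in>S. (freq M C t s - p s)\<^sup>2 / (\<eta> * p s)\<^sup>2)" by (intro sum_nonneg) auto
  show ?thesis
  proof (intro exI[of _ C] conjI allI impI ballI)
    fix t s assume t: "t < n" and s: "s \<in> S"
    have "(freq M C t s - p s)\<^sup>2 / (\<eta> * p s)\<^sup>2 \<le> (\<Sum>s\<in>S. (freq M C t s - p s)\<^sup>2 / (\<eta> * p s)\<^sup>2)"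
      using S s by (intro member_le_sum) auto
    also have "\<dots> \<le> (\<Sum>t<n. \<Sum>s\<in>S. (freq M C t s - p s)\<^sup>2 / (\<eta> * p s)\<^sup>2)"
      using t by (intro member_le_sum[of t "{..<n}" "\<lambda>t. \<Sum>s\<in>S. (freq M C t s - p s)\<^sup>2 / (\<eta> * p s)\<^sup>2"]) (auto intro: sum_nonneg)
    also have "\<dots> \<le> 1" using C(2) i0 b1 unfolding \<Phi>_def by linarith
    finally have "(freq M C t s - p s)\<^sup>2 \<le> (\<eta> * p s)\<^sup>2"
      using p_pos[OF s] \<eta> by (simp add: divide_le_eq)
    then have "freq M C t s - p s \<le> \<eta> * p s"
      using p_pos[OF s] \<eta> by (elim power2_le_imp_le) simp
    then show "freq M C t s \<le> (1 + \<eta>) * p s" by (simp add: algebra_simps)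
  next
    show "(\<integral>x. max 0 (1 - mix n M C x) \<partial>Xn n) \<le> b" using C(2) s0 unfolding \<Phi>_def by linarith
  qed (use C in auto)
qed

end

section \<open>The code\<close>

lemma sum_lessThan_add:
  fixes f :: "nat \<Rightarrow> 'a::comm_monoid_add"
  shows "(\<Sum>z<M + K. f z) = (\<Sum>z<M. f z) + (\<Sum>j<K. f (M + j))"
  by (induction K) (auto simp: add.assoc)

lemma count_density_kernel:
  fixes e :: "nat \<Rightarrow> 'a \<Rightarrow> real"
  assumes [measurable]: "\<And>z. e z \<in> borel_measurable N"
    and one: "\<And>x. (\<Sum>z. ennreal (e z x)) = 1"
  shows "(\<lambda>x. density (count_space UNIV) (\<lambda>z. ennreal (e z x))) \<in> N \<rightarrow>\<^sub>M prob_algebra (count_space UNIV)"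
proof -
  have em: "emeasure (density (count_space UNIV) (\<lambda>z. ennreal (e z x))) A = (\<Sum>z. ennreal (e z x) * indicator A z)" for x A
    by (simp add: emeasure_density nn_integral_count_space_nat)
  have ps: "prob_space (density (count_space UNIV) (\<lambda>z. ennreal (e z x)))" for x
    by (rule prob_spaceI) (simp add: em one)
  have "(\<lambda>x. density (count_space UNIV) (\<lambda>z. ennreal (e z x))) \<in> N \<rightarrow>\<^sub>M subprob_algebra (count_space UNIV)"
    by (rule measurable_subprob_algebra) (auto simp: em intro: prob_space_imp_subprob_space ps)
  then show ?thesis
    unfolding prob_algebra_def by (intro measurable_restrict_space2) (auto simp: ps)
qed

text \<open>One codebook of the kind just found is now fixed. \<open>b\<close> numbers all words, so
  that uncoded words can be sent as indices; \<open>Gs s\<close> is the law from which the decoder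
  draws an output letter on seeing \<open>s\<close>.\<close>

locale codebook = scheme pX S q p
  for pX :: "'x::topological_space measure" and S :: "'s set"
    and q :: "'s \<Rightarrow> 'x \<Rightarrow> real" and p :: "'s \<Rightarrow> real" +
  fixes n M :: nat and C :: "nat \<Rightarrow> nat \<Rightarrow> 's" and \<eta> :: real
    and b :: "nat \<Rightarrow> nat \<Rightarrow> 's" and Gs :: "'s \<Rightarrow> 'x measure"
  assumes M: "M > 0" and C: "\<And>z. z < M \<Longrightarrow> C z \<in> words n"
    and \<eta>: "0 < \<eta>" "\<eta> < 1"
    and freq_le: "\<And>t s. t < n \<Longrightarrow> s \<in> S \<Longrightarrow> freq M C t s \<le> (1 + \<eta>) * p s"
    and b: "bij_betw b {..<card (words n)} (words n)"
    and Gs: "\<And>s. s \<in> S \<Longrightarrow> Gs s \<in> space (prob_algebra borel)"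
    and Gs_mix: "\<And>\<phi>. \<phi> \<in> borel_measurable borel \<Longrightarrow>
      (\<Sum>s\<in>S. ennreal (p s) * (\<integral>\<^sup>+ y. \<phi> y \<partial>Gs s)) = (\<integral>\<^sup>+ y. \<phi> y \<partial>pX)"
begin

abbreviation "XN \<equiv> PiM {..<n} (\<lambda>_. pX)"
abbreviation "RN t \<equiv> PiM ({..<n} - {t}) (\<lambda>_. pX)"
abbreviation "BN \<equiv> PiM {..<n} (\<lambda>_. borel :: 'x measure)"
abbreviation "K \<equiv> card (words n)"

sublocale XN: prob_space XN
  by (intro PiM_prob_space X.prob_space_axioms)

text \<open>Chosen so that \<open>\<alpha> * (1 + \<eta>) = 1 - \<eta>\<close>: the excess of the
  column frequencies is cancelled and a margin \<open>\<eta>\<close> remains, which keeps the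
  fallback probability positive given any value of the \<open>t\<close>-th source letter.\<close>

definition \<alpha> :: real where "\<alpha> = (1 - \<eta>) / (1 + \<eta>)"

abbreviation L :: "(nat \<Rightarrow> 'x) \<Rightarrow> real" where "L \<equiv> mix n M C"

text \<open>The posterior of the index would be \<open>lr / (M * L)\<close>. With
  \<open>max 1 L\<close> in place of \<open>L\<close> the weight never exceeds
  \<open>\<alpha> / M * lr\<close>, and the total becomes \<open>\<alpha> * min 1 L\<close>; the
  missing mass is left to the fallback.\<close>

definition e :: "nat \<Rightarrow> (nat \<Rightarrow> 'x) \<Rightarrow> real" where
  "e z x = \<alpha> * lr n (C z) x / (M * max 1 (L x))"

lemma \<alpha>: "0 < \<alpha>" "\<alpha> < 1" "\<alpha> * (1 + \<eta>) = 1 - \<eta>"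
  using \<eta> by (auto simp: \<alpha>_def)

lemma L_nonneg: "0 \<le> L x"
  unfolding mix_def using C by (intro divide_nonneg_nonneg sum_nonneg lr_nonneg) auto

lemma L_measurable [measurable]: "L \<in> borel_measurable XN"
  unfolding mix_def using C by (intro borel_measurable_divide borel_measurable_sum lr_measurable) auto

lemma e_measurable [measurable]: "z < M \<Longrightarrow> e z \<in> borel_measurable XN"
  using lr_measurable[OF C, of z] unfolding e_def by measurable

lemma e_nonneg: "z < M \<Longrightarrow> 0 \<le> e z x"
  unfolding e_def using lr_nonneg[OF C] \<alpha> by (intro divide_nonneg_nonneg mult_nonneg_nonneg) auto

lemma e_le: "z < M \<Longrightarrow> e z x \<le> \<alpha> / M * lr n (C z) x"
proof -
  assume z: "z < M"
  have "e z x \<le> \<alpha> * lr n (C z) x / (M * 1)"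
    unfolding e_def using lr_nonneg[OF C[OF z], of x] \<alpha> M
    by (intro divide_left_mono mult_left_mono mult_nonneg_nonneg mult_pos_pos) auto
  then show ?thesis by simp
qed

definition Ft :: "(nat \<Rightarrow> 'x) \<Rightarrow> real" where
  "Ft x = (\<Sum>z<M. e z x)"

lemma Ft_eq: "1 - Ft x = 1 - \<alpha> + \<alpha> * max 0 (1 - L x)"
proof -
  have "Ft x = \<alpha> * (L x / max 1 (L x))"
    using M by (simp add: Ft_def e_def mix_def sum_divide_distrib[symmetric] sum_distrib_left[symmetric])
  also have "L x / max 1 (L x) = 1 - max 0 (1 - L x)"
    using L_nonneg[of x] by (auto simp: max_def)
  finally show ?thesis by (simp add: algebra_simps)
qed

lemma Ft_bounds: "0 \<le> Ft x" "Ft x \<le> 1"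
proof -
  show "0 \<le> Ft x" unfolding Ft_def by (intro sum_nonneg e_nonneg) auto
  have "0 \<le> 1 - \<alpha> + \<alpha> * max 0 (1 - L x)" using \<alpha> by (intro add_nonneg_nonneg) auto
  then show "Ft x \<le> 1" using Ft_eq[of x] by simp
qed

lemma Ft_measurable [measurable]: "Ft \<in> borel_measurable XN"
  unfolding Ft_def by measurable

definition Fs :: "nat \<Rightarrow> 's \<Rightarrow> (nat \<Rightarrow> 'x) \<Rightarrow> real" where
  "Fs t s x = (\<Sum>z<M. if C z t = s then e z x else 0)"

lemma Fs_measurable [measurable]: "Fs t s \<in> borel_measurable XN"
  unfolding Fs_def by measurable

lemma Fs_bounds: "0 \<le> Fs t s x \<and> Fs t s x \<le> 1"
proof
  show "0 \<le> Fs t s x" unfolding Fs_def by (intro sum_nonneg) (auto simp: e_nonneg)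
  have "Fs t s x \<le> Ft x" unfolding Fs_def Ft_def by (intro sum_mono) (auto simp: e_nonneg)
  then show "Fs t s x \<le> 1" using Ft_bounds(2)[of x] by simp
qed

lemma Fs_sum:
  assumes t: "t < n"
  shows "(\<Sum>s\<in>S. Fs t s x) = Ft x"
proof -
  have "(\<Sum>s\<in>S. Fs t s x) = (\<Sum>z<M. \<Sum>s\<in>S. if C z t = s then e z x else 0)"
    unfolding Fs_def by (rule sum.swap)
  also have "\<dots> = Ft x"
    unfolding Ft_def using S words_in[OF C t] by (intro sum.cong) auto
  finally show ?thesis .
qed

text \<open>Density of \<open>X\<^sub>t\<close> on the event that a codeword with \<open>t\<close>-th letter \<open>s\<close> is sent.\<close>
definition m :: "nat \<Rightarrow> 's \<Rightarrow> 'x \<Rightarrow> real" where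
  "m t s = marg pX {..<n} t (Fs t s)"

lemma m_measurable: "t < n \<Longrightarrow> m t s \<in> borel_measurable pX"
  unfolding m_def by (intro marg_measurable X.prob_space_axioms) auto

lemma m_nonneg: "t < n \<Longrightarrow> 0 \<le> m t s y"
  unfolding m_def
  by (rule marg_nn_integral(2)[OF X.prob_space_axioms _ _ _ Fs_bounds]) (auto simp: space_pX)

text \<open>Every factor except the \<open>t\<close>-th is a probability density and integrates to
  1.\<close>

lemma lr_section:
  assumes c: "c \<in> words n" and t: "t < n"
  shows "(\<integral>\<^sup>+ x. ennreal (lr n c (x(t := y))) \<partial>RN t) = ennreal (q (c t) y / p (c t))"
proof -
  have qp: "0 \<le> q (c i) u / p (c i)" if "i < n" for i u
    using words_in[OF c that] q_nonneg p_pos by (simp add: less_imp_le)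
  have ct: "c t \<in> S" using words_in[OF c t] .
  have lr: "lr n c (x(t := y)) = (q (c t) y / p (c t)) * (\<Prod>i\<in>{..<n} - {t}. q (c i) (x i) / p (c i))" for x
    unfolding lr_def using t by (subst prod.remove[of _ t]) (auto intro!: prod.cong)
  have one: "(\<integral>\<^sup>+ u. ennreal (q (c i) u / p (c i)) \<partial>pX) = 1" if "i < n" for i
  proof -
    have ci: "c i \<in> S" using words_in[OF c that] .
    have "(\<integral>\<^sup>+ u. ennreal (q (c i) u / p (c i)) \<partial>pX) = (\<integral>\<^sup>+ u. ennreal (q (c i) u) * ennreal (1 / p (c i)) \<partial>pX)"
      using p_pos[OF ci] by (intro nn_integral_cong) (simp add: ennreal_mult''[symmetric])
    also have "\<dots> = ennreal (p (c i)) * ennreal (1 / p (c i))"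
      using q_meas'[OF ci] by (subst nn_integral_multc) (auto simp: p_eq[OF ci])
    also have "\<dots> = 1" using p_pos[OF ci] by (simp add: ennreal_mult''[symmetric])
    finally show ?thesis .
  qed
  have "(\<integral>\<^sup>+ x. ennreal (lr n c (x(t := y))) \<partial>RN t)
      = (\<integral>\<^sup>+ x. ennreal (q (c t) y / p (c t)) * (\<Prod>i\<in>{..<n} - {t}. ennreal (q (c i) (x i) / p (c i))) \<partial>RN t)"
    unfolding lr using qp t
    by (intro nn_integral_cong) (subst prod_ennreal, (auto)[1], subst ennreal_mult, auto intro!: prod_nonneg)
  also have "\<dots> = ennreal (q (c t) y / p (c t)) * (\<integral>\<^sup>+ x. (\<Prod>i\<in>{..<n} - {t}. ennreal (q (c i) (x i) / p (c i))) \<partial>RN t)"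
  proof (rule nn_integral_cmult)
    show "(\<lambda>x. \<Prod>i\<in>{..<n} - {t}. ennreal (q (c i) (x i) / p (c i))) \<in> borel_measurable (RN t)"
    proof (intro borel_measurable_prod_ennreal)
      fix i assume i: "i \<in> {..<n} - {t}"
      then have "c i \<in> S" using words_in[OF c] by auto
      then have "(\<lambda>u. ennreal (q (c i) u / p (c i))) \<in> borel_measurable pX" by measurable
      from measurable_compose[OF measurable_component_singleton[OF i] this]
      show "(\<lambda>x. ennreal (q (c i) (x i) / p (c i))) \<in> borel_measurable (RN t)" .
    qed
  qed
  also have "(\<integral>\<^sup>+ x. (\<Prod>i\<in>{..<n} - {t}. ennreal (q (c i) (x i) / p (c i))) \<partial>RN t)
     = (\<Prod>i\<in>{..<n} - {t}. \<integral>\<^sup>+ u. ennreal (q (c i) u / p (c i)) \<partial>pX)"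
    using words_in[OF c] by (intro product_nn_integral_prod) auto
  also have "\<dots> = 1" using one by simp
  finally show ?thesis by (simp add: fun_upd_def)
qed

text \<open>The domination that makes exact repair possible. By the cap on \<open>e\<close>, each
  codeword with \<open>t\<close>-th letter \<open>s\<close> contributes at most
  \<open>\<alpha> / M * (q s y / p s)\<close> once the other coordinates are integrated out.
  Together they give \<open>\<alpha> * freq * (q s y / p s)\<close>, and the frequency bound yields
  \<open>\<alpha> * (1 + \<eta>) * q s y\<close>.\<close>

lemma m_le:
  assumes t: "t < n" and s: "s \<in> S"
  shows "m t s y \<le> (1 - \<eta>) * q s y"
proof -
  have tI: "t \<in> {..<n}" using t by simp
  have y: "y \<in> space pX" by (simp add: space_pX)
  have upd: "(\<lambda>x. x(t := y)) \<in> RN t \<rightarrow>\<^sub>M XN"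
    by (rule fun_upd_section_measurable[OF tI y])
  have "ennreal (m t s y) = (\<integral>\<^sup>+ x. ennreal (Fs t s (x(t := y))) \<partial>RN t)"
    unfolding m_def by (rule marg_nn_integral(1)[OF X.prob_space_axioms tI y _ Fs_bounds]) measurable
  also have "\<dots> \<le> (\<integral>\<^sup>+ x. (\<Sum>z<M. if C z t = s then ennreal (\<alpha> / M) * ennreal (lr n (C z) (x(t := y))) else 0) \<partial>RN t)"
  proof (intro nn_integral_mono)
    fix x
    have "Fs t s (x(t := y)) \<le> (\<Sum>z<M. if C z t = s then \<alpha> / M * lr n (C z) (x(t := y)) else 0)"
      unfolding Fs_def using e_le by (intro sum_mono) auto
    then have "ennreal (Fs t s (x(t := y))) \<le> ennreal (\<Sum>z<M. if C z t = s then \<alpha> / M * lr n (C z) (x(t := y)) else 0)"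
      by (rule ennreal_leI)
    also have "\<dots> = (\<Sum>z<M. ennreal (if C z t = s then \<alpha> / M * lr n (C z) (x(t := y)) else 0))"
      using \<alpha> lr_nonneg[OF C] by (subst sum_ennreal) auto
    also have "\<dots> = (\<Sum>z<M. if C z t = s then ennreal (\<alpha> / M) * ennreal (lr n (C z) (x(t := y))) else 0)"
      using \<alpha> lr_nonneg[OF C] by (intro sum.cong refl) (auto simp only: ennreal_mult' if_True if_False ennreal_0 divide_nonneg_nonneg less_imp_le of_nat_0_le_iff split: if_splits)
    finally show "ennreal (Fs t s (x(t := y))) \<le> \<dots>" .
  qed
  also have "\<dots> = (\<Sum>z<M. \<integral>\<^sup>+ x. (if C z t = s then ennreal (\<alpha> / M) * ennreal (lr n (C z) (x(t := y))) else 0) \<partial>RN t)"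
    using measurable_compose[OF upd lr_measurable[OF C]] by (intro nn_integral_sum) auto
  also have "\<dots> = (\<Sum>z<M. if C z t = s then ennreal (\<alpha> / M * (q s y / p s)) else 0)"
  proof (intro sum.cong refl)
    fix z assume "z \<in> {..<M}"
    then have z: "z < M" by simp
    have "(\<integral>\<^sup>+ x. ennreal (\<alpha> / M) * ennreal (lr n (C z) (x(t := y))) \<partial>RN t) = ennreal (\<alpha> / M * (q s y / p s))" if "C z t = s"
    proof -
      have "(\<integral>\<^sup>+ x. ennreal (\<alpha> / M) * ennreal (lr n (C z) (x(t := y))) \<partial>RN t)
         = ennreal (\<alpha> / M) * (\<integral>\<^sup>+ x. ennreal (lr n (C z) (x(t := y))) \<partial>RN t)"
        using measurable_compose[OF upd lr_measurable[OF C[OF z]]] by (intro nn_integral_cmult) auto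
      also have "\<dots> = ennreal (\<alpha> / M) * ennreal (q s y / p s)"
        using lr_section[OF C[OF z] t, of y] that by simp
      also have "\<dots> = ennreal (\<alpha> / M * (q s y / p s))"
        using \<alpha> q_nonneg[OF s] p_pos[OF s] by (subst ennreal_mult) auto
      finally show ?thesis .
    qed
    then show "(\<integral>\<^sup>+ x. (if C z t = s then ennreal (\<alpha> / M) * ennreal (lr n (C z) (x(t := y))) else 0) \<partial>RN t)
       = (if C z t = s then ennreal (\<alpha> / M * (q s y / p s)) else 0)" by simp
  qed
  also have "\<dots> = (\<Sum>z<M. ennreal (if C z t = s then \<alpha> / M * (q s y / p s) else 0))"
    by (intro sum.cong refl) simp
  also have "\<dots> = ennreal (\<Sum>z<M. if C z t = s then \<alpha> / M * (q s y / p s) else 0)"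
    using \<alpha> q_nonneg[OF s] p_pos[OF s] by (intro sum_ennreal) auto
  also have "(\<Sum>z<M. if C z t = s then \<alpha> / M * (q s y / p s) else 0) = \<alpha> * freq M C t s * (q s y / p s)"
  proof -
    have "(\<Sum>z<M. if C z t = s then \<alpha> / M * (q s y / p s) else 0) = (\<Sum>z<M. (if C z t = s then 1 else 0) * (\<alpha> / M * (q s y / p s)))"
      by (intro sum.cong) auto
    then show ?thesis unfolding freq_def sum_distrib_right[symmetric] by simp
  qed
  finally have "m t s y \<le> \<alpha> * freq M C t s * (q s y / p s)"
    using \<alpha> q_nonneg[OF s] p_pos[OF s]
    by (subst (asm) ennreal_le_iff) (auto simp: freq_def intro!: mult_nonneg_nonneg divide_nonneg_nonneg sum_nonneg)
  also have "\<dots> \<le> \<alpha> * ((1 + \<eta>) * p s) * (q s y / p s)"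
    using \<alpha> q_nonneg[OF s] p_pos[OF s] freq_le[OF t s] by (intro mult_right_mono mult_left_mono) auto
  also have "\<dots> = \<alpha> * (1 + \<eta>) * q s y" using p_pos[OF s] by simp
  finally show ?thesis by (simp add: \<alpha>(3))
qed

section \<open>The fallback word\<close>

definition D :: "nat \<Rightarrow> 'x \<Rightarrow> real" where
  "D t y = 1 - (\<Sum>s\<in>S. m t s y)"

lemma D_pos: "t < n \<Longrightarrow> 0 < D t y"
proof -
  assume t: "t < n"
  have "(\<Sum>s\<in>S. m t s y) \<le> (\<Sum>s\<in>S. (1 - \<eta>) * q s y)" by (intro sum_mono m_le t)
  also have "\<dots> = 1 - \<eta>" by (simp add: sum_distrib_left[symmetric] q_sum)
  finally show ?thesis using \<eta> by (simp add: D_def)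
qed

text \<open>Every codeword has some \<open>t\<close>-th letter in \<open>S\<close>, so the coded
  mass \<open>Ft\<close> is the sum of the \<open>Fs t s\<close>. Hence \<open>D t y\<close> is the
  probability of fallback given that the \<open>t\<close>-th source letter is
  \<open>y\<close>.\<close>

lemma marg_fallback:
  assumes t: "t < n"
  shows "marg pX {..<n} t (\<lambda>x. 1 - Ft x) y = D t y"
proof -
  interpret R: prob_space "RN t" by (intro PiM_prob_space X.prob_space_axioms)
  have int: "integrable (RN t) (\<lambda>x. Fs t s (x(t := y)))" for s
    by (rule marg_integrable[OF X.prob_space_axioms, where B=1]) (use t Fs_bounds in \<open>auto simp: space_pX\<close>)
  have "marg pX {..<n} t (\<lambda>x. 1 - Ft x) y = (\<integral>x. 1 - (\<Sum>s\<in>S. Fs t s (x(t := y))) \<partial>RN t)"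
    by (simp add: marg_def Fs_sum[OF t])
  also have "\<dots> = D t y"
    using int by (simp add: R.prob_space D_def m_def marg_def)
  finally show ?thesis .
qed

text \<open>The part of the target \<open>q s y\<close> not yet delivered by the codewords,
  normalised to a law on letters; the total deficit is \<open>D t y\<close> because the
  \<open>q s y\<close> sum to 1.\<close>

definition \<kappa> :: "nat \<Rightarrow> 's \<Rightarrow> 'x \<Rightarrow> real" where
  "\<kappa> t s y = (q s y - m t s y) / D t y"

lemma \<kappa>_nonneg: "t < n \<Longrightarrow> s \<in> S \<Longrightarrow> 0 \<le> \<kappa> t s y"
proof -
  assume t: "t < n" and s: "s \<in> S"
  have "m t s y \<le> (1 - \<eta>) * q s y" by (rule m_le[OF t s])
  also have "\<dots> \<le> 1 * q s y" using \<eta> q_nonneg[OF s] by (intro mult_right_mono) auto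
  finally show ?thesis using D_pos[OF t, of y] by (simp add: \<kappa>_def)
qed

lemma \<kappa>_sum: "t < n \<Longrightarrow> (\<Sum>s\<in>S. \<kappa> t s y) = 1"
  using D_pos[of t y] by (simp add: \<kappa>_def sum_divide_distrib[symmetric] sum_subtractf q_sum) (simp add: D_def)

lemma \<kappa>_measurable: "t < n \<Longrightarrow> s \<in> S \<Longrightarrow> \<kappa> t s \<in> borel_measurable pX"
  unfolding \<kappa>_def D_def
  by (intro borel_measurable_divide borel_measurable_diff borel_measurable_sum m_measurable q_meas') auto

text \<open>Given the block, the letters are drawn independently, the \<open>t\<close>-th from
  \<open>x t\<close> alone: only single-letter laws have to come out right, so no joint correction
  is needed.\<close>

definition fb :: "(nat \<Rightarrow> 's) \<Rightarrow> (nat \<Rightarrow> 'x) \<Rightarrow> real" where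
  "fb v x = (1 - Ft x) * (\<Prod>t<n. \<kappa> t (v t) (x t))"

lemma fb_nonneg: "v \<in> words n \<Longrightarrow> 0 \<le> fb v x"
  unfolding fb_def using Ft_bounds(2)[of x]
  by (intro mult_nonneg_nonneg prod_nonneg \<kappa>_nonneg) (auto dest: words_in)

lemma \<kappa>_component_measurable:
  assumes "t < n" "s \<in> S"
  shows "(\<lambda>x. \<kappa> t s (x t)) \<in> borel_measurable XN"
  by (rule measurable_compose[OF _ \<kappa>_measurable[OF assms], where f="\<lambda>x. x t"]) (use assms in auto)

lemma fb_measurable: "v \<in> words n \<Longrightarrow> fb v \<in> borel_measurable XN"
  unfolding fb_def
  by (intro borel_measurable_times borel_measurable_diff borel_measurable_prod \<kappa>_component_measurable) (auto dest: words_in)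

lemma fb_sum: "(\<Sum>v\<in>words n. fb v x) = 1 - Ft x"
  unfolding fb_def sum_distrib_left[symmetric]
  by (subst words_sum_prod) (simp add: \<kappa>_sum)

text \<open>Indices below \<open>M\<close> are codewords and the next \<open>K\<close> are all the
  words. Later indices are never sent; they get the word \<open>C 0\<close> so that the decoder is
  defined on all of \<open>nat\<close>.\<close>

definition wd :: "nat \<Rightarrow> nat \<Rightarrow> 's" where
  "wd z = (if z < M then C z else if z < M + K then b (z - M) else C 0)"

definition ee :: "nat \<Rightarrow> (nat \<Rightarrow> 'x) \<Rightarrow> real" where
  "ee z x = (if z < M then e z x else if z < M + K then fb (b (z - M)) x else 0)"

lemma b_in: "j < K \<Longrightarrow> b j \<in> words n"
  using b by (auto simp: bij_betw_def)

lemma wd_words: "wd z \<in> words n"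
  unfolding wd_def using C M b_in by auto

lemma ee_nonneg: "0 \<le> ee z x"
  unfolding ee_def using e_nonneg fb_nonneg b_in by auto

lemma ee_measurable: "ee z \<in> borel_measurable XN"
proof (cases "z < M")
  case True
  then show ?thesis using e_measurable by (simp add: ee_def[abs_def])
next
  case False
  then show ?thesis using fb_measurable[OF b_in, of "z - M"]
    by (cases "z < M + K") (auto simp: ee_def[abs_def])
qed

lemma ee_split:
  fixes f :: "nat \<Rightarrow> 'c::comm_monoid_add"
  assumes "\<And>z. z < M \<Longrightarrow> f z = f1 z" "\<And>j. j < K \<Longrightarrow> f (M + j) = f2 (b j)"
  shows "(\<Sum>z<M + K. f z) = (\<Sum>z<M. f1 z) + (\<Sum>v\<in>words n. f2 v)"
proof -
  have "(\<Sum>z<M + K. f z) = (\<Sum>z<M. f1 z) + (\<Sum>j<K. f2 (b j))"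
    unfolding sum_lessThan_add using assms by simp
  also have "(\<Sum>j<K. f2 (b j)) = (\<Sum>v\<in>words n. f2 v)"
    by (rule sum.reindex_bij_betw[OF b])
  finally show ?thesis .
qed

lemma ee_sum: "(\<Sum>z<M + K. ee z x) = 1"
  by (subst ee_split[where ?f1.0="\<lambda>z. e z x" and ?f2.0="\<lambda>v. fb v x"])
     (auto simp: ee_def fb_sum Ft_def[symmetric])

lemma ee_suminf: "(\<Sum>z. ennreal (ee z x)) = 1"
proof -
  have "(\<Sum>z. ennreal (ee z x)) = (\<Sum>z<M + K. ennreal (ee z x))"
    by (rule suminf_finite) (auto simp: ee_def)
  also have "\<dots> = ennreal (\<Sum>z<M + K. ee z x)" by (rule sum_ennreal) (rule ee_nonneg)
  finally show ?thesis by (simp add: ee_sum)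
qed

definition E :: "(nat \<Rightarrow> 'x) \<Rightarrow> nat measure" where
  "E x = density (count_space UNIV) (\<lambda>z. ennreal (ee z x))"

definition G :: "nat \<Rightarrow> (nat \<Rightarrow> 'x) measure" where
  "G z = PiM {..<n} (\<lambda>t. Gs (wd z t))"

lemma sets_XN: "sets XN = sets BN"
  by (intro sets_PiM_cong) (auto simp: sets_pX)

lemma E_kernel: "E \<in> BN \<rightarrow>\<^sub>M prob_algebra (count_space UNIV)"
proof -
  have "E = (\<lambda>x. density (count_space UNIV) (\<lambda>z. ennreal (ee z x)))" by (simp add: fun_eq_iff E_def)
  then show ?thesis
    using count_density_kernel[of ee BN] ee_measurable ee_suminf
    by (simp add: measurable_cong_sets[OF sets_XN refl])
qed

lemma Gs_wd: "t < n \<Longrightarrow> Gs (wd z t) \<in> space (prob_algebra borel)"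
  by (intro Gs words_in[OF wd_words])

lemma G_kernel: "G \<in> count_space UNIV \<rightarrow>\<^sub>M prob_algebra BN"
proof -
  have "prob_space (G z)" for z
    unfolding G_def
  proof -
    have "PiM {..<n} (\<lambda>t. Gs (wd z t)) = PiM {..<n} (\<lambda>t. if t < n then Gs (wd z t) else pX)"
      by (intro PiM_cong) auto
    also have "prob_space \<dots>"
      using Gs_wd X.prob_space_axioms by (intro prob_space_PiM) (auto simp: space_prob_algebra)
    finally show "prob_space (PiM {..<n} (\<lambda>t. Gs (wd z t)))" .
  qed
  moreover have "sets (G z) = sets BN" for z
    unfolding G_def using Gs_wd by (intro sets_PiM_cong) (auto simp: space_prob_algebra)
  ultimately show ?thesis by (auto simp: space_prob_algebra)
qed

sublocale BC: block_code pX n E G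
  by unfold_locales (rule pX E_kernel G_kernel)+

lemma enc_eq: "BC.enc z x = ee z x"
proof -
  have "emeasure (E x) {z} = ennreal (ee z x)"
    unfolding E_def by (simp add: emeasure_density nn_integral_count_space_indicator[symmetric] nn_integral_count_space_finite)
  then show ?thesis unfolding BC.enc_def by (simp add: measure_def ee_nonneg)
qed

lemma dec_eq:
  assumes t: "t < n"
  shows "BC.dec z t = Gs (wd z t)"
proof -
  have s: "sets (Gs (wd z t)) = sets borel" using Gs_wd[OF t] by (simp add: space_prob_algebra)
  have "BC.dec z t = distr (G z) (Gs (wd z t)) (\<lambda>y. y t)"
    unfolding BC.dec_def by (intro distr_cong) (auto simp: s)
  also have "\<dots> = Gs (wd z t)"
    unfolding G_def
    by (rule distr_PiM_component) (use Gs_wd t in \<open>auto simp: space_prob_algebra\<close>)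
  finally show ?thesis .
qed

text \<open>Codewords contribute the density \<open>m t s\<close> and the fallback contributes
  \<open>D t * \<kappa> t s = q s - m t s\<close>, so the sum is \<open>q s\<close> without error.
  Test functions depending on letter and source value are allowed, so that output law and distortion
  both follow.\<close>

lemma exact_coupling:
  assumes t: "t < n" and \<Phi>: "\<And>s. s \<in> S \<Longrightarrow> \<Phi> s \<in> borel_measurable pX"
  shows "(\<Sum>z. \<integral>\<^sup>+ x. ennreal (ee z x) * \<Phi> (wd z t) (x t) \<partial>XN) = (\<Sum>s\<in>S. \<integral>\<^sup>+ y. ennreal (q s y) * \<Phi> s y \<partial>pX)"
proof -
  have tI: "t \<in> {..<n}" using t by simp
  have \<Phi>t: "(\<lambda>x. \<Phi> s (x t)) \<in> borel_measurable XN" if "s \<in> S" for s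
    by (rule measurable_compose[OF _ \<Phi>[OF that], where f="\<lambda>x. x t"]) (use t in auto)
  have "(\<Sum>z. \<integral>\<^sup>+ x. ennreal (ee z x) * \<Phi> (wd z t) (x t) \<partial>XN) = (\<Sum>z<M + K. \<integral>\<^sup>+ x. ennreal (ee z x) * \<Phi> (wd z t) (x t) \<partial>XN)"
    by (rule suminf_finite) (auto simp: ee_def)
  also have "\<dots> = (\<Sum>z<M. \<integral>\<^sup>+ x. ennreal (e z x) * \<Phi> (C z t) (x t) \<partial>XN) + (\<Sum>v\<in>words n. \<integral>\<^sup>+ x. ennreal (fb v x) * \<Phi> (v t) (x t) \<partial>XN)"
    by (rule ee_split) (auto simp: ee_def wd_def)
  also have "(\<Sum>z<M. \<integral>\<^sup>+ x. ennreal (e z x) * \<Phi> (C z t) (x t) \<partial>XN) = (\<Sum>s\<in>S. \<integral>\<^sup>+ y. ennreal (m t s y) * \<Phi> s y \<partial>pX)"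
  proof -
    have "(\<Sum>z<M. \<integral>\<^sup>+ x. ennreal (e z x) * \<Phi> (C z t) (x t) \<partial>XN) = (\<integral>\<^sup>+ x. (\<Sum>z<M. ennreal (e z x) * \<Phi> (C z t) (x t)) \<partial>XN)"
      using \<Phi>t words_in[OF C t] by (intro nn_integral_sum[symmetric]) auto
    also have "\<dots> = (\<integral>\<^sup>+ x. (\<Sum>s\<in>S. ennreal (Fs t s x) * \<Phi> s (x t)) \<partial>XN)"
    proof (intro nn_integral_cong)
      fix x
      have "(\<Sum>s\<in>S. ennreal (Fs t s x) * \<Phi> s (x t)) = (\<Sum>s\<in>S. \<Sum>z<M. ennreal (if C z t = s then e z x else 0) * \<Phi> s (x t))"
        unfolding Fs_def using e_nonneg by (subst sum_ennreal[symmetric]) (auto simp: sum_distrib_right)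
      also have "\<dots> = (\<Sum>z<M. \<Sum>s\<in>S. ennreal (if C z t = s then e z x else 0) * \<Phi> s (x t))"
        by (rule sum.swap)
      also have "\<dots> = (\<Sum>z<M. \<Sum>s\<in>S. if C z t = s then ennreal (e z x) * \<Phi> (C z t) (x t) else 0)"
        by (intro sum.cong refl) auto
      also have "\<dots> = (\<Sum>z<M. ennreal (e z x) * \<Phi> (C z t) (x t))"
        using S words_in[OF C t] by (intro sum.cong) auto
      finally show "(\<Sum>z<M. ennreal (e z x) * \<Phi> (C z t) (x t)) = (\<Sum>s\<in>S. ennreal (Fs t s x) * \<Phi> s (x t))" by simp
    qed
    also have "\<dots> = (\<Sum>s\<in>S. \<integral>\<^sup>+ x. ennreal (Fs t s x) * \<Phi> s (x t) \<partial>XN)"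
      using \<Phi>t by (intro nn_integral_sum) auto
    also have "\<dots> = (\<Sum>s\<in>S. \<integral>\<^sup>+ y. ennreal (m t s y) * \<Phi> s y \<partial>pX)"
      unfolding m_def
      by (intro sum.cong refl nn_integral_PiM_marg[OF X.prob_space_axioms _ tI _ Fs_bounds]) (auto simp: \<Phi>)
    finally show ?thesis .
  qed
  also have "(\<Sum>v\<in>words n. \<integral>\<^sup>+ x. ennreal (fb v x) * \<Phi> (v t) (x t) \<partial>XN) = (\<Sum>s\<in>S. \<integral>\<^sup>+ y. ennreal (q s y - m t s y) * \<Phi> s y \<partial>pX)"
  proof -
    have "(\<Sum>v\<in>words n. \<integral>\<^sup>+ x. ennreal (fb v x) * \<Phi> (v t) (x t) \<partial>XN)
       = (\<integral>\<^sup>+ x. (\<Sum>v\<in>words n. ennreal (fb v x) * \<Phi> (v t) (x t)) \<partial>XN)"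
      using \<Phi>t fb_measurable words_in[OF _ t] by (intro nn_integral_sum[symmetric]) auto
    also have "\<dots> = (\<integral>\<^sup>+ x. ennreal (1 - Ft x) * (\<Sum>s\<in>S. ennreal (\<kappa> t s (x t)) * \<Phi> s (x t)) \<partial>XN)"
    proof (intro nn_integral_cong)
      fix x
      \<comment> \<open>The test function is attached to factor \<open>t\<close>; the sum over words
        then factors over positions, and every position other than \<open>t\<close> sums to
        1.\<close>
      have "(\<Sum>v\<in>words n. ennreal (fb v x) * \<Phi> (v t) (x t))
         = (\<Sum>v\<in>words n. ennreal (1 - Ft x) * (\<Prod>i<n. ennreal (\<kappa> i (v i) (x i)) * (if i = t then \<Phi> (v i) (x i) else 1)))"
      proof (intro sum.cong refl)
        fix v assume v: "v \<in> words n"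
        have k: "0 \<le> \<kappa> i (v i) (x i)" if "i < n" for i using \<kappa>_nonneg[OF that words_in[OF v that]] .
        have "ennreal (fb v x) = ennreal (1 - Ft x) * (\<Prod>i<n. ennreal (\<kappa> i (v i) (x i)))"
          unfolding fb_def using k Ft_bounds(2)[of x]
          by (subst prod_ennreal, (auto)[1], subst ennreal_mult) (auto intro!: prod_nonneg)
        then show "ennreal (fb v x) * \<Phi> (v t) (x t) = ennreal (1 - Ft x) * (\<Prod>i<n. ennreal (\<kappa> i (v i) (x i)) * (if i = t then \<Phi> (v i) (x i) else 1))"
          using t by (simp add: prod.distrib mult.assoc)
      qed
      also have "\<dots> = ennreal (1 - Ft x) * (\<Prod>i<n. \<Sum>s\<in>S. ennreal (\<kappa> i s (x i)) * (if i = t then \<Phi> s (x i) else 1))"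
        unfolding sum_distrib_left[symmetric] by (subst words_sum_prod) simp
      also have "(\<Prod>i<n. \<Sum>s\<in>S. ennreal (\<kappa> i s (x i)) * (if i = t then \<Phi> s (x i) else 1))
         = (\<Prod>i<n. if i = t then \<Sum>s\<in>S. ennreal (\<kappa> t s (x t)) * \<Phi> s (x t) else 1)"
      proof (intro prod.cong refl)
        fix i assume i: "i \<in> {..<n}"
        have "(\<Sum>s\<in>S. ennreal (\<kappa> i s (x i))) = 1"
          using i \<kappa>_nonneg \<kappa>_sum[of i] by (subst sum_ennreal) auto
        then show "(\<Sum>s\<in>S. ennreal (\<kappa> i s (x i)) * (if i = t then \<Phi> s (x i) else 1))
           = (if i = t then \<Sum>s\<in>S. ennreal (\<kappa> t s (x t)) * \<Phi> s (x t) else 1)" by simp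
      qed
      finally show "(\<Sum>v\<in>words n. ennreal (fb v x) * \<Phi> (v t) (x t))
         = ennreal (1 - Ft x) * (\<Sum>s\<in>S. ennreal (\<kappa> t s (x t)) * \<Phi> s (x t))" using t by simp
    qed
    \<comment> \<open>Apart from \<open>1 - Ft\<close> the integrand depends on the block only
      through \<open>x t\<close>, so \<open>1 - Ft\<close> may be replaced by its marginal.\<close>
    also have "\<dots> = (\<integral>\<^sup>+ y. ennreal (marg pX {..<n} t (\<lambda>x. 1 - Ft x) y) * (\<Sum>s\<in>S. ennreal (\<kappa> t s y) * \<Phi> s y) \<partial>pX)"
      by (rule nn_integral_PiM_marg[OF X.prob_space_axioms _ tI, where B=1])
         (use Ft_bounds \<Phi> \<kappa>_measurable[OF t] in auto)
    also have "\<dots> = (\<integral>\<^sup>+ y. (\<Sum>s\<in>S. ennreal (q s y - m t s y) * \<Phi> s y) \<partial>pX)"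
    proof (intro nn_integral_cong)
      fix y
      show "ennreal (marg pX {..<n} t (\<lambda>x. 1 - Ft x) y) * (\<Sum>s\<in>S. ennreal (\<kappa> t s y) * \<Phi> s y)
        = (\<Sum>s\<in>S. ennreal (q s y - m t s y) * \<Phi> s y)"
        unfolding marg_fallback[OF t] sum_distrib_left
      proof (intro sum.cong refl)
        fix s assume s: "s \<in> S"
        have "ennreal (q s y - m t s y) = ennreal (D t y) * ennreal (\<kappa> t s y)"
          using D_pos[OF t, of y] \<kappa>_nonneg[OF t s, of y]
          by (subst ennreal_mult[symmetric]) (auto simp: \<kappa>_def)
        then show "ennreal (D t y) * (ennreal (\<kappa> t s y) * \<Phi> s y) = ennreal (q s y - m t s y) * \<Phi> s y"
          by (simp add: mult.assoc)
      qed
    qed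
    also have "\<dots> = (\<Sum>s\<in>S. \<integral>\<^sup>+ y. ennreal (q s y - m t s y) * \<Phi> s y \<partial>pX)"
      using \<Phi> m_measurable[OF t] q_meas' by (intro nn_integral_sum) auto
    finally show ?thesis .
  qed
  also have "(\<Sum>s\<in>S. \<integral>\<^sup>+ y. ennreal (m t s y) * \<Phi> s y \<partial>pX) + (\<Sum>s\<in>S. \<integral>\<^sup>+ y. ennreal (q s y - m t s y) * \<Phi> s y \<partial>pX)
     = (\<Sum>s\<in>S. \<integral>\<^sup>+ y. ennreal (q s y) * \<Phi> s y \<partial>pX)"
    unfolding sum.distrib[symmetric]
  proof (intro sum.cong refl)
    fix s assume s: "s \<in> S"
    have "ennreal (q s y) * \<Phi> s y = ennreal (m t s y) * \<Phi> s y + ennreal (q s y - m t s y) * \<Phi> s y" for y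
    proof -
      have "m t s y \<le> (1 - \<eta>) * q s y" by (rule m_le[OF t s])
      also have "\<dots> \<le> 1 * q s y" using \<eta> q_nonneg[OF s] by (intro mult_right_mono) auto
      finally have "ennreal (q s y) = ennreal (m t s y) + ennreal (q s y - m t s y)"
        using m_nonneg[OF t, of s y] by (subst ennreal_plus[symmetric]) auto
      then show ?thesis by (simp add: distrib_right)
    qed
    then show "(\<integral>\<^sup>+ y. ennreal (m t s y) * \<Phi> s y \<partial>pX) + (\<integral>\<^sup>+ y. ennreal (q s y - m t s y) * \<Phi> s y \<partial>pX) = (\<integral>\<^sup>+ y. ennreal (q s y) * \<Phi> s y \<partial>pX)"
      using s \<Phi> m_measurable[OF t] q_meas' by (subst nn_integral_add[symmetric]) auto
  qed
  finally show ?thesis .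
qed

end

context codebook begin

lemma Gs_section_measurable:
  assumes s: "s \<in> S" and f: "f \<in> borel_measurable (borel \<Otimes>\<^sub>M borel)"
  shows "(\<lambda>x. \<integral>\<^sup>+ y. f (x, y) \<partial>Gs s) \<in> borel_measurable pX"
proof -
  interpret prob_space "Gs s" using Gs[OF s] by (simp add: space_prob_algebra)
  have sg: "sets (borel \<Otimes>\<^sub>M Gs s) = sets (borel \<Otimes>\<^sub>M borel)"
    using Gs[OF s] by (intro sets_pair_measure_cong) (auto simp: space_prob_algebra)
  have "(\<lambda>x. \<integral>\<^sup>+ y. f (x, y) \<partial>Gs s) \<in> borel_measurable borel"
    using f by (intro borel_measurable_nn_integral) (simp add: measurable_cong_sets[OF sg refl])
  then show ?thesis by (simp add: measurable_pX)
qed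

lemma nn_integral_J_exact:
  assumes t: "t < n" and f: "f \<in> borel_measurable (borel \<Otimes>\<^sub>M borel)"
  shows "(\<integral>\<^sup>+ p. f (fst p t, snd p t) \<partial>BC.J) = (\<Sum>s\<in>S. \<integral>\<^sup>+ x. ennreal (q s x) * (\<integral>\<^sup>+ y. f (x, y) \<partial>Gs s) \<partial>pX)"
  unfolding BC.nn_integral_J_component[OF t f]
  using exact_coupling[OF t Gs_section_measurable[OF _ f]]
  by (simp add: enc_eq dec_eq[OF t])

lemma marginal_exact:
  assumes t: "t < n"
  shows "distr BC.J borel (\<lambda>p. snd p t) = pX"
proof (rule measure_eqI_nn_integral[where L=borel])
  fix \<phi> :: "'x \<Rightarrow> ennreal" assume [measurable]: "\<phi> \<in> borel_measurable borel"
  have m: "(\<lambda>p. snd p t) \<in> BC.J \<rightarrow>\<^sub>M borel"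
  proof -
    have "(\<lambda>p. snd p t) \<in> BN \<Otimes>\<^sub>M BN \<rightarrow>\<^sub>M borel"
      using measurable_compose[OF BC.component_pair_measurable[OF t] measurable_snd] by simp
    then show ?thesis using BC.J by (simp add: space_prob_algebra cong: measurable_cong_sets)
  qed
  have "(\<integral>\<^sup>+ y. \<phi> y \<partial>distr BC.J borel (\<lambda>p. snd p t)) = (\<integral>\<^sup>+ p. (\<lambda>r. \<phi> (snd r)) (fst p t, snd p t) \<partial>BC.J)"
    by (subst nn_integral_distr[OF m]) auto
  also have "\<dots> = (\<Sum>s\<in>S. \<integral>\<^sup>+ x. ennreal (q s x) * (\<integral>\<^sup>+ y. \<phi> y \<partial>Gs s) \<partial>pX)"
    by (subst nn_integral_J_exact[OF t]) auto
  also have "\<dots> = (\<Sum>s\<in>S. ennreal (p s) * (\<integral>\<^sup>+ y. \<phi> y \<partial>Gs s))"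
    by (intro sum.cong refl) (simp add: nn_integral_multc p_eq)
  also have "\<dots> = (\<integral>\<^sup>+ y. \<phi> y \<partial>pX)" by (rule Gs_mix) measurable
  finally show "(\<integral>\<^sup>+ y. \<phi> y \<partial>distr BC.J borel (\<lambda>p. snd p t)) = (\<integral>\<^sup>+ y. \<phi> y \<partial>pX)" .
qed (simp_all add: sets_pX)

section \<open>Entropy of the index\<close>

lemma ee_le_1: "ee z x \<le> 1"
proof (cases "z < M + K")
  case True
  then have "ee z x \<le> (\<Sum>z<M + K. ee z x)" by (intro member_le_sum) (auto simp: ee_nonneg)
  then show ?thesis by (simp add: ee_sum)
qed (simp add: ee_def)

lemma ee_integrable: "integrable XN (ee z)"
  using ee_nonneg ee_le_1 ee_measurable by (intro XN.integrable_const_bound[where B=1] AE_I2) auto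

lemma pz_integral: "BC.pz z = (\<integral>x. ee z x \<partial>XN)"
proof -
  have "ennreal (BC.pz z) = ennreal (\<integral>x. ee z x \<partial>XN)"
    unfolding BC.pz_eq enc_eq using ee_nonneg by (intro nn_integral_eq_integral ee_integrable) auto
  then show ?thesis
    using BC.pz_nonneg ee_nonneg by (subst (asm) ennreal_inj) (auto intro: integral_nonneg_AE)
qed

lemma pz_sum: "(\<Sum>z<M + K. BC.pz z) = 1"
  unfolding pz_integral
  by (subst Bochner_Integration.integral_sum[symmetric]) (auto simp: ee_integrable ee_sum XN.prob_space)

text \<open>The fallback probability, through which the covering error enters the rate.\<close>

definition \<rho> :: real where "\<rho> = (\<Sum>j<K. BC.pz (M + j))"

lemma \<rho>_eq: "\<rho> = 1 - \<alpha> + \<alpha> * (\<integral>x. max 0 (1 - L x) \<partial>XN)"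
proof -
  have "\<rho> = (\<integral>x. (\<Sum>j<K. ee (M + j) x) \<partial>XN)"
    unfolding \<rho>_def pz_integral by (rule Bochner_Integration.integral_sum[symmetric]) (rule ee_integrable)
  also have "(\<lambda>x. \<Sum>j<K. ee (M + j) x) = (\<lambda>x. 1 - \<alpha> + \<alpha> * max 0 (1 - L x))"
  proof
    fix x
    have "(\<Sum>j<K. ee (M + j) x) = (\<Sum>j<K. fb (b j) x)" by (intro sum.cong) (auto simp: ee_def)
    also have "\<dots> = (\<Sum>v\<in>words n. fb v x)" by (rule sum.reindex_bij_betw[OF b])
    finally show "(\<Sum>j<K. ee (M + j) x) = 1 - \<alpha> + \<alpha> * max 0 (1 - L x)"
      by (simp add: fb_sum Ft_eq)
  qed
  also have "(\<integral>x. 1 - \<alpha> + \<alpha> * max 0 (1 - L x) \<partial>XN) = 1 - \<alpha> + \<alpha> * (\<integral>x. max 0 (1 - L x) \<partial>XN)"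
  proof -
    have "integrable XN (\<lambda>x. max 0 (1 - L x))"
      using L_nonneg by (intro XN.integrable_const_bound[where B=1] AE_I2) auto
    then show ?thesis by (simp add: XN.prob_space)
  qed
  finally show ?thesis .
qed

lemma K_pos: "K > 0"
  using C[OF M] words_finite by (auto simp: card_gt_0_iff)

text \<open>Gibbs' inequality against the law with mass 1/2 uniform on the codeword indices and mass
  1/2 uniform on the fallback indices. The split costs \<open>ln 2\<close>, and the correction terms
  of the two halves cancel because both laws have total mass 1.\<close>

lemma entropy_le:
  "disc_entropy (XN \<bind> E) \<le> ennreal (ln 2 + ln M + \<rho> * ln K)"
proof -
  let ?p = BC.pz
  have p1: "?p z \<le> 1" for z
    using prob_space.prob_le_1[OF prob_space_bind'[OF BC.Xn BC.E]] by (simp add: BC.pz_def)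
  have nn: "0 \<le> - (?p z * ln (?p z))" for z
    using p1[of z] BC.pz_nonneg[of z] by (cases "?p z = 0") (auto simp: mult_nonneg_nonpos)
  have gibbs: "- (u * ln u) \<le> - u * ln Q + Q - u" if "0 \<le> u" "0 < Q" for u Q :: real
    using psi_tangent[OF that] by (simp add: psi_def algebra_simps)
  have p0: "?p z = 0" if "z \<ge> M + K" for z
    using that by (simp add: pz_integral ee_def)
  have split: "(\<Sum>z<M. ?p z) + \<rho> = 1"
    using pz_sum unfolding sum_lessThan_add \<rho>_def .
  have "disc_entropy (XN \<bind> E) = (\<Sum>z. ennreal (- (?p z * ln (?p z))))"
    by (simp add: disc_entropy_def BC.pz_def)
  also have "\<dots> = (\<Sum>z<M + K. ennreal (- (?p z * ln (?p z))))"
    by (rule suminf_finite) (auto simp: p0 not_less)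
  also have "\<dots> = ennreal (\<Sum>z<M + K. - (?p z * ln (?p z)))"
    by (rule sum_ennreal) (rule nn)
  finally have "disc_entropy (XN \<bind> E) = ennreal (\<Sum>z<M + K. - (?p z * ln (?p z)))" .
  moreover have "(\<Sum>z<M + K. - (?p z * ln (?p z))) \<le> ln 2 + ln M + \<rho> * ln K"
  proof -
    have "(\<Sum>z<M. - (?p z * ln (?p z))) \<le> (\<Sum>z<M. - ?p z * ln (1 / (2 * M)) + 1 / (2 * M) - ?p z)"
      using M BC.pz_nonneg by (intro sum_mono gibbs) auto
    also have "\<dots> = (\<Sum>z<M. ?p z) * ln (2 * M) + 1 / 2 - (\<Sum>z<M. ?p z)"
      using M by (simp add: sum.distrib sum_subtractf sum_distrib_right ln_div)
    finally have 1: "(\<Sum>z<M. - (?p z * ln (?p z))) \<le> (\<Sum>z<M. ?p z) * ln (2 * M) + 1 / 2 - (\<Sum>z<M. ?p z)" .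
    have "(\<Sum>j<K. - (?p (M + j) * ln (?p (M + j)))) \<le> (\<Sum>j<K. - ?p (M + j) * ln (1 / (2 * K)) + 1 / (2 * K) - ?p (M + j))"
      using K_pos BC.pz_nonneg by (intro sum_mono gibbs) auto
    also have "\<dots> = \<rho> * ln (2 * K) + 1 / 2 - \<rho>"
      using K_pos by (simp add: \<rho>_def sum.distrib sum_subtractf sum_distrib_right ln_div)
    finally have 2: "(\<Sum>j<K. - (?p (M + j) * ln (?p (M + j)))) \<le> \<rho> * ln (2 * K) + 1 / 2 - \<rho>" .
    have "(\<Sum>z<M + K. - (?p z * ln (?p z))) \<le> (1 - \<rho>) * ln (2 * M) + \<rho> * ln (2 * K)"
    proof -
      have s: "(\<Sum>z<M. ?p z) = 1 - \<rho>" using split by simp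
      show ?thesis unfolding sum_lessThan_add using 1 2 unfolding s by linarith
    qed
    also have "\<dots> = ln 2 + (1 - \<rho>) * ln M + \<rho> * ln K"
      using M K_pos by (simp add: ln_mult algebra_simps)
    also have "\<dots> \<le> ln 2 + ln M + \<rho> * ln K"
    proof -
      have "0 \<le> \<rho>" unfolding \<rho>_def using BC.pz_nonneg by (intro sum_nonneg) auto
      moreover have "0 \<le> ln (real M)" using M by simp
      ultimately show ?thesis by (simp add: algebra_simps)
    qed
    finally show ?thesis .
  qed
  ultimately show ?thesis by (simp add: ennreal_leI)
qed

end

section \<open>Choice of parameters and achievability\<close>

context scheme begin

lemma S_nonempty: "card S > 0"
  using q_sum S by (cases "S = {}") (auto simp: card_gt_0_iff)

lemma card_words: "card (words n) = card S ^ n"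
  unfolding words_def by (simp add: card_PiE)

text \<open>The truncation level has exponent \<open>info + \<epsilon>\<close>, above that of the
  typical likelihood ratio and below the codebook exponent \<open>info + 2 * \<epsilon>\<close>. The
  first gap makes the Chernoff tail small, the second the variance term
  \<open>B / M\<close>.\<close>

lemma eventually_code_rate:
  assumes \<epsilon>: "\<epsilon> > 0" and \<eta>: "\<eta> > 0" and b: "0 < b" "b \<le> 1"
  shows "\<forall>\<^sub>F n in sequentially. \<exists>C M. M > 0 \<and> ln (real M) \<le> ln 2 + real n * (info + 2 * \<epsilon>) \<and>
     (\<forall>z<M. C z \<in> words n) \<and> (\<integral>x. max 0 (1 - mix n M C x) \<partial>Xn n) \<le> b
     \<and> (\<forall>t<n. \<forall>s\<in>S. freq M C t s \<le> (1 + \<eta>) * p s)"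
proof -
  define C1 where "C1 = (\<Sum>s\<in>S. 1 / p s)"
  have cS: "cS > 0"
    using S S_nonempty p_pos by (intro sum_pos) (auto intro: add_pos_pos)
  have C1: "C1 \<ge> 0"
    unfolding C1_def using p_pos by (intro sum_nonneg) (auto intro: less_imp_le)
  \<comment> \<open>Small enough that the quadratic error \<open>\<theta>\<^sup>2 * cS\<close>
    consumes at most half of the linear gain \<open>\<theta> * \<epsilon>\<close>.\<close>
  define \<theta> where "\<theta> = min 1 (\<epsilon> / (2 * cS))"
  have \<theta>: "0 < \<theta>" "\<theta> \<le> 1" using \<epsilon> cS by (auto simp: \<theta>_def)
  have "\<theta> \<le> \<epsilon> / (2 * cS)" by (simp add: \<theta>_def)
  then have \<theta>C: "\<theta> * cS \<le> \<epsilon> / 2" using cS by (simp add: field_simps)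
  define \<delta> where "\<delta> = b / 2"
  have \<delta>: "\<delta> > 0" using b by (simp add: \<delta>_def)
  \<comment> \<open>Bounds for the Chernoff tail, the variance term and the frequency deviations.
    Together they have to fit into \<open>b - \<delta> = \<delta>\<close>.\<close>
  have "(\<lambda>n. exp (- (\<theta> * \<epsilon> / 2)) ^ n + 1 / \<delta> * exp (- \<epsilon>) ^ n + C1 / \<eta>\<^sup>2 * (real n * exp (- \<epsilon>) ^ n)) \<longlonglongrightarrow> 0 + 1 / \<delta> * 0 + C1 / \<eta>\<^sup>2 * 0"
    using \<theta> \<epsilon> by (intro tendsto_add tendsto_mult tendsto_const LIMSEQ_realpow_zero powser_times_n_limit_0) auto
  then have "\<forall>\<^sub>F n in sequentially. exp (- (\<theta> * \<epsilon> / 2)) ^ n + 1 / \<delta> * exp (- \<epsilon>) ^ n + C1 / \<eta>\<^sup>2 * (real n * exp (- \<epsilon>) ^ n) < \<delta>"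
    using \<delta> by (intro order_tendstoD(2)[where y=0]) auto
  then show ?thesis
  proof eventually_elim
    case (elim n)
    define B where "B = exp (real n * (info + \<epsilon>))"
    define x where "x = exp (real n * (info + 2 * \<epsilon>))"
    define M where "M = nat \<lceil>x\<rceil>"
    have x1: "x \<ge> 1" using info_nonneg \<epsilon> by (simp add: x_def)
    have Mx: "x \<le> real M" unfolding M_def by (rule real_nat_ceiling_ge)
    \<comment> \<open>As \<open>x \<ge> 1\<close>, rounding up at most doubles it; this is the
      \<open>ln 2\<close> in the bound on \<open>ln M\<close>.\<close>
    have Mx2: "real M \<le> 2 * x"
    proof -
      have "real M \<le> x + 1" unfolding M_def using x1 by linarith
      then show ?thesis using x1 by simp
    qed
    have M0: "M > 0" using Mx x1 by (cases M) auto
    have Mr: "real M > 0" using M0 by simp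
    have "ln (real M) \<le> ln (2 * x)" using Mx2 M0 x1 by simp
    also have "\<dots> = ln 2 + real n * (info + 2 * \<epsilon>)" using x1 by (simp add: ln_mult x_def)
    finally have lnM: "ln (real M) \<le> ln 2 + real n * (info + 2 * \<epsilon>)" .
    have T1: "B powr (- \<theta>) * exp (real n * (\<theta> * info + \<theta>\<^sup>2 * cS)) \<le> exp (- (\<theta> * \<epsilon> / 2)) ^ n"
    proof -
      have "B powr (- \<theta>) * exp (real n * (\<theta> * info + \<theta>\<^sup>2 * cS)) = exp (real n * (- \<theta> * \<epsilon> + \<theta> * (\<theta> * cS)))"
        by (simp add: B_def powr_def exp_add[symmetric] algebra_simps power2_eq_square)
      also have "\<dots> \<le> exp (real n * (- \<theta> * \<epsilon> + \<theta> * (\<epsilon> / 2)))"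
      proof -
        have "\<theta> * (\<theta> * cS) \<le> \<theta> * (\<epsilon> / 2)" using \<theta>C \<theta> by (intro mult_left_mono) auto
        then have "real n * (- \<theta> * \<epsilon> + \<theta> * (\<theta> * cS)) \<le> real n * (- \<theta> * \<epsilon> + \<theta> * (\<epsilon> / 2))"
          by (intro mult_left_mono[OF add_left_mono]) auto
        then show ?thesis by (simp only: exp_le_cancel_iff)
      qed
      also have "\<dots> = exp (- (\<theta> * \<epsilon> / 2)) ^ n"
        unfolding exp_of_nat_mult[symmetric] by (simp add: algebra_simps)
      finally show ?thesis .
    qed
    have T3: "B / (M * \<delta>) \<le> 1 / \<delta> * exp (- \<epsilon>) ^ n"
    proof -
      have "B = x * exp (- \<epsilon>) ^ n"
        unfolding B_def x_def exp_of_nat_mult[symmetric] exp_add[symmetric] by (simp add: algebra_simps)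
      also have "\<dots> \<le> M * exp (- \<epsilon>) ^ n" using Mx by (intro mult_right_mono) auto
      finally show ?thesis using Mr \<delta> by (simp add: field_simps)
    qed
    have T4: "real n * C1 / (M * \<eta>\<^sup>2) \<le> C1 / \<eta>\<^sup>2 * (real n * exp (- \<epsilon>) ^ n)"
    proof -
      have "exp \<epsilon> ^ n \<le> x"
        unfolding x_def exp_of_nat_mult[symmetric] exp_le_cancel_iff
        using info_nonneg \<epsilon> by (intro mult_left_mono) auto
      then have "exp \<epsilon> ^ n \<le> M" using Mx by simp
      then have "1 \<le> M * exp (- \<epsilon>) ^ n" by (simp add: exp_minus power_inverse field_simps)
      then have "real n * C1 / (M * \<eta>\<^sup>2) * 1 \<le> real n * C1 / (M * \<eta>\<^sup>2) * (M * exp (- \<epsilon>) ^ n)"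
        using C1 by (intro mult_left_mono) auto
      also have "\<dots> = C1 / \<eta>\<^sup>2 * (real n * exp (- \<epsilon>) ^ n)" using Mr by simp
      finally show ?thesis by simp
    qed
    have "\<exists>C. (\<forall>z<M. C z \<in> words n) \<and> (\<integral>x. max 0 (1 - mix n M C x) \<partial>Xn n) \<le> b
       \<and> (\<forall>t<n. \<forall>s\<in>S. freq M C t s \<le> (1 + \<eta>) * p s)"
    proof (rule exists_codebook[OF M0 _ \<delta> \<theta> \<eta> _ b(2)])
      show "B > 0" by (simp add: B_def)
      show "B powr (- \<theta>) * exp (real n * (\<theta> * info + \<theta>\<^sup>2 * cS))
          + \<delta> + B / (M * \<delta>) + real n * (\<Sum>s\<in>S. 1 / p s) / (M * \<eta>\<^sup>2) \<le> b"
        using T1 T3 T4 elim unfolding C1_def[symmetric] \<delta>_def by linarith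
    qed
    then show ?case using M0 lnM by blast
  qed
qed

lemma achievable:
  assumes Gs: "\<And>s. s \<in> S \<Longrightarrow> Gs s \<in> space (prob_algebra borel)"
    and Gs_mix: "\<And>\<phi>. \<phi> \<in> borel_measurable borel \<Longrightarrow>
      (\<Sum>s\<in>S. ennreal (p s) * (\<integral>\<^sup>+ y. \<phi> y \<partial>Gs s)) = (\<integral>\<^sup>+ y. \<phi> y \<partial>pX)"
    and d: "d pX pX = 0"
    and \<Delta>: "(\<lambda>r. \<Delta> (fst r) (snd r)) \<in> borel_measurable (borel \<Otimes>\<^sub>M borel)"
    and dist: "enn2ereal (\<Sum>s\<in>S. \<integral>\<^sup>+ x. ennreal (q s x) * (\<integral>\<^sup>+ y. ennreal (\<Delta> x y) \<partial>Gs s) \<partial>pX) \<le> ereal D"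
    and R: "info < R"
  shows "achievable_pr pX \<Delta> d D 0 R"
proof -
  \<comment> \<open>Five shares: one for the overhead \<open>2 * ln 2\<close> (rounding
    \<open>M\<close>, and the two halves of the index set), two for the codebook exponent, two for
    the fallback entropy.\<close>
  define \<epsilon> where "\<epsilon> = (R - info) / 5"
  have \<epsilon>: "\<epsilon> > 0" using R by (simp add: \<epsilon>_def)
  define c where "c = ln (real (card S))"
  have c: "c \<ge> 0" using S_nonempty by (simp add: c_def)
  \<comment> \<open>These make \<open>(2 * \<eta> + \<beta>) * c \<le> 2 * \<epsilon>\<close>, where
    \<open>2 * \<eta> + \<beta>\<close> will bound the fallback probability; \<open>c + 1\<close>
    guards against \<open>c = 0\<close>, the case of a single letter.\<close>
  define \<eta> where "\<eta> = min (1 / 2) (\<epsilon> / (2 * (c + 1)))"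
  define \<beta> where "\<beta> = min 1 (\<epsilon> / (c + 1))"
  have \<eta>: "0 < \<eta>" "\<eta> < 1" using \<epsilon> c by (auto simp: \<eta>_def)
  have \<beta>: "0 < \<beta>" "\<beta> \<le> 1" using \<epsilon> c by (auto simp: \<beta>_def)
  have "\<eta> \<le> \<epsilon> / (2 * (c + 1))" "\<beta> \<le> \<epsilon> / (c + 1)" by (simp_all add: \<eta>_def \<beta>_def)
  then have "2 * \<eta> * (c + 1) \<le> \<epsilon>" "\<beta> * (c + 1) \<le> \<epsilon>" using c by (simp_all add: field_simps)
  then have sm: "(2 * \<eta> + \<beta>) * c \<le> 2 * \<epsilon>"
    using \<eta> \<beta> by (simp add: algebra_simps)
  have "(\<lambda>n. (2 * ln 2) / real n) \<longlonglongrightarrow> 0"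
    by (rule lim_const_over_n)
  then have "\<forall>\<^sub>F n in sequentially. (2 * ln 2) / real n < \<epsilon>"
    using \<epsilon> by (intro order_tendstoD(2)[where y=0]) auto
  then show ?thesis
    unfolding achievable_pr_def
    using eventually_code_rate[OF \<epsilon> \<eta>(1) \<beta>] eventually_gt_at_top[of 0]
  proof eventually_elim
    case (elim n)
    then obtain C M where M: "M > 0" and lnM: "ln (real M) \<le> ln 2 + real n * (info + 2 * \<epsilon>)"
      and C: "\<And>z. z < M \<Longrightarrow> C z \<in> words n"
      and cov: "(\<integral>x. max 0 (1 - mix n M C x) \<partial>Xn n) \<le> \<beta>"
      and fr: "\<And>t s. t < n \<Longrightarrow> s \<in> S \<Longrightarrow> freq M C t s \<le> (1 + \<eta>) * p s" by blast
    have n: "n > 0" using elim by simp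
    obtain b where b: "bij_betw b {..<card (words n)} (words n)"
      using ex_bij_betw_nat_finite[OF words_finite, of n] by (auto simp: atLeast0LessThan)
    interpret cb: codebook pX S q p n M C \<eta> b Gs
      by unfold_locales (use M C \<eta> fr b Gs Gs_mix in auto)
    have ent: "enn2ereal (disc_entropy (Xn n \<bind> cb.E)) / ereal (real n) \<le> ereal R"
    proof -
      have "cb.\<rho> \<le> 2 * \<eta> + \<beta>"
      proof -
        have "cb.\<rho> \<le> 1 - cb.\<alpha> + 1 * \<beta>"
          unfolding cb.\<rho>_eq using cov cb.\<alpha>
          by (intro add_left_mono mult_mono) (auto intro: integral_nonneg_AE)
        moreover have "1 - cb.\<alpha> \<le> 2 * \<eta>"
          unfolding cb.\<alpha>_def using \<eta> by (simp add: field_simps)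
        ultimately show ?thesis by simp
      qed
      then have "cb.\<rho> * (real n * c) \<le> (2 * \<eta> + \<beta>) * (real n * c)"
        using c by (intro mult_right_mono) auto
      also have "\<dots> = real n * ((2 * \<eta> + \<beta>) * c)" by simp
      also have "\<dots> \<le> real n * (2 * \<epsilon>)" using sm by (intro mult_left_mono) auto
      finally have r: "cb.\<rho> * ln (real (card (words n))) \<le> real n * (2 * \<epsilon>)"
        using S_nonempty by (simp add: card_words ln_realpow c_def)
      have "2 * ln 2 \<le> real n * \<epsilon>"
        using elim(1) n by (simp add: field_simps)
      then have "ln 2 + ln (real M) + cb.\<rho> * ln (real (card (words n))) \<le> real n * \<epsilon> + real n * (info + 2 * \<epsilon>) + real n * (2 * \<epsilon>)"
        using lnM r by linarith
      also have "\<dots> = real n * R"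
      proof -
        have "R = info + 5 * \<epsilon>" unfolding \<epsilon>_def by (simp add: field_simps)
        then show ?thesis by (simp add: algebra_simps)
      qed
      finally have "disc_entropy (Xn n \<bind> cb.E) \<le> ennreal (real n * R)"
        using cb.entropy_le by (meson ennreal_leI order_trans)
      then have "enn2ereal (disc_entropy (Xn n \<bind> cb.E)) \<le> enn2ereal (ennreal (real n * R))"
        by (simp add: less_eq_ennreal.rep_eq)
      also have "\<dots> = ereal (real n * R)"
        using R info_nonneg by simp
      finally have "enn2ereal (disc_entropy (Xn n \<bind> cb.E)) \<le> ereal (real n) * ereal R" by simp
      then show ?thesis using n by (subst ereal_divide_le_pos) auto
    qed
    have J: "(\<integral>\<^sup>+ r. ennreal (\<Delta> (fst r t) (snd r t)) \<partial>cb.BC.J) = (\<Sum>s\<in>S. \<integral>\<^sup>+ x. ennreal (q s x) * (\<integral>\<^sup>+ y. ennreal (\<Delta> x y) \<partial>Gs s) \<partial>pX)" if "t < n" for t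
      using cb.nn_integral_J_exact[OF that, of "\<lambda>r. ennreal (\<Delta> (fst r) (snd r))"] \<Delta> by simp
    have dis: "(\<Sum>t<n. enn2ereal (\<integral>\<^sup>+ r. ennreal (\<Delta> (fst r t) (snd r t)) \<partial>cb.BC.J)) / ereal (real n) \<le> ereal D"
    proof -
      have "(\<Sum>t<n. enn2ereal (\<integral>\<^sup>+ r. ennreal (\<Delta> (fst r t) (snd r t)) \<partial>cb.BC.J)) \<le> (\<Sum>t<n. ereal D)"
        using dist by (intro sum_mono) (simp add: J)
      also have "\<dots> = ereal (real n) * ereal D" by simp
      finally show ?thesis using n by (subst ereal_divide_le_pos) auto
    qed
    have per: "enn2ereal (d pX (distr cb.BC.J borel (\<lambda>p. snd p t))) \<le> ereal 0" if "t < n" for t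
      unfolding cb.marginal_exact[OF that] d by (simp add: zero_ennreal.rep_eq)
    show ?case
      by (intro exI[of _ cb.E] exI[of _ cb.G] conjI cb.E_kernel cb.G_kernel)
         (use ent dis per in \<open>simp_all add: Let_def cb.BC.J_def\<close>)
  qed
qed

end

section \<open>The main theorem\<close>

lemma nn_integral_finite_support:
  fixes \<nu> :: "'x::t1_space measure"
  assumes s: "sets \<nu> = sets borel" and S: "finite S" and ae: "AE y in \<nu>. y \<in> S"
    and f: "f \<in> borel_measurable borel"
  shows "(\<integral>\<^sup>+ y. f y \<partial>\<nu>) = (\<Sum>s\<in>S. emeasure \<nu> {s} * f s)"
proof -
  have pt: "{u} \<in> sets \<nu>" for u by (simp add: s)
  have "(\<integral>\<^sup>+ y. f y \<partial>\<nu>) = (\<integral>\<^sup>+ y. (\<Sum>s\<in>S. f s * indicator {s} y) \<partial>\<nu>)"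
  proof (intro nn_integral_cong_AE, use ae in eventually_elim)
    case (elim y)
    have "(\<Sum>s\<in>S. f s * indicator {s} y) = (\<Sum>s\<in>S. if y = s then f y else 0)"
      by (intro sum.cong) (auto simp: indicator_def)
    then show ?case using S elim by simp
  qed
  also have "\<dots> = (\<Sum>s\<in>S. \<integral>\<^sup>+ y. f s * indicator {s} y \<partial>\<nu>)"
    using pt by (intro nn_integral_sum) auto
  also have "\<dots> = (\<Sum>s\<in>S. emeasure \<nu> {s} * f s)"
    using pt by (intro sum.cong refl) (simp add: nn_integral_cmult_indicator mult.commute)
  finally show ?thesis .
qed

text \<open>Turns kernels of the kind given by (A3) into a \<open>scheme\<close>. \<open>Q x\<close>
  may leave the finite set for a null set of \<open>x\<close>, and some of its points may have
  probability zero; both defects are removed on null sets, which changes neither mutual information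
  nor distortion.\<close>

lemma achievable_of_finite_support:
  fixes pX :: "'x::polish_space measure"
  assumes pX: "pX \<in> space (prob_algebra borel)"
    and \<Delta>: "(\<lambda>r. \<Delta> (fst r) (snd r)) \<in> borel_measurable (borel \<Otimes>\<^sub>M borel)"
    and d: "d pX pX = 0"
    and Q: "Q \<in> borel \<rightarrow>\<^sub>M prob_algebra borel" and r: "r \<in> borel \<rightarrow>\<^sub>M prob_algebra borel"
    and S0: "finite S0" "emeasure (pX \<bind> Q) S0 = 1"
    and mi: "mutual_info (joint pX Q) < ereal R"
    and dist: "enn2ereal (\<integral>\<^sup>+ p. ennreal (\<Delta> (fst p) (snd p)) \<partial>(joint pX (\<lambda>x. Q x \<bind> r))) \<le> ereal D"
    and mix: "pX \<bind> Q \<bind> r = pX"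
  shows "achievable_pr pX \<Delta> d D 0 R"
proof -
  interpret X: prob_space pX using pX by (simp add: space_prob_algebra)
  have spX: "sets pX = sets borel" using pX by (simp add: space_prob_algebra)
  have sp: "space pX = UNIV" using sets_eq_imp_space_eq[OF spX] by simp
  define \<nu> where "\<nu> = pX \<bind> Q"
  have \<nu>: "\<nu> \<in> space (prob_algebra borel)"
    using prob_space_bind'[OF pX Q] sets_bind'[OF pX Q] by (simp add: \<nu>_def space_prob_algebra)
  then interpret N: prob_space \<nu> by (simp add: space_prob_algebra)
  have s\<nu>: "sets \<nu> = sets borel" using \<nu> by (simp add: space_prob_algebra)
  have Qx: "prob_space (Q x)" "sets (Q x) = sets borel" for x
    using measurable_space[OF Q, of x] by (auto simp: space_prob_algebra)
  define p where "p = (\<lambda>s. measure \<nu> {s})"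
  \<comment> \<open>Points of probability zero are dropped because \<open>q s x\<close> is going to
    be divided by \<open>p s\<close>.\<close>
  define S where "S = {s \<in> S0. p s > 0}"
  have S: "finite S" using S0 by (simp add: S_def)
  have p_pos: "0 < p s" if "s \<in> S" for s using that by (simp add: S_def)
  have fs: "T \<in> sets borel" if "finite T" for T :: "'x set"
    using that by (intro borel_closed finite_imp_closed)
  have aeS: "AE y in \<nu>. y \<in> S"
  proof -
    have "AE y in \<nu>. y \<in> S0"
      using S0 by (intro N.AE_prob_1) (simp add: measure_def \<nu>_def)
    moreover have "AE y in \<nu>. \<forall>s\<in>{s\<in>S0. p s = 0}. y \<noteq> s"
    proof (intro AE_finite_allI)
      fix s assume "s \<in> {s \<in> S0. p s = 0}"
      then have "{s} \<in> null_sets \<nu>"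
        by (intro null_setsI) (auto simp: N.emeasure_eq_measure p_def s\<nu>)
      from AE_not_in[OF this] show "AE y in \<nu>. y \<noteq> s" by simp
    qed (use S0 in auto)
    ultimately show ?thesis
    proof eventually_elim
      case (elim y)
      have "0 \<le> p y" by (simp add: p_def)
      then show ?case using elim by (force simp: S_def)
    qed
  qed
  have aeQ: "AE x in pX. AE y in Q x. y \<in> S"
  proof -
    have "Measurable.pred borel (\<lambda>y. y \<in> S)" using fs[OF S] by simp
    then show ?thesis
      using aeS unfolding \<nu>_def
      by (subst (asm) AE_bind[OF measurable_prob_algebraD[OF Q[folded measurable_cong_sets[OF spX refl]]]]) auto
  qed
  have Qm: "(\<lambda>x. measure (Q x) {s}) \<in> borel_measurable borel" for s
    by (rule measurable_compose[OF measurable_prob_algebraD[OF Q]]) measurable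
  \<comment> \<open>A \<open>scheme\<close> needs rows summing to 1 for every \<open>x\<close>; on
    the exceptional null set the row is replaced by \<open>p\<close>.\<close>
  define good where "good = (\<lambda>x. (\<Sum>s\<in>S. measure (Q x) {s}) = 1)"
  define q where "q = (\<lambda>s x. if good x then measure (Q x) {s} else p s)"
  have emQ: "emeasure (Q x) {s} = ennreal (measure (Q x) {s})" for x s
    by (simp add: finite_measure.emeasure_eq_measure[OF prob_space.finite_measure[OF Qx(1)]])
  have em\<nu>: "emeasure \<nu> {s} = ennreal (p s)" for s
    by (simp add: N.emeasure_eq_measure p_def)
  have p_sum: "(\<Sum>s\<in>S. p s) = 1"
  proof -
    have "ennreal (\<Sum>s\<in>S. p s) = (\<Sum>s\<in>S. emeasure \<nu> {s} * 1)"
      by (simp add: em\<nu> sum_ennreal p_def)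
    also have "\<dots> = 1"
      using nn_integral_finite_support[OF s\<nu> S aeS, of "\<lambda>_. 1"] N.emeasure_space_1 by simp
    finally show ?thesis by (simp add: p_def sum_nonneg)
  qed
  have ae: "AE x in pX. (AE y in Q x. y \<in> S) \<and> good x"
    using aeQ
  proof eventually_elim
    case (elim x)
    have "ennreal (\<Sum>s\<in>S. measure (Q x) {s}) = (\<Sum>s\<in>S. emeasure (Q x) {s} * 1)"
      by (simp add: emQ sum_ennreal)
    also have "\<dots> = 1"
      using nn_integral_finite_support[OF Qx(2) S elim, of "\<lambda>_. 1"] prob_space.emeasure_space_1[OF Qx(1), of x] by simp
    finally show ?case using elim by (simp add: good_def sum_nonneg)
  qed
  have q_eq: "AE x in pX. \<forall>f\<in>borel_measurable borel. (\<integral>\<^sup>+ y. f y \<partial>Q x) = (\<Sum>s\<in>S. ennreal (q s x) * f s)"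
    using ae
  proof eventually_elim
    case (elim x)
    then show ?case
      using nn_integral_finite_support[OF Qx(2) S, of x] by (simp add: q_def emQ)
  qed
  have qm: "q s \<in> borel_measurable borel" for s
  proof -
    note [measurable] = Qm
    show ?thesis unfolding q_def good_def by measurable
  qed
  have qm': "q s \<in> borel_measurable pX" for s
    using qm by (simp add: measurable_cong_sets[OF spX refl])
  interpret scheme pX S q p
  proof
    fix s assume s: "s \<in> S"
    have "(\<integral>\<^sup>+ x. ennreal (q s x) \<partial>pX) = (\<integral>\<^sup>+ x. emeasure (Q x) {s} \<partial>pX)"
      by (intro nn_integral_cong_AE, use ae in eventually_elim) (simp add: q_def emQ)
    also have "\<dots> = emeasure \<nu> {s}"
      unfolding \<nu>_def by (rule emeasure_bind_prob_algebra[OF pX Q, symmetric]) simp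
    finally show "(\<integral>\<^sup>+ x. ennreal (q s x) \<partial>pX) = ennreal (p s)" by (simp add: em\<nu>)
  next
    fix x show "(\<Sum>s\<in>S. q s x) = 1"
      by (cases "good x") (simp_all add: q_def p_sum, simp add: good_def)
  qed (use pX S qm p_pos in \<open>auto simp: q_def p_def\<close>)
  \<comment> \<open>The density of the joint law relative to
    \<open>pX \<Otimes>\<^sub>M \<nu>\<close>. As \<open>\<nu>\<close> lives on the points of
    \<open>S\<close>, only the values \<open>q s x / p s\<close> there matter.\<close>
  define h where "h = (\<lambda>(x, y). \<Sum>s\<in>S. indicator {s} y * (q s x / p s))"
  have h_meas: "h \<in> borel_measurable (borel \<Otimes>\<^sub>M borel)"
  proof -
    note [measurable] = qm
    show ?thesis unfolding h_def by measurable
  qed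
  have h0: "0 \<le> h r" for r
    unfolding h_def using q_nonneg p_pos by (auto simp: split_beta intro!: sum_nonneg mult_nonneg_nonneg divide_nonneg_pos)
  have h_s: "h (x, s) = q s x / p s" if "s \<in> S" for x s
  proof -
    have "h (x, s) = (\<Sum>s'\<in>S. if s = s' then q s' x / p s' else 0)"
      unfolding h_def by (auto intro!: sum.cong simp: indicator_def)
    then show ?thesis using S that by simp
  qed
  have int\<nu>: "(\<integral>\<^sup>+ w. F w \<partial>(pX \<Otimes>\<^sub>M \<nu>)) = (\<integral>\<^sup>+ x. (\<Sum>s\<in>S. ennreal (p s) * F (x, s)) \<partial>pX)"
    if F: "F \<in> borel_measurable (borel \<Otimes>\<^sub>M borel)" for F :: "'x \<times> 'x \<Rightarrow> ennreal"
  proof -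
    have spp: "sets (pX \<Otimes>\<^sub>M \<nu>) = sets (borel \<Otimes>\<^sub>M borel)"
      by (intro sets_pair_measure_cong spX s\<nu>)
    have "(\<integral>\<^sup>+ w. F w \<partial>(pX \<Otimes>\<^sub>M \<nu>)) = (\<integral>\<^sup>+ x. \<integral>\<^sup>+ y. F (x, y) \<partial>\<nu> \<partial>pX)"
      using F by (intro N.nn_integral_fst[symmetric]) (simp add: measurable_cong_sets[OF spp refl])
    also have "\<dots> = (\<integral>\<^sup>+ x. (\<Sum>s\<in>S. ennreal (p s) * F (x, s)) \<partial>pX)"
    proof (intro nn_integral_cong)
      fix x
      have "(\<lambda>y. F (x, y)) \<in> borel_measurable borel"
        using measurable_compose[OF measurable_Pair1' F, of x] by simp
      from nn_integral_finite_support[OF s\<nu> S aeS this]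
      show "(\<integral>\<^sup>+ y. F (x, y) \<partial>\<nu>) = (\<Sum>s\<in>S. ennreal (p s) * F (x, s))" by (simp add: em\<nu>)
    qed
    finally show ?thesis .
  qed
  have "mutual_info (joint pX Q) = enn2ereal (\<integral>\<^sup>+ w. ennreal (psi (h w)) \<partial>(pX \<Otimes>\<^sub>M (pX \<bind> Q)))"
  proof (rule mutual_info_joint[OF pX Q h_meas h0])
    fix F :: "'x \<times> 'x \<Rightarrow> ennreal" assume F: "F \<in> borel_measurable (borel \<Otimes>\<^sub>M borel)"
    have "(\<integral>\<^sup>+ w. F w \<partial>joint pX Q) = (\<integral>\<^sup>+ x. \<integral>\<^sup>+ y. F (x, y) \<partial>Q x \<partial>pX)"
      by (rule nn_integral_joint[OF pX Q F])
    also have "\<dots> = (\<integral>\<^sup>+ x. (\<Sum>s\<in>S. ennreal (q s x) * F (x, s)) \<partial>pX)"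
    proof (intro nn_integral_cong_AE, use q_eq in eventually_elim)
      case (elim x)
      have "(\<lambda>y. F (x, y)) \<in> borel_measurable borel"
        using measurable_compose[OF measurable_Pair1' F, of x] by simp
      with elim show ?case by blast
    qed
    also have "\<dots> = (\<integral>\<^sup>+ x. (\<Sum>s\<in>S. ennreal (p s) * (ennreal (h (x, s)) * F (x, s))) \<partial>pX)"
    proof (intro nn_integral_cong sum.cong refl)
      fix x s assume s: "s \<in> S"
      have "ennreal (q s x) = ennreal (p s) * ennreal (h (x, s))"
        using p_pos[OF s] q_nonneg[OF s, of x] by (subst ennreal_mult[symmetric]) (auto simp: h_s[OF s])
      then show "ennreal (q s x) * F (x, s) = ennreal (p s) * (ennreal (h (x, s)) * F (x, s))"
        by (simp add: mult.assoc)
    qed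
    also have "\<dots> = (\<integral>\<^sup>+ w. ennreal (h w) * F w \<partial>(pX \<Otimes>\<^sub>M \<nu>))"
      using h_meas F by (subst int\<nu>) auto
    finally show "(\<integral>\<^sup>+ w. F w \<partial>joint pX Q) = (\<integral>\<^sup>+ w. ennreal (h w) * F w \<partial>(pX \<Otimes>\<^sub>M (pX \<bind> Q)))"
      by (simp add: \<nu>_def)
  qed
  also have "(\<integral>\<^sup>+ w. ennreal (psi (h w)) \<partial>(pX \<Otimes>\<^sub>M (pX \<bind> Q))) = (\<integral>\<^sup>+ x. (\<Sum>s\<in>S. ennreal (p s) * ennreal (psi (h (x, s)))) \<partial>pX)"
    unfolding \<nu>_def[symmetric] using h_meas by (intro int\<nu>) auto
  also have "\<dots> = (\<integral>\<^sup>+ x. ennreal (idens x) \<partial>pX)"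
  proof (intro nn_integral_cong)
    fix x
    have nn: "0 \<le> psi (q s x / p s)" if "s \<in> S" for s
      using q_nonneg[OF that] p_pos[OF that] by (intro psi_nonneg divide_nonneg_pos)
    have "ennreal (idens x) = (\<Sum>s\<in>S. ennreal (p s * psi (q s x / p s)))"
      unfolding idens_def using nn p_pos by (intro sum_ennreal[symmetric]) (auto intro: mult_nonneg_nonneg less_imp_le)
    also have "\<dots> = (\<Sum>s\<in>S. ennreal (p s) * ennreal (psi (h (x, s))))"
      using nn p_pos by (intro sum.cong refl) (simp add: h_s ennreal_mult less_imp_le)
    finally show "(\<Sum>s\<in>S. ennreal (p s) * ennreal (psi (h (x, s)))) = ennreal (idens x)" by simp
  qed
  also have "\<dots> = ennreal info"
    unfolding info_def using idens_nonneg by (intro nn_integral_eq_integral idens_integrable) auto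
  finally have "mutual_info (joint pX Q) = ereal info" using info_nonneg by simp
  then have info: "info < R" using mi by simp
  show ?thesis
  proof (rule achievable[where Gs=r])
    fix s show "r s \<in> space (prob_algebra borel)" using measurable_space[OF r, of s] by simp
  next
    fix \<phi> :: "'x \<Rightarrow> ennreal" assume \<phi>: "\<phi> \<in> borel_measurable borel"
    have rm: "(\<lambda>s. \<integral>\<^sup>+ y. \<phi> y \<partial>r s) \<in> borel_measurable borel"
      by (rule measurable_compose[OF measurable_prob_algebraD[OF r] nn_integral_measurable_subprob_algebra[OF \<phi>]])
    have "(\<integral>\<^sup>+ y. \<phi> y \<partial>pX) = (\<integral>\<^sup>+ y. \<phi> y \<partial>(\<nu> \<bind> r))" unfolding \<nu>_def mix ..
    also have "\<dots> = (\<integral>\<^sup>+ s. \<integral>\<^sup>+ y. \<phi> y \<partial>r s \<partial>\<nu>)" by (rule nn_integral_bind_prob_algebra[OF \<nu> r \<phi>])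
    also have "\<dots> = (\<Sum>s\<in>S. ennreal (p s) * (\<integral>\<^sup>+ y. \<phi> y \<partial>r s))"
      using nn_integral_finite_support[OF s\<nu> S aeS rm] by (simp add: em\<nu>)
    finally show "(\<Sum>s\<in>S. ennreal (p s) * (\<integral>\<^sup>+ y. \<phi> y \<partial>r s)) = (\<integral>\<^sup>+ y. \<phi> y \<partial>pX)" by simp
  next
    have K: "(\<lambda>x. Q x \<bind> r) \<in> borel \<rightarrow>\<^sub>M prob_algebra borel"
      by (rule measurable_bind_prob_space[OF Q r])
    have \<Delta>': "(\<lambda>w. ennreal (\<Delta> (fst w) (snd w))) \<in> borel_measurable (borel \<Otimes>\<^sub>M borel)" using \<Delta> by simp
    have \<Delta>x: "(\<lambda>y. ennreal (\<Delta> x y)) \<in> borel_measurable borel" for x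
      using measurable_compose[OF measurable_Pair1' \<Delta>', of x] by simp
    have rm: "(\<lambda>s. \<integral>\<^sup>+ y. ennreal (\<Delta> x y) \<partial>r s) \<in> borel_measurable borel" for x
      by (rule measurable_compose[OF measurable_prob_algebraD[OF r] nn_integral_measurable_subprob_algebra[OF \<Delta>x]])
    have "(\<integral>\<^sup>+ w. ennreal (\<Delta> (fst w) (snd w)) \<partial>(joint pX (\<lambda>x. Q x \<bind> r)))
        = (\<integral>\<^sup>+ x. \<integral>\<^sup>+ y. ennreal (\<Delta> x y) \<partial>(Q x \<bind> r) \<partial>pX)"
      by (subst nn_integral_joint[OF pX K \<Delta>']) simp
    also have "\<dots> = (\<integral>\<^sup>+ x. \<integral>\<^sup>+ s. \<integral>\<^sup>+ y. ennreal (\<Delta> x y) \<partial>r s \<partial>Q x \<partial>pX)"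
      using Qx by (intro nn_integral_cong nn_integral_bind_prob_algebra[OF _ r \<Delta>x]) (simp add: space_prob_algebra)
    also have "\<dots> = (\<integral>\<^sup>+ x. (\<Sum>s\<in>S. ennreal (q s x) * (\<integral>\<^sup>+ y. ennreal (\<Delta> x y) \<partial>r s)) \<partial>pX)"
      by (intro nn_integral_cong_AE, use q_eq in eventually_elim) (use rm in blast)
    also have "\<dots> = (\<Sum>s\<in>S. \<integral>\<^sup>+ x. ennreal (q s x) * (\<integral>\<^sup>+ y. ennreal (\<Delta> x y) \<partial>r s) \<partial>pX)"
    proof (intro nn_integral_sum borel_measurable_times_ennreal)
      fix s
      have rs: "prob_space (r s)" "sets (r s) = sets borel"
        using measurable_space[OF r, of s] by (auto simp: space_prob_algebra)
      interpret R: prob_space "r s" by (rule rs)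
      have "sets (borel \<Otimes>\<^sub>M r s) = sets (borel \<Otimes>\<^sub>M borel)" by (intro sets_pair_measure_cong refl rs)
      note sr = measurable_cong_sets[OF this refl]
      have "(\<lambda>x. \<integral>\<^sup>+ y. ennreal (\<Delta> x y) \<partial>r s) \<in> borel_measurable borel"
        using \<Delta>' by (intro R.borel_measurable_nn_integral) (simp add: sr case_prod_beta')
      then show "(\<lambda>x. \<integral>\<^sup>+ y. ennreal (\<Delta> x y) \<partial>r s) \<in> borel_measurable pX"
        by (simp add: measurable_cong_sets[OF spX refl])
      show "(\<lambda>x. ennreal (q s x)) \<in> borel_measurable pX" using qm'[of s] by simp
    qed
    finally show "enn2ereal (\<Sum>s\<in>S. \<integral>\<^sup>+ x. ennreal (q s x) * (\<integral>\<^sup>+ y. ennreal (\<Delta> x y) \<partial>r s) \<partial>pX) \<le> ereal D"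
      using dist by simp
  qed (use d \<Delta> info in auto)
qed

theorem theorem4:
  fixes pX :: "'x::polish_space measure"
    and \<Delta> :: "'x \<Rightarrow> 'x \<Rightarrow> real"
    and d :: "'x measure \<Rightarrow> 'x measure \<Rightarrow> ennreal"
    and D :: real
  assumes pX: "pX \<in> space (prob_algebra borel)"
    and \<Delta>_meas: "(\<lambda>p. \<Delta> (fst p) (snd p)) \<in> borel_measurable (borel \<Otimes>\<^sub>M borel)"
    and \<Delta>_nonneg: "\<forall>x y. 0 \<le> \<Delta> x y"
    and \<Delta>_zero: "\<forall>x y. \<Delta> x y = 0 \<longleftrightarrow> x = y"
    and d_zero: "\<forall>\<mu>\<in>space (prob_algebra borel). \<forall>\<nu>\<in>space (prob_algebra borel).
                   d \<mu> \<nu> = 0 \<longleftrightarrow> \<mu> = \<nu>"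
    and A1: "A1 d"
    and A3: "A3 pX \<Delta> d"
    and D_pos: "D > 0"
  shows "R_pr pX \<Delta> d D 0 = RDP pX \<Delta> d D 0"
proof (rule antisym)
  have d0: "d pX pX = 0" using d_zero pX by blast
  show "R_pr pX \<Delta> d D 0 \<le> RDP pX \<Delta> d D 0"
  \<comment> \<open>It suffices to bound \<open>R_pr\<close> by every \<open>y\<close> above the
    right side; an infinite right side is thereby covered too.\<close>
  proof (rule dense_ge)
    fix y assume "RDP pX \<Delta> d D 0 < y"
    then obtain a where a: "RDP pX \<Delta> d D 0 < ereal a" "ereal a < y" using ereal_dense2 by blast
    obtain c where c: "RDP pX \<Delta> d D 0 < ereal c" "ereal c < ereal a" using ereal_dense2[OF a(1)] by blast
    \<comment> \<open>Half the gap, so that \<open>c + \<epsilon> < a\<close> keeps the strict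
      inequality between information and rate that the coding argument needs.\<close>
    define \<epsilon> where "\<epsilon> = (a - c) / 2"
    have \<epsilon>: "\<epsilon> > 0" using c by (simp add: \<epsilon>_def)
    obtain S Q r where Q: "Q \<in> borel \<rightarrow>\<^sub>M prob_algebra borel" and r: "r \<in> borel \<rightarrow>\<^sub>M prob_algebra borel"
      and S: "finite S" "emeasure (pX \<bind> Q) S = 1"
      and mi: "mutual_info (joint pX Q) \<le> RDP pX \<Delta> d D 0 + ereal \<epsilon>"
      and dist: "enn2ereal (\<integral>\<^sup>+ p. ennreal (\<Delta> (fst p) (snd p)) \<partial>(joint pX (\<lambda>x. Q x \<bind> r))) \<le> ereal D"
      and mix: "pX \<bind> Q \<bind> r = pX"
      using A3 D_pos \<epsilon> unfolding A3_def by meson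
    note mi
    also have "RDP pX \<Delta> d D 0 + ereal \<epsilon> \<le> ereal c + ereal \<epsilon>" using c by (intro add_right_mono) auto
    also have "\<dots> < ereal a" using c by (simp add: \<epsilon>_def field_simps)
    finally have "mutual_info (joint pX Q) < ereal a" .
    from achievable_of_finite_support[where d=d, OF pX \<Delta>_meas d0 Q r S this dist mix]
    have "R_pr pX \<Delta> d D 0 \<le> ereal a" unfolding R_pr_def by (intro Inf_lower) auto
    with a(2) show "R_pr pX \<Delta> d D 0 \<le> y" by simp
  qed
  show "RDP pX \<Delta> d D 0 \<le> R_pr pX \<Delta> d D 0"
    unfolding R_pr_def
  proof (rule Inf_greatest, clarify)
    fix R assume "achievable_pr pX \<Delta> d D 0 R"
    \<comment> \<open>A single block length suffices for the converse; \<open>n > 0\<close> makes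
      the division by \<open>n\<close> meaningful.\<close>
    from eventually_happens[OF eventually_conj[OF this[unfolded achievable_pr_def] eventually_gt_at_top[of 0]]]
    obtain n E G where n: "n > 0"
      and E: "E \<in> PiM {..<n} (\<lambda>_. borel) \<rightarrow>\<^sub>M prob_algebra (count_space UNIV)"
      and G: "G \<in> count_space UNIV \<rightarrow>\<^sub>M prob_algebra (PiM {..<n} (\<lambda>_. borel))"
      and code: "let Xn = PiM {..<n} (\<lambda>_. pX);
            J = Xn \<bind> (\<lambda>x. E x \<bind> (\<lambda>z. distr (G z)
                   (PiM {..<n} (\<lambda>_. borel) \<Otimes>\<^sub>M PiM {..<n} (\<lambda>_. borel)) (Pair x)))
        in enn2ereal (disc_entropy (Xn \<bind> E)) / ereal (real n) \<le> ereal R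
         \<and> (\<Sum>t<n. enn2ereal (\<integral>\<^sup>+ p. ennreal (\<Delta> (fst p t) (snd p t)) \<partial>J)) / ereal (real n)
              \<le> ereal D
         \<and> (\<forall>t<n. enn2ereal (d pX (distr J borel (\<lambda>p. snd p t))) \<le> ereal 0)"
      by auto
    interpret BC: block_code pX n E G
      by unfold_locales (rule pX E G)+
    have H: "enn2ereal (disc_entropy (BC.Xn \<bind> E)) / ereal (real n) \<le> ereal R"
      and dist: "(\<Sum>t<n. enn2ereal (\<integral>\<^sup>+ p. ennreal (\<Delta> (fst p t) (snd p t)) \<partial>BC.J)) / ereal (real n) \<le> ereal D"
      and per: "\<And>t. t < n \<Longrightarrow> enn2ereal (d pX (distr BC.J borel (\<lambda>p. snd p t))) \<le> ereal 0"
      using code by (auto simp: Let_def BC.J_def)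
    \<comment> \<open>Zero divergence forces equality of laws, which supplies the exact realism
      assumed throughout the single-letter analysis.\<close>
    have marg: "distr BC.J borel (\<lambda>p. snd p t) = pX" if t: "t < n" for t
    proof -
      have "d pX (distr BC.J borel (\<lambda>p. snd p t)) = 0"
        using per[OF t] by (metis enn2ereal_nonneg antisym zero_ereal_def zero_ennreal.rep_eq enn2ereal_inject)
      then show ?thesis using d_zero pX BC.distr_J_component(1)[OF t] by metis
    qed
    from BC.RDP_le_entropy[where \<Delta>=\<Delta> and d=d, OF marg \<Delta>_meas n d0 dist] H
    show "RDP pX \<Delta> d D 0 \<le> ereal R" by (rule order_trans)
  qed
qed

end
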